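(* Let $(M,\varphi)$ be a manifold with coclosed $G_2$-structure. Then the linear map $$\widehat{\star\varphi}_2:\Omega^2(TM)\to\Omega^2(T^*M),\qquad Q\mapsto Q\lrcorner\star\varphi,$$ is an isomorphism.
   Context: A $G_2$-structure on a smooth $7$-manifold $M$ is a smooth $3$-form $\varphi$ such that for every $p\in M$ the pair $(T_pM,\varphi_p)$ is isomorphic to $(\mathbb{R}^7,\varphi_0)$, where $$\varphi_0=dx^{123}+dx^{145}+dx^{167}+dx^{246}-dx^{257}-dx^{347}-dx^{356},\quad dx^{ijk}=dx^i\wedge dx^j\wedge dx^k.$$ It determines an orientation, a Riemannian metric $g_\varphi$ and its volume form $\mathrm{Vol}_\varphi$, characterized by $(X\lrcorner\varphi)\wedge(Y\lrcorner\varphi)\wedge\varphi=6g_\varphi(X,Y)\mathrm{Vol}_\varphi$ for all vector fields $X,Y$; $\star$ denotes the Hodge star of $g_\varphi$. The $G_2$-structure is coclosed if $d\star\varphi=0$. $\Omega^2(TM)$ denotes smooth $2$-multivector fields (sections of $\Lambda^2TM$) and $\Omega^2(T^*M)$ smooth $2$-forms, with contraction $(X_1\wedge X_2)\lrcorner\phi=X_2\lrcorner X_1\lrcorner\phi$ extended linearly. *)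

theory Defs
  imports "HOL-Analysis.Analysis" "HOL-Library.Function_Algebras"
begin

section \<open>Function spaces as real vector spaces\<close>

text \<open>
  Tangent vectors, alternating forms and tensor fields are all represented by functions with
  pointwise operations, so that \<^const>\<open>subspace\<close>, \<^const>\<open>span\<close> and \<^const>\<open>dim\<close> apply to them.
\<close>

instantiation "fun" :: (type, scaleR) scaleR
begin
definition scaleR_fun :: "real \<Rightarrow> ('a \<Rightarrow> 'b) \<Rightarrow> 'a \<Rightarrow> 'b"
  where "scaleR_fun r f = (\<lambda>x. r *\<^sub>R f x)"
instance ..
end

instance "fun" :: (type, real_vector) real_vector
  by standard (simp_all add: scaleR_fun_def plus_fun_def fun_eq_iff algebra_simps)

definition linear_iso :: "'v::real_vector set \<Rightarrow> 'w::real_vector set \<Rightarrow> ('v \<Rightarrow> 'w) \<Rightarrow> bool" where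
  "linear_iso V W f \<longleftrightarrow> subspace V \<and> subspace W \<and>
     (\<forall>u\<in>V. \<forall>v\<in>V. f (u + v) = f u + f v) \<and>
     (\<forall>r. \<forall>v\<in>V. f (r *\<^sub>R v) = r *\<^sub>R f v) \<and>
     bij_betw f V W"


section \<open>Multilinear algebra on a subspace\<close>

text \<open>
  A \<open>k\<close>-form on the subspace \<open>V\<close> takes the list of its \<open>k\<close> arguments; it is \<open>0\<close> on every list
  that is not a list of \<open>k\<close> vectors of \<open>V\<close>, so that forms on \<open>V\<close> are equal iff they are equal
  as functions.
\<close>

definition alt_forms :: "'v::real_vector set \<Rightarrow> nat \<Rightarrow> ('v list \<Rightarrow> real) set" where
  "alt_forms V k = {\<alpha>.
     (\<forall>vs. \<not> (length vs = k \<and> set vs \<subseteq> V) \<longrightarrow> \<alpha> vs = 0) \<and>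
     (\<forall>vs i u v a b. length vs = k \<and> set vs \<subseteq> V \<and> i < k \<and> u \<in> V \<and> v \<in> V \<longrightarrow>
        \<alpha> (vs[i := a *\<^sub>R u + b *\<^sub>R v]) = a * \<alpha> (vs[i := u]) + b * \<alpha> (vs[i := v])) \<and>
     (\<forall>vs i j. length vs = k \<and> set vs \<subseteq> V \<and> i < j \<and> j < k \<and> vs ! i = vs ! j \<longrightarrow> \<alpha> vs = 0)}"

text \<open>
  The shuffle formula for the wedge product. As forms vanish on lists of the wrong length, only
  index sets \<open>I\<close> of size \<open>deg \<alpha>\<close> contribute; the sign is that of the shuffle
  listing \<open>I\<close> before its complement. In particular \<open>dx\<^sup>1 \<and> \<dots> \<and> dx\<^sup>k\<close> takes the value \<open>1\<close>
  on the first \<open>k\<close> standard basis vectors.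
\<close>

definition shuffle_sign :: "nat \<Rightarrow> nat set \<Rightarrow> real" where
  "shuffle_sign n I = (-1) ^ card {(i, j). i \<in> I \<and> j \<in> {..<n} - I \<and> j < i}"

definition wedge :: "('v list \<Rightarrow> real) \<Rightarrow> ('v list \<Rightarrow> real) \<Rightarrow> 'v list \<Rightarrow> real" where
  "wedge \<alpha> \<beta> vs = (\<Sum>I\<in>Pow {..<length vs}.
     shuffle_sign (length vs) I * \<alpha> (nths vs I) * \<beta> (nths vs (- I)))"

definition int_prod :: "'v \<Rightarrow> ('v list \<Rightarrow> real) \<Rightarrow> 'v list \<Rightarrow> real" where
  "int_prod X \<alpha> = (\<lambda>vs. \<alpha> (X # vs))"

text \<open>
  For a finite-dimensional \<open>V\<close>, the \<open>k\<close>-multivectors are the alternating \<open>k\<close>-forms on the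
  dual space \<open>alt_forms V 1\<close>, a vector \<open>X\<close> being identified with evaluation at \<open>X\<close>;
  \<open>wedge (eval_at V X) (eval_at V Y)\<close> is then the bivector \<open>X \<and> Y\<close>.
\<close>

definition multivectors :: "'v::real_vector set \<Rightarrow> nat \<Rightarrow> (('v list \<Rightarrow> real) list \<Rightarrow> real) set" where
  "multivectors V k = alt_forms (alt_forms V 1) k"

definition eval_at :: "'v::real_vector set \<Rightarrow> 'v \<Rightarrow> ('v list \<Rightarrow> real) list \<Rightarrow> real" where
  "eval_at V X \<alpha>s = (if length \<alpha>s = 1 \<and> set \<alpha>s \<subseteq> alt_forms V 1 then hd \<alpha>s [X] else 0)"

text \<open>
  Contraction of a form with a bivector: the linear extension of
  \<open>X\<^sub>1 \<and> X\<^sub>2 \<mapsto> int_prod X\<^sub>2 (int_prod X\<^sub>1 \<omega>)\<close>.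
\<close>

definition contract2 ::
  "'v::real_vector set \<Rightarrow> (('v list \<Rightarrow> real) list \<Rightarrow> real) \<Rightarrow> ('v list \<Rightarrow> real) \<Rightarrow> 'v list \<Rightarrow> real" where
  "contract2 V Q \<omega> = (THE \<eta>. \<exists>XYs. set XYs \<subseteq> V \<times> V \<and>
     Q = (\<Sum>(X, Y)\<leftarrow>XYs. wedge (eval_at V X) (eval_at V Y)) \<and>
     \<eta> = (\<Sum>(X, Y)\<leftarrow>XYs. int_prod Y (int_prod X \<omega>)))"

definition inner_product_on :: "'v::real_vector set \<Rightarrow> ('v \<Rightarrow> 'v \<Rightarrow> real) \<Rightarrow> bool" where
  "inner_product_on V g \<longleftrightarrow>
     (\<forall>u v. \<not> (u \<in> V \<and> v \<in> V) \<longrightarrow> g u v = 0) \<and>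
     (\<forall>u\<in>V. \<forall>v\<in>V. g u v = g v u) \<and>
     (\<forall>u\<in>V. \<forall>v\<in>V. \<forall>w\<in>V. \<forall>a b. g (a *\<^sub>R u + b *\<^sub>R v) w = a * g u w + b * g v w) \<and>
     (\<forall>u\<in>V. u \<noteq> 0 \<longrightarrow> g u u > 0)"

definition orthonormal_basis :: "'v::real_vector set \<Rightarrow> ('v \<Rightarrow> 'v \<Rightarrow> real) \<Rightarrow> 'v list \<Rightarrow> bool" where
  "orthonormal_basis V g es \<longleftrightarrow> set es \<subseteq> V \<and> span (set es) = V \<and>
     (\<forall>i<length es. \<forall>j<length es. g (es ! i) (es ! j) = (if i = j then 1 else 0))"

text \<open>An inner product has two volume forms, one for each orientation.\<close>

definition volume_form :: "'v::real_vector set \<Rightarrow> ('v \<Rightarrow> 'v \<Rightarrow> real) \<Rightarrow> ('v list \<Rightarrow> real) \<Rightarrow> bool" where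
  "volume_form V g vol \<longleftrightarrow> vol \<in> alt_forms V (dim V) \<and>
     (\<forall>es. orthonormal_basis V g es \<longrightarrow> \<bar>vol es\<bar> = 1)"

text \<open>
  The inner product of two forms of the same degree \<open>k\<close>, computed in an orthonormal basis \<open>es\<close>;
  only index sets of size \<open>k\<close> contribute.
\<close>

definition form_inner :: "'v list \<Rightarrow> ('v list \<Rightarrow> real) \<Rightarrow> ('v list \<Rightarrow> real) \<Rightarrow> real" where
  "form_inner es \<alpha> \<beta> = (\<Sum>I\<in>Pow {..<length es}. \<alpha> (nths es I) * \<beta> (nths es I))"

text \<open>
  The Hodge star of a \<open>k\<close>-form \<open>\<alpha>\<close> is characterized by
  \<open>\<beta> \<and> \<star>\<alpha> = \<langle>\<beta>, \<alpha>\<rangle> vol\<close> for all \<open>k\<close>-forms \<open>\<beta>\<close>.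
\<close>

definition hodge_star ::
  "'v::real_vector set \<Rightarrow> ('v \<Rightarrow> 'v \<Rightarrow> real) \<Rightarrow> ('v list \<Rightarrow> real) \<Rightarrow> nat \<Rightarrow>
     ('v list \<Rightarrow> real) \<Rightarrow> 'v list \<Rightarrow> real" where
  "hodge_star V g vol k \<alpha> = (THE \<eta>. \<eta> \<in> alt_forms V (dim V - k) \<and>
     (\<forall>\<beta>\<in>alt_forms V k. \<forall>es. orthonormal_basis V g es \<longrightarrow>
        wedge \<beta> \<eta> = form_inner es \<beta> \<alpha> *\<^sub>R vol))"


section \<open>The standard \<open>G\<^sub>2\<close> form\<close>

definition dx :: "7 \<Rightarrow> (real^7) list \<Rightarrow> real" where
  "dx i vs = (if length vs = 1 then hd vs $ i else 0)"

definition dx3 :: "7 \<Rightarrow> 7 \<Rightarrow> 7 \<Rightarrow> (real^7) list \<Rightarrow> real" where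
  "dx3 i j k = wedge (dx i) (wedge (dx j) (dx k))"

definition phi0 :: "(real^7) list \<Rightarrow> real" where
  "phi0 = dx3 1 2 3 + dx3 1 4 5 + dx3 1 6 7 + dx3 2 4 6 - dx3 2 5 7 - dx3 3 4 7 - dx3 3 5 6"

definition G2_form :: "'v::real_vector set \<Rightarrow> ('v list \<Rightarrow> real) \<Rightarrow> bool" where
  "G2_form V \<phi> \<longleftrightarrow> \<phi> \<in> alt_forms V 3 \<and>
     (\<exists>f :: 'v \<Rightarrow> real^7. linear_iso V UNIV f \<and>
        (\<forall>vs. length vs = 3 \<and> set vs \<subseteq> V \<longrightarrow> \<phi> vs = phi0 (map f vs)))"

text \<open>
  The metric together with its volume form, the latter also fixing the orientation.
\<close>

definition G2_metric_vol ::
  "'v::real_vector set \<Rightarrow> ('v list \<Rightarrow> real) \<Rightarrow> ('v \<Rightarrow> 'v \<Rightarrow> real) \<times> ('v list \<Rightarrow> real)" where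
  "G2_metric_vol V \<phi> = (THE (g, vol). inner_product_on V g \<and> volume_form V g vol \<and>
     (\<forall>X\<in>V. \<forall>Y\<in>V.
        wedge (wedge (int_prod X \<phi>) (int_prod Y \<phi>)) \<phi> = (6 * g X Y) *\<^sub>R vol))"


section \<open>Smooth manifolds\<close>

primrec Ck_on :: "nat \<Rightarrow> ('a::real_normed_vector \<Rightarrow> 'b::real_normed_vector) \<Rightarrow> 'a set \<Rightarrow> bool" where
  "Ck_on 0 f S \<longleftrightarrow> continuous_on S f"
| "Ck_on (Suc k) f S \<longleftrightarrow> (\<forall>x\<in>S. f differentiable (at x)) \<and>
     (\<forall>v. Ck_on k (\<lambda>x. frechet_derivative f (at x) v) S)"

text \<open>Only meant for finite-dimensional domains and open \<open>S\<close>.\<close>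

definition smooth_on :: "('a::euclidean_space \<Rightarrow> 'b::real_normed_vector) \<Rightarrow> 'a set \<Rightarrow> bool" where
  "smooth_on f S \<longleftrightarrow> (\<forall>k. Ck_on k f S)"

text \<open>A chart is its domain together with its coordinate map.\<close>

type_synonym ('a, 'n) chart = "'a set \<times> ('a \<Rightarrow> real^'n)"

definition chart_inv :: "('a, 'n) chart \<Rightarrow> real^'n \<Rightarrow> 'a" where
  "chart_inv c = inv_into (fst c) (snd c)"

definition transition :: "('a, 'n) chart \<Rightarrow> ('a, 'n) chart \<Rightarrow> real^'n \<Rightarrow> real^'n" where
  "transition c d = snd d \<circ> chart_inv c"

definition charts_at :: "('a, 'n) chart set \<Rightarrow> 'a \<Rightarrow> ('a, 'n) chart set" where
  "charts_at A p = {c \<in> A. p \<in> fst c}"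

text \<open>The smooth structure on the space \<open>M\<close> is the one generated by the atlas \<open>A\<close>.\<close>

definition smooth_manifold :: "'a topology \<Rightarrow> ('a, 'n::finite) chart set \<Rightarrow> bool" where
  "smooth_manifold M A \<longleftrightarrow> Hausdorff_space M \<and> second_countable M \<and>
     (\<Union>c\<in>A. fst c) = topspace M \<and>
     (\<forall>c\<in>A. openin M (fst c) \<and> open (snd c ` fst c) \<and>
        homeomorphic_map (subtopology M (fst c)) (top_of_set (snd c ` fst c)) (snd c)) \<and>
     (\<forall>c\<in>A. \<forall>d\<in>A. smooth_on (transition c d) (snd c ` (fst c \<inter> fst d)))"

text \<open>
  A tangent vector at \<open>p\<close> assigns to each chart around \<open>p\<close> its vector of components, the
  components in two charts being related by the Jacobian of the transition map
  (and \<open>0\<close> to all other charts).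
\<close>

definition tangent_space ::
  "('a, 'n::finite) chart set \<Rightarrow> 'a \<Rightarrow> (('a, 'n) chart \<Rightarrow> real^'n) set" where
  "tangent_space A p = {v. (\<forall>c. c \<notin> charts_at A p \<longrightarrow> v c = 0) \<and>
     (\<forall>c\<in>charts_at A p. \<forall>d\<in>charts_at A p.
        v d = frechet_derivative (transition c d) (at (snd c p)) (v c))}"

text \<open>
  The tangent vector at \<open>p\<close> with components \<open>u\<close> in the chart \<open>c\<close>, i.e. \<open>\<Sum>\<^sub>i u\<^sub>i \<partial>/\<partial>x\<^sup>i\<close>, and the
  cotangent vector \<open>\<Sum>\<^sub>i l\<^sub>i dx\<^sup>i\<close>.
\<close>

definition coord_vector ::
  "('a, 'n::finite) chart set \<Rightarrow> 'a \<Rightarrow> ('a, 'n) chart \<Rightarrow> real^'n \<Rightarrow> ('a, 'n) chart \<Rightarrow> real^'n" where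
  "coord_vector A p c u d =
     (if d \<in> charts_at A p then frechet_derivative (transition c d) (at (snd c p)) u else 0)"

definition coord_covector ::
  "('a, 'n::finite) chart set \<Rightarrow> 'a \<Rightarrow> ('a, 'n) chart \<Rightarrow> real^'n \<Rightarrow>
     (('a, 'n) chart \<Rightarrow> real^'n) list \<Rightarrow> real" where
  "coord_covector A p c l vs =
     (if length vs = 1 \<and> set vs \<subseteq> tangent_space A p then l \<bullet> hd vs c else 0)"

type_synonym ('a, 'n) form_field = "'a \<Rightarrow> (('a, 'n) chart \<Rightarrow> real^'n) list \<Rightarrow> real"

type_synonym ('a, 'n) multivector_field =
  "'a \<Rightarrow> ((('a, 'n) chart \<Rightarrow> real^'n) list \<Rightarrow> real) list \<Rightarrow> real"

text \<open>
  A field is smooth if its components in each chart are; it is \<open>0\<close> outside the manifold, so that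
  fields are equal iff they are equal as functions.
\<close>

definition form_in_chart ::
  "('a, 'n::finite) chart set \<Rightarrow> ('a, 'n) form_field \<Rightarrow> ('a, 'n) chart \<Rightarrow>
     (real^'n) list \<Rightarrow> real^'n \<Rightarrow> real" where
  "form_in_chart A \<omega> c us y =
     \<omega> (chart_inv c y) (map (coord_vector A (chart_inv c y) c) us)"

definition smooth_forms ::
  "'a topology \<Rightarrow> ('a, 'n::finite) chart set \<Rightarrow> nat \<Rightarrow> ('a, 'n) form_field set" where
  "smooth_forms M A k = {\<omega>.
     (\<forall>p\<in>topspace M. \<omega> p \<in> alt_forms (tangent_space A p) k) \<and>
     (\<forall>p. p \<notin> topspace M \<longrightarrow> \<omega> p = 0) \<and>
     (\<forall>c\<in>A. \<forall>us. length us = k \<longrightarrow> smooth_on (form_in_chart A \<omega> c us) (snd c ` fst c))}"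

definition smooth_multivectors ::
  "'a topology \<Rightarrow> ('a, 'n::finite) chart set \<Rightarrow> nat \<Rightarrow> ('a, 'n) multivector_field set" where
  "smooth_multivectors M A k = {Q.
     (\<forall>p\<in>topspace M. Q p \<in> multivectors (tangent_space A p) k) \<and>
     (\<forall>p. p \<notin> topspace M \<longrightarrow> Q p = 0) \<and>
     (\<forall>c\<in>A. \<forall>ls. length ls = k \<longrightarrow>
        smooth_on (\<lambda>y. Q (chart_inv c y) (map (coord_covector A (chart_inv c y) c) ls))
          (snd c ` fst c))}"

text \<open>
  The exterior derivative, by the coordinate formula
  \<open>d\<omega>(v\<^sub>0, \<dots>, v\<^sub>k) = \<Sum>\<^sub>i (-1)\<^sup>i v\<^sub>i(\<omega>(v\<^sub>0, \<dots>, v\<^sub>i omitted, \<dots>, v\<^sub>k))\<close> for the extensions of the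
  \<open>v\<^sub>j\<close> with constant components in some chart around the point; by naturality of \<open>d\<close>
  the choice of chart does not matter.
\<close>

definition ext_deriv ::
  "'a topology \<Rightarrow> ('a, 'n::finite) chart set \<Rightarrow> ('a, 'n) form_field \<Rightarrow> ('a, 'n) form_field" where
  "ext_deriv M A \<omega> p vs =
     (if p \<in> topspace M \<and> set vs \<subseteq> tangent_space A p then
        (let c = (SOME c. c \<in> charts_at A p); us = map (\<lambda>v. v c) vs in
           \<Sum>i<length us. (-1) ^ i * frechet_derivative
             (form_in_chart A \<omega> c (take i us @ drop (Suc i) us)) (at (snd c p)) (us ! i))
      else 0)"


section \<open>Coclosed \<open>G\<^sub>2\<close>-structures\<close>

definition G2_structure :: "'a topology \<Rightarrow> ('a, 7) chart set \<Rightarrow> ('a, 7) form_field \<Rightarrow> bool" where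
  "G2_structure M A \<phi> \<longleftrightarrow> \<phi> \<in> smooth_forms M A 3 \<and>
     (\<forall>p\<in>topspace M. G2_form (tangent_space A p) (\<phi> p))"

definition star_phi :: "'a topology \<Rightarrow> ('a, 7) chart set \<Rightarrow> ('a, 7) form_field \<Rightarrow> ('a, 7) form_field" where
  "star_phi M A \<phi> p =
     (if p \<in> topspace M then
        (let V = tangent_space A p; (g, vol) = G2_metric_vol V (\<phi> p)
         in hodge_star V g vol 3 (\<phi> p))
      else 0)"

definition coclosed :: "'a topology \<Rightarrow> ('a, 7) chart set \<Rightarrow> ('a, 7) form_field \<Rightarrow> bool" where
  "coclosed M A \<phi> \<longleftrightarrow> ext_deriv M A (star_phi M A \<phi>) = 0"

definition contract_field ::
  "('a, 'n::finite) chart set \<Rightarrow> ('a, 'n) multivector_field \<Rightarrow> ('a, 'n) form_field \<Rightarrow>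
     ('a, 'n) form_field" where
  "contract_field A Q \<omega> p = contract2 (tangent_space A p) (Q p) (\<omega> p)"

end

theory Submission
  imports Defs
begin

text \<open>
  The claim is pointwise linear algebra plus smoothness of the inverse. In a frame that identifies
  \<open>\<phi>\<^sub>p\<close> with \<open>\<phi>\<^sub>0\<close>, the dual form \<open>\<star>\<phi>\<close> becomes an explicit 4-form \<open>\<psi>\<^sub>0\<close>, and contraction with \<open>\<psi>\<^sub>0\<close>,
  composed with the identification of vectors and covectors, is an operator \<open>T\<close> on \<open>\<Lambda>\<^sup>2\<close> with
  \<open>T\<^sup>2 = T + 2\<close>; its inverse is therefore \<open>(T - 1) / 2\<close>. The only data in this formula besides \<open>\<phi>\<close> are
  the metric, its inverse, and \<open>\<star>\<phi>\<close>. All are smooth: the 7-form \<open>(X \<lrcorner> \<phi>) \<and> (Y \<lrcorner> \<phi>) \<and> \<phi>\<close> gives the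
  metric up to a scalar density, the density is a cube root of a rational expression in \<open>\<phi>\<close>, and
  \<open>\<star>\<phi>\<close> is obtained from the contraction identity for two copies of \<open>\<phi>\<close>.
\<close>

section \<open>Alternating forms\<close>

text \<open>The obstacle is that a frame taking \<phi> to \<open>phi0\<close> is chosen separately
  at every point, so nothing is known about its dependence on the point, and smoothness of the
  inverse cannot be read off in that frame. Two frames are therefore carried along. The algebra is
  done in the adapted, orthonormal one; every sum over it is a trace, which the inverse metric turns
  into a sum over the coordinate frame of a chart, where the components of \<phi> are smooth. The
  metric with its volume form, the Hodge star and the contraction are definite descriptions, so each
  is first identified by an existence and a uniqueness argument. The cube root has odd order, so it
  also recovers the sign of the density, that is, whether the chart is positively oriented.\<close>

lemma fun_scaleR_apply [simp]: "(r *\<^sub>R f) x = r *\<^sub>R f x"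
  by (simp add: scaleR_fun_def)

lemma alt_forms_off: "\<alpha> \<in> alt_forms V k \<Longrightarrow> \<not> (length vs = k \<and> set vs \<subseteq> V) \<Longrightarrow> \<alpha> vs = 0"
  by (simp add: alt_forms_def)

lemma alt_forms_update:
  assumes "\<alpha> \<in> alt_forms V k" "length vs = k" "set vs \<subseteq> V" "i < k" "u \<in> V" "v \<in> V"
  shows "\<alpha> (vs[i := a *\<^sub>R u + b *\<^sub>R v]) = a * \<alpha> (vs[i := u]) + b * \<alpha> (vs[i := v])"
  using assms unfolding alt_forms_def by blast

lemma alt_forms_eq:
  assumes "\<alpha> \<in> alt_forms V k" "length vs = k" "set vs \<subseteq> V" "i < j" "j < k" "vs ! i = vs ! j"
  shows "\<alpha> vs = 0"
  using assms unfolding alt_forms_def by blast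

lemma alt_formsI:
  assumes "\<And>vs. \<not> (length vs = k \<and> set vs \<subseteq> V) \<Longrightarrow> \<alpha> vs = 0"
    and "\<And>vs i u v a b. length vs = k \<Longrightarrow> set vs \<subseteq> V \<Longrightarrow> i < k \<Longrightarrow> u \<in> V \<Longrightarrow> v \<in> V \<Longrightarrow>
        \<alpha> (vs[i := a *\<^sub>R u + b *\<^sub>R v]) = a * \<alpha> (vs[i := u]) + b * \<alpha> (vs[i := v])"
    and "\<And>vs i j. length vs = k \<Longrightarrow> set vs \<subseteq> V \<Longrightarrow> i < j \<Longrightarrow> j < k \<Longrightarrow> vs ! i = vs ! j \<Longrightarrow> \<alpha> vs = 0"
  shows "\<alpha> \<in> alt_forms V k"
  using assms unfolding alt_forms_def by blast

lemma subspace_alt_forms: "subspace (alt_forms V k)"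
proof (rule real_vector.subspaceI)
  show "0 \<in> alt_forms V k" by (rule alt_formsI) auto
next
  fix x y assume x: "x \<in> alt_forms V k" and y: "y \<in> alt_forms V k"
  show "x + y \<in> alt_forms V k"
  proof (rule alt_formsI)
    show "(x + y) vs = 0" if "length vs = k" "set vs \<subseteq> V" "i < j" "j < k" "vs ! i = vs ! j" for vs i j
      using alt_forms_eq[OF x that] alt_forms_eq[OF y that] by simp
  qed (use x y in \<open>auto simp: alt_forms_off alt_forms_update algebra_simps\<close>)
next
  fix r x assume x: "x \<in> alt_forms V k"
  show "r *\<^sub>R x \<in> alt_forms V k"
  proof (rule alt_formsI)
    show "(r *\<^sub>R x) vs = 0" if "length vs = k" "set vs \<subseteq> V" "i < j" "j < k" "vs ! i = vs ! j" for vs i j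
      using alt_forms_eq[OF x that] by simp
  qed (use x in \<open>auto simp: alt_forms_off alt_forms_update algebra_simps\<close>)
qed

lemma alt_forms_head:
  assumes "\<alpha> \<in> alt_forms V k" "u \<in> V" "v \<in> V"
  shows "\<alpha> ((a *\<^sub>R u + b *\<^sub>R v) # vs) = a * \<alpha> (u # vs) + b * \<alpha> (v # vs)"
proof (cases "Suc (length vs) = k \<and> set vs \<subseteq> V")
  case True
  then show ?thesis using alt_forms_update[OF assms(1), of "u # vs" 0 u v a b] assms by auto
next
  case False
  then show ?thesis using alt_forms_off[OF assms(1)] by auto
qed

lemma alt_forms_head_zero:
  assumes "\<alpha> \<in> alt_forms V k" "subspace V"
  shows "\<alpha> (0 # vs) = 0"
  using alt_forms_head[OF assms(1), of 0 0 0 0 vs] assms(2) by (simp add: subspace_0)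

lemma alt_forms_head_sum:
  assumes "\<alpha> \<in> alt_forms V k" "subspace V" "\<And>i. i \<in> I \<Longrightarrow> u i \<in> V"
  shows "\<alpha> ((\<Sum>i\<in>I. c i *\<^sub>R u i) # vs) = (\<Sum>i\<in>I. c i * \<alpha> (u i # vs))"
  using assms(3)
proof (induction I rule: infinite_finite_induct)
  case (insert x F)
  have "(\<Sum>i\<in>F. c i *\<^sub>R u i) \<in> V"
    using insert by (intro subspace_sum[OF assms(2)] subspace_scale[OF assms(2)]) auto
  then show ?case
    using insert alt_forms_head[OF assms(1), of "u x" "\<Sum>i\<in>F. c i *\<^sub>R u i" "c x" 1 vs] by simp
qed (auto simp: alt_forms_head_zero[OF assms(1,2)])

lemma alt_forms_twice: "\<alpha> \<in> alt_forms V k \<Longrightarrow> \<alpha> (v # v # vs) = 0"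
  using alt_forms_off[of \<alpha> V k "v # v # vs"] alt_forms_eq[of \<alpha> V k "v # v # vs" 0 1] by fastforce

text \<open>For \<open>v\<close> outside \<open>V\<close> the contraction is the zero form, so
  \<open>v\<close> may be arbitrary. The inductions below contract along entries of lists about
  which nothing is known.\<close>

lemma int_prod_alt_forms:
  assumes "\<alpha> \<in> alt_forms V (Suc k)"
  shows "int_prod v \<alpha> \<in> alt_forms V k"
proof (cases "v \<in> V")
  case True
  show ?thesis
  proof (rule alt_formsI)
    show "int_prod v \<alpha> vs = 0" if "\<not> (length vs = k \<and> set vs \<subseteq> V)" for vs
      using that by (auto simp: int_prod_def intro!: alt_forms_off[OF assms])
  next
    fix vs i u w a b assume "length vs = k" "set vs \<subseteq> V" "i < k" "u \<in> V" "w \<in> V"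
    then show "int_prod v \<alpha> (vs[i := a *\<^sub>R u + b *\<^sub>R w]) =
        a * int_prod v \<alpha> (vs[i := u]) + b * int_prod v \<alpha> (vs[i := w])"
      using alt_forms_update[OF assms, of "v # vs" "Suc i" u w a b] True by (simp add: int_prod_def)
  next
    fix vs i j assume "length vs = k" "set vs \<subseteq> V" "i < j" "j < k" "vs ! i = vs ! j"
    then show "int_prod v \<alpha> vs = 0"
      using alt_forms_eq[OF assms, of "v # vs" "Suc i" "Suc j"] True by (simp add: int_prod_def)
  qed
next
  case False
  then have "int_prod v \<alpha> = 0"
    by (auto simp: int_prod_def fun_eq_iff intro!: alt_forms_off[OF assms])
  then show ?thesis using subspace_0[OF subspace_alt_forms] by simp
qed

lemma int_prod_0form: "\<alpha> \<in> alt_forms V 0 \<Longrightarrow> int_prod v \<alpha> = 0"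
  by (auto simp: int_prod_def fun_eq_iff intro!: alt_forms_off)

lemma int_prod_linear:
  assumes "\<alpha> \<in> alt_forms V k" "u \<in> V" "v \<in> V"
  shows "int_prod (a *\<^sub>R u + b *\<^sub>R v) \<alpha> = a *\<^sub>R int_prod u \<alpha> + b *\<^sub>R int_prod v \<alpha>"
  using alt_forms_head[OF assms] by (auto simp: int_prod_def fun_eq_iff)

lemma int_prod_add [simp]: "int_prod v (\<alpha> + \<beta>) = int_prod v \<alpha> + int_prod v \<beta>"
  and int_prod_scaleR [simp]: "int_prod v (c *\<^sub>R \<alpha>) = c *\<^sub>R int_prod v \<alpha>"
  and int_prod_zero [simp]: "int_prod v 0 = 0"
  by (auto simp: int_prod_def fun_eq_iff)

lemma int_prod_twice: "\<alpha> \<in> alt_forms V k \<Longrightarrow> int_prod v (int_prod v \<alpha>) = 0"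
  by (auto simp: int_prod_def fun_eq_iff alt_forms_twice)

text \<open>Polarization: the value on \<open>u + v\<close>, \<open>u + v\<close> is 0, and
  expanding it leaves the two mixed terms. If the list does not consist of \<open>k\<close> vectors
  of \<open>V\<close>, both sides are 0.\<close>

lemma alt_forms_swap:
  assumes "\<alpha> \<in> alt_forms V k" "subspace V"
  shows "\<alpha> (u # v # vs) = - \<alpha> (v # u # vs)"
proof (cases "Suc (Suc (length vs)) = k \<and> set (u # v # vs) \<subseteq> V")
  case True
  then obtain m where m: "k = Suc m" by auto
  have a: "\<alpha> ((u + v) # w # vs) = \<alpha> (u # w # vs) + \<alpha> (v # w # vs)" for w
    using alt_forms_head[OF assms(1), of u v 1 1] True by simp
  have b: "\<alpha> (w # (u + v) # vs) = \<alpha> (w # u # vs) + \<alpha> (w # v # vs)" for w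
    using alt_forms_head[OF int_prod_alt_forms[OF assms(1)[unfolded m]], of u v w 1 1] True
    by (simp add: int_prod_def)
  show ?thesis
    using a[of "u + v"] b[of u] b[of v] alt_forms_twice[OF assms(1)] by simp
next
  case False
  then have "\<alpha> (u # v # vs) = 0" "\<alpha> (v # u # vs) = 0"
    by (auto intro!: alt_forms_off[OF assms(1)])
  then show ?thesis by simp
qed

lemma int_prod_swap:
  assumes "\<alpha> \<in> alt_forms V k" "subspace V"
  shows "int_prod u (int_prod v \<alpha>) = - int_prod v (int_prod u \<alpha>)"
  by (rule ext) (simp add: int_prod_def, rule alt_forms_swap[OF assms])

text \<open>Once all contractions are alternating, alternation is left to check for the first
  argument only, and there only against the second: a repetition further down is moved into the tail
  by swapping the first two entries. The recursion of the wedge product on the head of the list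
  delivers its information in this form.\<close>

lemma alt_forms_SucI:
  assumes V: "subspace V"
    and off: "\<And>vs. \<not> (length vs = Suc k \<and> set vs \<subseteq> V) \<Longrightarrow> \<alpha> vs = 0"
    and int: "\<And>v. v \<in> V \<Longrightarrow> int_prod v \<alpha> \<in> alt_forms V k"
    and lin: "\<And>u v a b vs. u \<in> V \<Longrightarrow> v \<in> V \<Longrightarrow>
      \<alpha> ((a *\<^sub>R u + b *\<^sub>R v) # vs) = a * \<alpha> (u # vs) + b * \<alpha> (v # vs)"
    and tw: "\<And>v vs. v \<in> V \<Longrightarrow> \<alpha> (v # v # vs) = 0"
  shows "\<alpha> \<in> alt_forms V (Suc k)"
proof (rule alt_formsI)
  show "\<alpha> vs = 0" if "\<not> (length vs = Suc k \<and> set vs \<subseteq> V)" for vs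
    using off that .
next
  fix vs i u v a b
  assume *: "length vs = Suc k" "set vs \<subseteq> V" "i < Suc k" "u \<in> V" "v \<in> V"
  then obtain w ws where vs: "vs = w # ws" by (cases vs) auto
  show "\<alpha> (vs[i := a *\<^sub>R u + b *\<^sub>R v]) = a * \<alpha> (vs[i := u]) + b * \<alpha> (vs[i := v])"
  proof (cases i)
    case 0
    then show ?thesis using lin * vs by simp
  next
    case (Suc j)
    then show ?thesis
      using alt_forms_update[OF int, of w ws j u v a b] * vs by (simp add: int_prod_def)
  qed
next
  fix vs i j
  assume *: "length vs = Suc k" "set vs \<subseteq> V" "i < j" "j < Suc k" "vs ! i = vs ! j"
  then obtain w ws where vs: "vs = w # ws" by (cases vs) auto
  obtain j' where j: "j = Suc j'" using * by (cases j) auto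
  show "\<alpha> vs = 0"
  proof (cases i)
    case (Suc i')
    then show ?thesis
      using alt_forms_eq[OF int, of w ws i' j'] * vs j by (simp add: int_prod_def)
  next
    case 0
    then have ws: "ws ! j' = w" "j' < length ws" using * vs j by auto
    then obtain x xs where xs: "ws = x # xs" by (cases ws) auto
    have xV: "x \<in> V" "w \<in> V" using * vs xs by auto
    obtain m where k: "k = Suc m" using * vs xs by auto
    show ?thesis
    proof (cases j')
      case 0
      then show ?thesis using tw xV ws xs vs by simp
    next
      case (Suc l)
      \<comment> \<open>Polarization again, now for an \<open>\<alpha>\<close> not yet known to be
        alternating: additivity in the first two slots and \<open>tw\<close> are what is
        available.\<close>
      have a: "\<alpha> ((w + x) # y # xs) = \<alpha> (w # y # xs) + \<alpha> (x # y # xs)" for y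
        using lin[OF xV(2,1), of 1 1] by simp
      have b: "\<alpha> (y # (w + x) # xs) = \<alpha> (y # w # xs) + \<alpha> (y # x # xs)" if "y \<in> V" for y
        using alt_forms_head[OF int[OF that], of w x 1 1] xV by (simp add: int_prod_def)
      have "w + x \<in> V" using V xV by (simp add: subspace_add)
      then have "\<alpha> (w # x # xs) = - \<alpha> (x # w # xs)"
        using a[of "w + x"] b[of w] b[of x] tw[of w xs] tw[of x xs] tw[of "w + x" xs] xV by simp
      also have "\<alpha> (x # w # xs) = 0"
        using alt_forms_eq[OF int[OF xV(1)], of "w # xs" 0 "Suc l"] * vs xs ws Suc xV
        by (simp add: int_prod_def)
      finally show ?thesis by (simp add: vs xs)
    qed
  qed
qed

section \<open>The wedge product\<close>

text \<open>Subsets are sorted by whether they contain 0, in step with the recursion on the head of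
  an argument list.\<close>

lemma sum_Pow_Suc:
  fixes f :: "nat set \<Rightarrow> 'b::comm_monoid_add"
  shows "(\<Sum>I\<in>Pow {..<Suc n}. f I) = (\<Sum>I\<in>Pow {..<n}. f (insert 0 (Suc ` I)) + f (Suc ` I))"
proof -
  have inj: "inj_on (image Suc) (Pow {..<n})" by (intro inj_onI) (simp add: inj_image_eq_iff)
  have inj': "inj_on (insert 0) (image Suc ` Pow {..<n})"
    by (intro inj_onI) (metis (mono_tags, lifting) Diff_insert_absorb Zero_not_Suc imageE)
  have "Pow {..<Suc n} = image Suc ` Pow {..<n} \<union> insert 0 ` image Suc ` Pow {..<n}"
    by (simp add: lessThan_Suc_eq_insert_0 Pow_insert image_Pow_surj)
  then have "(\<Sum>I\<in>Pow {..<Suc n}. f I) =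
      (\<Sum>I\<in>image Suc ` Pow {..<n}. f I) + (\<Sum>I\<in>insert 0 ` image Suc ` Pow {..<n}. f I)"
    by (subst sum.union_disjoint[symmetric]) (auto simp: image_iff)
  then show ?thesis
    by (simp add: sum.reindex[OF inj] sum.reindex[OF inj'] sum.distrib add.commute)
qed

lemma shuffle_sign_insert: "shuffle_sign (Suc n) (insert 0 (Suc ` I)) = shuffle_sign n I"
proof -
  have "{(i, j). i \<in> insert 0 (Suc ` I) \<and> j \<in> {..<Suc n} - insert 0 (Suc ` I) \<and> j < i} =
      map_prod Suc Suc ` {(i, j). i \<in> I \<and> j \<in> {..<n} - I \<and> j < i}"
    by (auto simp: image_iff lessThan_Suc_eq_insert_0)
  then show ?thesis
    unfolding shuffle_sign_def by (simp add: card_image inj_on_def)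
qed

text \<open>Index 0 lies in the complement and forms one new inversion with each element of
  \<open>I\<close>; these give the factor \<open>(-1) ^ card I\<close>.\<close>

lemma shuffle_sign_image:
  assumes "I \<subseteq> {..<n}"
  shows "shuffle_sign (Suc n) (Suc ` I) = (-1) ^ card I * shuffle_sign n I"
proof -
  let ?A = "{(i, j). i \<in> I \<and> j \<in> {..<n} - I \<and> j < i}"
  have fin: "finite I" using assms finite_subset by blast
  have "?A \<subseteq> I \<times> {..<n}" by auto
  then have finA: "finite ?A" using fin finite_subset by blast
  have "{(i, j). i \<in> Suc ` I \<and> j \<in> {..<Suc n} - Suc ` I \<and> j < i} =
      map_prod Suc Suc ` ?A \<union> (\<lambda>i. (Suc i, 0)) ` I"
    by (auto simp: image_iff lessThan_Suc_eq_insert_0)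
  moreover have "card (map_prod Suc Suc ` ?A \<union> (\<lambda>i. (Suc i, 0)) ` I) = card ?A + card I"
    using fin finA
    by (subst card_Un_disjoint) (auto simp: card_image inj_on_def simp del: Collect_case_prod)
  ultimately show ?thesis
    unfolding shuffle_sign_def by (simp add: power_add)
qed

lemma length_nths_subset: "I \<subseteq> {..<length vs} \<Longrightarrow> length (nths vs I) = card I"
  by (simp add: length_nths) (metis (mono_tags, lifting) Collect_mem_eq Collect_cong lessThan_iff subset_eq)

lemma wedge_Nil [simp]: "wedge \<alpha> \<beta> [] = \<alpha> [] * \<beta> []"
  by (simp add: wedge_def shuffle_sign_def)

text \<open>Without a degree for \<open>\<alpha>\<close>, the sign of the antiderivation rule has to
  be read off from the length of the list that \<open>\<alpha>\<close> receives.\<close>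

lemma wedge_Cons: "wedge \<alpha> \<beta> (v # vs) =
  wedge (int_prod v \<alpha>) \<beta> vs + wedge (\<lambda>us. (-1) ^ length us * \<alpha> us) (int_prod v \<beta>) vs"
proof -
  have a: "{j. Suc j \<in> insert 0 (Suc ` I)} = I" "{j. Suc j \<in> Suc ` I} = I"
    "{j. Suc j \<in> - insert 0 (Suc ` I)} = - I" "{j. Suc j \<notin> Suc ` I} = - I" for I
    by auto
  show ?thesis
    unfolding wedge_def length_Cons sum_Pow_Suc sum.distrib[symmetric]
    by (intro sum.cong refl)
      (auto simp: shuffle_sign_insert shuffle_sign_image nths_Cons a int_prod_def
        length_nths_subset)
qed

lemma wedge_Cons_alt_forms:
  assumes "\<alpha> \<in> alt_forms V k"
  shows "wedge \<alpha> \<beta> (v # vs) =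
    wedge (int_prod v \<alpha>) \<beta> vs + (-1) ^ k * wedge \<alpha> (int_prod v \<beta>) vs"
proof -
  have "(\<lambda>us. (-1) ^ length us * \<alpha> us) = (\<lambda>us. (-1) ^ k * \<alpha> us)"
  proof (rule ext)
    show "(-1) ^ length us * \<alpha> us = (-1) ^ k * \<alpha> us" for us
      using alt_forms_off[OF assms, of us] by auto
  qed
  then show ?thesis
    by (simp add: wedge_Cons) (simp add: wedge_def sum_distrib_left mult_ac)
qed

lemma int_prod_wedge:
  assumes "\<alpha> \<in> alt_forms V k"
  shows "int_prod v (wedge \<alpha> \<beta>) =
    wedge (int_prod v \<alpha>) \<beta> + (-1) ^ k *\<^sub>R wedge \<alpha> (int_prod v \<beta>)"
  using wedge_Cons_alt_forms[OF assms] by (auto simp: fun_eq_iff int_prod_def)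

lemma wedge_add_left: "wedge (\<alpha> + \<alpha>') \<beta> = wedge \<alpha> \<beta> + wedge \<alpha>' \<beta>"
  and wedge_add_right: "wedge \<alpha> (\<beta> + \<beta>') = wedge \<alpha> \<beta> + wedge \<alpha> \<beta>'"
  and wedge_scaleR_left: "wedge (c *\<^sub>R \<alpha>) \<beta> = c *\<^sub>R wedge \<alpha> \<beta>"
  and wedge_scaleR_right: "wedge \<alpha> (c *\<^sub>R \<beta>) = c *\<^sub>R wedge \<alpha> \<beta>"
  and wedge_zero_left [simp]: "wedge 0 \<beta> = 0"
  and wedge_zero_right [simp]: "wedge \<alpha> 0 = 0"
  by (auto simp: wedge_def fun_eq_iff algebra_simps sum.distrib sum_distrib_left)

lemma set_nths_Un: "set (nths vs I) \<union> set (nths vs (- I)) = set vs"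
  by (force simp: set_nths in_set_conv_nth)

lemma length_nths_add: "length (nths vs I) + length (nths vs (- I)) = length vs"
proof (induction vs arbitrary: I)
  case (Cons v vs)
  have "{j. Suc j \<in> - I} = - {j. Suc j \<in> I}" by auto
  then show ?case using Cons[of "{j. Suc j \<in> I}"] by (simp add: nths_Cons)
qed simp

lemma wedge_off:
  assumes "\<alpha> \<in> alt_forms V k" "\<beta> \<in> alt_forms V l" "\<not> (length vs = k + l \<and> set vs \<subseteq> V)"
  shows "wedge \<alpha> \<beta> vs = 0"
proof -
  have "\<alpha> (nths vs I) * \<beta> (nths vs (- I)) = 0" for I
  proof (rule ccontr)
    assume "\<not> ?thesis"
    then have "length (nths vs I) = k \<and> set (nths vs I) \<subseteq> V"
      "length (nths vs (- I)) = l \<and> set (nths vs (- I)) \<subseteq> V"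
      using alt_forms_off[OF assms(1)] alt_forms_off[OF assms(2)] by fastforce+
    then show False
      using set_nths_Un[of vs I] length_nths_add[of vs I] assms(3) by auto
  qed
  then show ?thesis unfolding wedge_def mult.assoc by (intro sum.neutral) simp
qed

text \<open>Induction on the total degree: by the antiderivation rule a contraction of the product
  is a sum of products of smaller total degree, which is what \<open>alt_forms_SucI\<close> asks
  for. A factor of degree 0 has contraction 0.\<close>

lemma wedge_alt_forms:
  assumes V: "subspace V"
  shows "\<alpha> \<in> alt_forms V k \<Longrightarrow> \<beta> \<in> alt_forms V l \<Longrightarrow> wedge \<alpha> \<beta> \<in> alt_forms V (k + l)"
proof (induction "k + l" arbitrary: k l \<alpha> \<beta>)
  case 0
  then show ?case by (intro alt_formsI) (auto simp: wedge_off)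
next
  case (Suc n)
  have left: "wedge (int_prod v \<alpha>) \<beta> \<in> alt_forms V n" for v
  proof (cases k)
    case 0
    then show ?thesis
      using Suc.prems int_prod_0form[of \<alpha> V v] subspace_0[OF subspace_alt_forms] by simp
  next
    case (Suc k')
    then show ?thesis
      using Suc.hyps(1)[of k' l "int_prod v \<alpha>" \<beta>] Suc.hyps(2) Suc.prems
        int_prod_alt_forms[of \<alpha> V k' v] by auto
  qed
  have right: "wedge \<alpha> (int_prod v \<beta>) \<in> alt_forms V n" for v
  proof (cases l)
    case 0
    then show ?thesis
      using Suc.prems int_prod_0form[of \<beta> V v] subspace_0[OF subspace_alt_forms] by simp
  next
    case (Suc l')
    then show ?thesis
      using Suc.hyps(1)[of k l' \<alpha> "int_prod v \<beta>"] Suc.hyps(2) Suc.prems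
        int_prod_alt_forms[of \<beta> V l' v] by auto
  qed
  have "wedge \<alpha> \<beta> \<in> alt_forms V (Suc n)"
  proof (rule alt_forms_SucI[OF V])
    show "wedge \<alpha> \<beta> vs = 0" if "\<not> (length vs = Suc n \<and> set vs \<subseteq> V)" for vs
      using wedge_off Suc.prems Suc.hyps(2) that by metis
  next
    show "int_prod v (wedge \<alpha> \<beta>) \<in> alt_forms V n" for v
      unfolding int_prod_wedge[OF Suc.prems(1)]
      by (intro subspace_add subspace_alt_forms subspace_scale left right)
  next
    show "wedge \<alpha> \<beta> ((a *\<^sub>R u + b *\<^sub>R v) # vs) = a * wedge \<alpha> \<beta> (u # vs) + b * wedge \<alpha> \<beta> (v # vs)"
      if "u \<in> V" "v \<in> V" for u v a b vs
      by (simp add: wedge_Cons_alt_forms[OF Suc.prems(1)] int_prod_linear[OF Suc.prems(1) that]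
          int_prod_linear[OF Suc.prems(2) that] wedge_add_left wedge_add_right wedge_scaleR_left
          wedge_scaleR_right algebra_simps)
  next
    fix v vs
    show "wedge \<alpha> \<beta> (v # v # vs) = 0"
    proof (cases k)
      case 0
      then show ?thesis
        using Suc.prems by (simp add: wedge_Cons_alt_forms[of _ V 0] int_prod_0form int_prod_twice)
    next
      case (Suc k')
      then have "int_prod v \<alpha> \<in> alt_forms V k'" using Suc.prems int_prod_alt_forms by auto
      \<comment> \<open>Contracting twice with \<open>v\<close> leaves two mixed terms with the
        signs \<open>(-1) ^ k\<close> and \<open>(-1) ^ k'\<close>, which cancel since
        \<open>k = Suc k'\<close>.\<close>
      then show ?thesis
        using Suc.prems Suc
        by (simp add: wedge_Cons_alt_forms[of \<alpha> V k] wedge_Cons_alt_forms[of "int_prod v \<alpha>" V k'] int_prod_twice)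
    qed
  qed
  then show ?case using Suc.hyps(2) by simp
qed

section \<open>The inner product of forms\<close>

lemma form_inner_Nil [simp]: "form_inner [] \<alpha> \<beta> = \<alpha> [] * \<beta> []"
  by (simp add: form_inner_def)

lemma form_inner_Cons: "form_inner (e # es) \<alpha> \<beta> =
  form_inner es (int_prod e \<alpha>) (int_prod e \<beta>) + form_inner es \<alpha> \<beta>"
proof -
  have a: "{j. Suc j \<in> insert 0 (Suc ` I)} = I" "{j. Suc j \<in> Suc ` I} = I" for I
    by auto
  show ?thesis
    unfolding form_inner_def length_Cons sum_Pow_Suc sum.distrib[symmetric]
    by (intro sum.cong refl) (auto simp: nths_Cons a int_prod_def)
qed

lemma form_inner_zero_left [simp]: "form_inner es 0 \<beta> = 0"
  and form_inner_zero_right [simp]: "form_inner es \<alpha> 0 = 0"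
  and form_inner_minus: "form_inner es (- \<alpha>) (- \<beta>) = form_inner es \<alpha> \<beta>"
  by (simp_all add: form_inner_def)

text \<open>An analogue of Euler's identity for homogeneous functions; it reduces the change of
  orthonormal basis in \<^const>\<open>form_inner\<close> to that in a trace.\<close>

lemma form_inner_Suc:
  assumes V: "subspace V"
  shows "\<alpha> \<in> alt_forms V (Suc k) \<Longrightarrow> \<beta> \<in> alt_forms V (Suc k) \<Longrightarrow>
    real (Suc k) * form_inner es \<alpha> \<beta> = (\<Sum>x\<leftarrow>es. form_inner es (int_prod x \<alpha>) (int_prod x \<beta>))"
proof (induction es arbitrary: k \<alpha> \<beta>)
  case Nil
  then show ?case by (simp add: alt_forms_off)
next
  case (Cons e es)
  let ?\<alpha> = "int_prod e \<alpha>" and ?\<beta> = "int_prod e \<beta>"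
  \<comment> \<open>Contractions with \<open>e\<close> and \<open>x\<close> anticommute and the two
    signs cancel in the product, so the induction hypothesis for the contractions with
    \<open>e\<close> applies.\<close>
  have tail: "(\<Sum>x\<leftarrow>es. form_inner es (int_prod e (int_prod x \<alpha>)) (int_prod e (int_prod x \<beta>))) =
      real k * form_inner es ?\<alpha> ?\<beta>"
  proof (cases k)
    case 0
    then have "?\<alpha> \<in> alt_forms V 0" using Cons.prems int_prod_alt_forms by auto
    then show ?thesis
      using 0 int_prod_0form[of ?\<alpha> V]
      by (simp add: int_prod_swap[OF Cons.prems(1) V, of e] int_prod_swap[OF Cons.prems(2) V, of e]
          form_inner_minus)
  next
    case (Suc m)
    then show ?thesis
      using Cons.IH[of ?\<alpha> m ?\<beta>] Cons.prems int_prod_alt_forms[of \<alpha> V k e] int_prod_alt_forms[of \<beta> V k e]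
      by (simp add: int_prod_swap[OF Cons.prems(1) V, of e] int_prod_swap[OF Cons.prems(2) V, of e]
          form_inner_minus)
  qed
  show ?case
    using Cons.IH[OF Cons.prems] tail
    by (simp add: form_inner_Cons sum_list_addf int_prod_twice[OF Cons.prems(1)]
        int_prod_twice[OF Cons.prems(2)] algebra_simps)
qed

lemma form_inner_0:
  assumes "\<alpha> \<in> alt_forms V 0" "\<beta> \<in> alt_forms V 0"
  shows "form_inner es \<alpha> \<beta> = \<alpha> [] * \<beta> []"
  by (induction es) (auto simp: form_inner_Cons int_prod_0form[OF assms(1)])

lemma form_inner_gt:
  "\<alpha> \<in> alt_forms V k \<Longrightarrow> length es < k \<Longrightarrow> form_inner es \<alpha> \<beta> = 0"
proof (induction es arbitrary: \<alpha> \<beta> k)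
  case Nil
  then show ?case by (simp add: alt_forms_off)
next
  case (Cons e es)
  then obtain m where "k = Suc m" by (cases k) auto
  then show ?case
    using Cons.IH[of \<alpha> k] Cons.IH[of "int_prod e \<alpha>" m] Cons.prems int_prod_alt_forms[of \<alpha> V m]
    by (auto simp: form_inner_Cons)
qed

lemma form_inner_top:
  "\<alpha> \<in> alt_forms V (length es) \<Longrightarrow> form_inner es \<alpha> \<beta> = \<alpha> es * \<beta> es"
proof (induction es arbitrary: \<alpha> \<beta>)
  case (Cons e es)
  then show ?case
    using form_inner_gt[of \<alpha> V "Suc (length es)" es]
      Cons.IH[of "int_prod e \<alpha>"] int_prod_alt_forms[of \<alpha> V "length es"]
    by (simp add: form_inner_Cons) (simp add: int_prod_def)
qed simp

section \<open>Inner products on a subspace and their orthonormal bases\<close>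

lemma inner_product_on_combination:
  assumes "inner_product_on V g" "u \<in> V" "v \<in> V" "w \<in> V"
  shows "g (a *\<^sub>R u + b *\<^sub>R v) w = a * g u w + b * g v w"
  using assms by (simp add: inner_product_on_def)

lemma inner_product_on_sum:
  assumes "inner_product_on V g" "subspace V" "w \<in> V"
  shows "(\<And>i. i \<in> I \<Longrightarrow> u i \<in> V) \<Longrightarrow>
    g (\<Sum>i\<in>I. c i *\<^sub>R u i) w = (\<Sum>i\<in>I. c i * g (u i) w)"
proof (induction I rule: infinite_finite_induct)
  case (insert x F)
  have "(\<Sum>i\<in>F. c i *\<^sub>R u i) \<in> V"
    using insert by (intro subspace_sum[OF assms(2)] subspace_scale[OF assms(2)]) auto
  then have "g (c x *\<^sub>R u x + 1 *\<^sub>R (\<Sum>i\<in>F. c i *\<^sub>R u i)) w = c x * g (u x) w + 1 * g (\<Sum>i\<in>F. c i *\<^sub>R u i) w"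
    using assms insert by (intro inner_product_on_combination) auto
  then show ?case using insert by simp
next
  have "g (0 *\<^sub>R w + 0 *\<^sub>R w) w = 0 * g w w + 0 * g w w"
    using assms by (intro inner_product_on_combination)
  then have "g 0 w = 0" by simp
  then show "g (\<Sum>i\<in>{}. c i *\<^sub>R u i) w = (\<Sum>i\<in>{}. c i * g (u i) w)"
    "\<And>A. infinite A \<Longrightarrow> g (\<Sum>i\<in>A. c i *\<^sub>R u i) w = (\<Sum>i\<in>A. c i * g (u i) w)"
    by auto
qed

lemma distinct_orthonormal_basis:
  assumes "orthonormal_basis V g es"
  shows "distinct es"
  unfolding distinct_conv_nth
proof (intro allI impI notI)
  fix i j assume "i < length es" "j < length es" "i \<noteq> j" "es ! i = es ! j"
  then show False using assms unfolding orthonormal_basis_def by (metis zero_neq_one)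
qed

lemma orthonormal_basis_expand:
  assumes g: "inner_product_on V g" and V: "subspace V" and es: "orthonormal_basis V g es"
    and x: "x \<in> V"
  shows "x = (\<Sum>i<length es. g x (es ! i) *\<^sub>R es ! i)"
proof -
  have esV: "es ! i \<in> V" if "i < length es" for i
    using es that unfolding orthonormal_basis_def by auto
  have "x \<in> span (set es)" using es x by (simp add: orthonormal_basis_def)
  then have "x \<in> range (\<lambda>c. \<Sum>v\<in>set es. c v *\<^sub>R v)" by (simp add: span_finite)
  then obtain c where c: "x = (\<Sum>v\<in>set es. c v *\<^sub>R v)" by auto
  have dist: "distinct es" by (rule distinct_orthonormal_basis[OF es])
  have "x = (\<Sum>v\<leftarrow>es. c v *\<^sub>R v)"
    using c dist by (simp add: sum_list_distinct_conv_sum_set)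
  then have x': "x = (\<Sum>i<length es. c (es ! i) *\<^sub>R es ! i)"
    by (simp add: sum_list_sum_nth atLeast0LessThan)
  have "g x (es ! j) = c (es ! j)" if j: "j < length es" for j
  proof -
    have "g x (es ! j) = (\<Sum>i<length es. c (es ! i) * g (es ! i) (es ! j))"
      unfolding x' by (rule inner_product_on_sum[OF g V]) (use esV j in auto)
    also have "\<dots> = (\<Sum>i<length es. if i = j then c (es ! i) else 0)"
      by (intro sum.cong refl) (use es j in \<open>auto simp: orthonormal_basis_def\<close>)
    also have "\<dots> = c (es ! j)" using j by (simp add: sum.delta')
    finally show ?thesis .
  qed
  then show ?thesis using x' by (metis (no_types, lifting) lessThan_iff sum.cong)
qed

text \<open>The change of basis matrix \<open>g (es ! a) (es' ! i)\<close> has orthonormal columns,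
  as one sees by expanding \<open>es' ! i\<close> in \<open>es\<close>. The two lists are not
  assumed to be equally long, so that this lemma can serve to prove it.\<close>

lemma orthonormal_trace:
  fixes B :: "'v::real_vector \<Rightarrow> 'v \<Rightarrow> real"
  assumes g: "inner_product_on V g" and V: "subspace V"
    and es: "orthonormal_basis V g es" and es': "orthonormal_basis V g es'"
    and B1: "\<And>(c::nat \<Rightarrow> real) u v I. v \<in> V \<Longrightarrow> (\<And>i. i \<in> I \<Longrightarrow> u i \<in> V) \<Longrightarrow> B (\<Sum>i\<in>I. c i *\<^sub>R u i) v = (\<Sum>i\<in>I. c i * B (u i) v)"
    and B2: "\<And>(c::nat \<Rightarrow> real) u v I. v \<in> V \<Longrightarrow> (\<And>i. i \<in> I \<Longrightarrow> u i \<in> V) \<Longrightarrow> B v (\<Sum>i\<in>I. c i *\<^sub>R u i) = (\<Sum>i\<in>I. c i * B v (u i))"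
  shows "(\<Sum>e\<leftarrow>es. B e e) = (\<Sum>e\<leftarrow>es'. B e e)"
proof -
  let ?n = "length es" and ?m = "length es'"
  have esV: "es ! i \<in> V" if "i < ?n" for i
    using es that unfolding orthonormal_basis_def by auto
  have esV': "es' ! i \<in> V" if "i < ?m" for i
    using es' that unfolding orthonormal_basis_def by auto
  have sym: "g u v = g v u" if "u \<in> V" "v \<in> V" for u v
    using g that by (simp add: inner_product_on_def)
  have "B (es ! a) (es ! a) =
      (\<Sum>i<?m. \<Sum>j<?m. g (es ! a) (es' ! i) * g (es ! a) (es' ! j) * B (es' ! i) (es' ! j))"
    if a: "a < ?n" for a
  proof -
    have x: "es ! a = (\<Sum>i<?m. g (es ! a) (es' ! i) *\<^sub>R es' ! i)"
      using orthonormal_basis_expand[OF g V es' esV[OF a]] .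
    have "B (es ! a) (es ! a) = B (\<Sum>i<?m. g (es ! a) (es' ! i) *\<^sub>R es' ! i) (es ! a)"
      by (rule arg_cong[where f = "\<lambda>z. B z (es ! a)", OF x])
    also have "\<dots> = (\<Sum>i<?m. g (es ! a) (es' ! i) * B (es' ! i) (es ! a))"
      by (rule B1) (use esV[OF a] esV' in auto)
    also have "\<dots> = (\<Sum>i<?m. g (es ! a) (es' ! i) * B (es' ! i) (\<Sum>j<?m. g (es ! a) (es' ! j) *\<^sub>R es' ! j))"
      by (intro sum.cong refl arg_cong2[where f = "(*)"] arg_cong[where f = "B _", OF x])
    also have "\<dots> = (\<Sum>i<?m. g (es ! a) (es' ! i) * (\<Sum>j<?m. g (es ! a) (es' ! j) * B (es' ! i) (es' ! j)))"
      by (intro sum.cong refl arg_cong2[where f = "(*)"] B2) (use esV' in auto)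
    finally show ?thesis by (simp add: sum_distrib_left mult.assoc)
  qed
  then have "(\<Sum>a<?n. B (es ! a) (es ! a)) =
      (\<Sum>a<?n. \<Sum>i<?m. \<Sum>j<?m. g (es ! a) (es' ! i) * g (es ! a) (es' ! j) * B (es' ! i) (es' ! j))"
    by simp
  also have "\<dots> = (\<Sum>i<?m. \<Sum>j<?m. (\<Sum>a<?n. g (es ! a) (es' ! i) * g (es ! a) (es' ! j)) * B (es' ! i) (es' ! j))"
    unfolding sum_distrib_right
    by (rule trans[OF sum.swap], rule sum.cong[OF refl], rule sum.swap)
  also have "\<dots> = (\<Sum>i<?m. \<Sum>j<?m. if j = i then B (es' ! i) (es' ! i) else 0)"
  proof (intro sum.cong refl)
    fix i j assume "i \<in> {..<?m}" "j \<in> {..<?m}"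
    then have ij: "i < ?m" "j < ?m" by auto
    have "g (es' ! i) (es' ! j) = g (\<Sum>a<?n. g (es' ! i) (es ! a) *\<^sub>R es ! a) (es' ! j)"
      by (rule arg_cong[where f = "\<lambda>z. g z (es' ! j)", OF orthonormal_basis_expand[OF g V es esV'[OF ij(1)]]])
    also have "\<dots> = (\<Sum>a<?n. g (es' ! i) (es ! a) * g (es ! a) (es' ! j))"
      by (rule inner_product_on_sum[OF g V]) (use esV esV'[OF ij(2)] in auto)
    also have "\<dots> = (\<Sum>a<?n. g (es ! a) (es' ! i) * g (es ! a) (es' ! j))"
      using sym esV esV' ij by (intro sum.cong refl) auto
    finally show "(\<Sum>a<?n. g (es ! a) (es' ! i) * g (es ! a) (es' ! j)) * B (es' ! i) (es' ! j)
        = (if j = i then B (es' ! i) (es' ! i) else 0)"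
      using es' ij unfolding orthonormal_basis_def by auto
  qed
  also have "\<dots> = (\<Sum>i<?m. B (es' ! i) (es' ! i))" by simp
  finally show ?thesis by (simp add: sum_list_sum_nth atLeast0LessThan)
qed

text \<open>The trace of \<open>g\<close> itself counts the vectors of an orthonormal basis.\<close>

lemma length_orthonormal_basis:
  fixes V :: "'v::real_vector set"
  assumes g: "inner_product_on V g" and V: "subspace V"
    and es: "orthonormal_basis V g es" and es': "orthonormal_basis V g es'"
  shows "length es = length es'"
proof -
  have sym: "g u v = g v u" if "u \<in> V" "v \<in> V" for u v
    using g that by (simp add: inner_product_on_def)
  have tr: "(\<Sum>e\<leftarrow>fs. g e e) = real (length fs)" if "orthonormal_basis V g fs" for fs
    using that unfolding orthonormal_basis_def sum_list_sum_nth by (simp add: atLeast0LessThan)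
  have "(\<Sum>e\<leftarrow>es. g e e) = (\<Sum>e\<leftarrow>es'. g e e)"
  proof (rule orthonormal_trace[OF g V es es', where B = g])
    fix c :: "nat \<Rightarrow> real" and u :: "nat \<Rightarrow> 'v" and v I assume *: "v \<in> V" "\<And>i. i \<in> I \<Longrightarrow> u i \<in> V"
    show 1: "g (\<Sum>i\<in>I. c i *\<^sub>R u i) v = (\<Sum>i\<in>I. c i * g (u i) v)"
      by (rule inner_product_on_sum[OF g V]) (use * in auto)
    have "(\<Sum>i\<in>I. c i *\<^sub>R u i) \<in> V"
      using * by (intro subspace_sum[OF V] subspace_scale[OF V]) auto
    then show "g v (\<Sum>i\<in>I. c i *\<^sub>R u i) = (\<Sum>i\<in>I. c i * g v (u i))"
      using 1 sym[OF _ *(1)] sym[OF *(1) *(2)] by simp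
  qed
  then show ?thesis using tr[OF es] tr[OF es'] by simp
qed

lemma form_inner_int_prod_sum:
  assumes V: "subspace V" and \<alpha>: "\<alpha> \<in> alt_forms V k" and u: "\<And>i. i \<in> I \<Longrightarrow> u i \<in> V"
  shows "form_inner es (int_prod (\<Sum>i\<in>I. c i *\<^sub>R u i) \<alpha>) \<beta> = (\<Sum>i\<in>I. c i * form_inner es (int_prod (u i) \<alpha>) \<beta>)"
    and "form_inner es \<beta> (int_prod (\<Sum>i\<in>I. c i *\<^sub>R u i) \<alpha>) = (\<Sum>i\<in>I. c i * form_inner es \<beta> (int_prod (u i) \<alpha>))"
proof -
  have "\<alpha> ((\<Sum>i\<in>I. c i *\<^sub>R u i) # vs) = (\<Sum>i\<in>I. c i * \<alpha> (u i # vs))" for vs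
    by (rule alt_forms_head_sum[OF \<alpha> V u])
  then show "form_inner es (int_prod (\<Sum>i\<in>I. c i *\<^sub>R u i) \<alpha>) \<beta> = (\<Sum>i\<in>I. c i * form_inner es (int_prod (u i) \<alpha>) \<beta>)"
    "form_inner es \<beta> (int_prod (\<Sum>i\<in>I. c i *\<^sub>R u i) \<alpha>) = (\<Sum>i\<in>I. c i * form_inner es \<beta> (int_prod (u i) \<alpha>))"
    by (simp_all add: form_inner_def int_prod_def sum_distrib_left sum_distrib_right mult_ac
        sum.swap[of _ I "Pow _"])
qed

text \<open>In the identity \<open>form_inner_Suc\<close> the basis occurs twice. Inside, it is
  exchanged by the induction hypothesis for the contractions; the remaining sum over
  \<open>es\<close> is the trace of a bilinear form.\<close>

lemma form_inner_basis_independent: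
  assumes g: "inner_product_on V g" and V: "subspace V"
    and es: "orthonormal_basis V g es" and es': "orthonormal_basis V g es'"
  shows "\<alpha> \<in> alt_forms V k \<Longrightarrow> \<beta> \<in> alt_forms V k \<Longrightarrow> form_inner es \<alpha> \<beta> = form_inner es' \<alpha> \<beta>"
proof (induction k arbitrary: \<alpha> \<beta>)
  case 0
  then show ?case by (simp add: form_inner_0)
next
  case (Suc k)
  have "real (Suc k) * form_inner es \<alpha> \<beta> = (\<Sum>x\<leftarrow>es. form_inner es (int_prod x \<alpha>) (int_prod x \<beta>))"
    using form_inner_Suc[OF V Suc.prems] .
  also have "\<dots> = (\<Sum>x\<leftarrow>es. form_inner es' (int_prod x \<alpha>) (int_prod x \<beta>))"
    using Suc.IH Suc.prems int_prod_alt_forms by metis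
  also have "\<dots> = (\<Sum>x\<leftarrow>es'. form_inner es' (int_prod x \<alpha>) (int_prod x \<beta>))"
    by (rule orthonormal_trace[OF g V es es', where
          B = "\<lambda>x y. form_inner es' (int_prod x \<alpha>) (int_prod y \<beta>)"])
      (auto simp: form_inner_int_prod_sum[OF V Suc.prems(1)] form_inner_int_prod_sum[OF V Suc.prems(2)])
  also have "\<dots> = real (Suc k) * form_inner es' \<alpha> \<beta>"
    using form_inner_Suc[OF V Suc.prems] by simp
  finally show ?case by simp
qed

section \<open>Forms are determined by their values on increasing lists of basis vectors\<close>

text \<open>Absolute values hide the sign of the permutation; sorting is used only to transfer the
  vanishing of a value.\<close>

lemma abs_alt_forms_insort:
  assumes V: "subspace V"
  shows "\<alpha> \<in> alt_forms V k \<Longrightarrow> \<bar>\<alpha> (map e (insort i ks))\<bar> = \<bar>\<alpha> (map e (i # ks))\<bar>"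
proof (induction ks arbitrary: \<alpha> k)
  case (Cons j ks)
  show ?case
  proof (cases k)
    case 0
    then show ?thesis using Cons.prems alt_forms_off[of \<alpha> V 0] by auto
  next
    case (Suc m)
    then have "int_prod (e j) \<alpha> \<in> alt_forms V m" using Cons.prems int_prod_alt_forms by auto
    from Cons.IH[OF this] show ?thesis
      using alt_forms_swap[OF Cons.prems V, of "e i" "e j" "map e ks"] by (simp add: int_prod_def)
  qed
qed simp

lemma abs_alt_forms_sort:
  assumes V: "subspace V"
  shows "\<alpha> \<in> alt_forms V k \<Longrightarrow> \<bar>\<alpha> (map e (sort ks))\<bar> = \<bar>\<alpha> (map e ks)\<bar>"
proof (induction ks arbitrary: \<alpha> k)
  case (Cons i ks)
  show ?case
  proof (cases k)
    case 0
    then show ?thesis using Cons.prems alt_forms_off[of \<alpha> V 0] by (auto simp: sort_key_def)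
  next
    case (Suc m)
    then have "int_prod (e i) \<alpha> \<in> alt_forms V m" using Cons.prems int_prod_alt_forms by auto
    from Cons.IH[OF this] show ?thesis
      using abs_alt_forms_insort[OF V Cons.prems, of e i "sort ks"] by (simp add: int_prod_def)
  qed
qed simp

lemma alt_forms_eq_0_basis:
  assumes V: "subspace V" and e: "e ` I \<subseteq> V" "V \<subseteq> span (e ` I)" and I: "finite I"
  shows "\<alpha> \<in> alt_forms V k \<Longrightarrow> (\<And>ks. length ks = k \<Longrightarrow> set ks \<subseteq> I \<Longrightarrow> \<alpha> (map e ks) = 0) \<Longrightarrow> \<alpha> = 0"
proof (induction k arbitrary: \<alpha>)
  case 0
  show ?case
  proof (rule ext)
    show "\<alpha> vs = 0 vs" for vs
      using alt_forms_off[OF 0(1), of vs] 0(2)[of "[]"] by (cases vs) auto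
  qed
next
  case (Suc k)
  have "int_prod (e i) \<alpha> = 0" if "i \<in> I" for i
    using Suc.prems(2)[of "i # _"] that
    by (intro Suc.IH int_prod_alt_forms Suc.prems(1)) (auto simp: int_prod_def)
  then have z: "\<alpha> (e i # vs) = 0" if "i \<in> I" for i vs
    using that by (auto simp: int_prod_def fun_eq_iff)
  show ?case
  proof (rule ext)
    fix vs
    show "\<alpha> vs = 0 vs"
    proof (cases "length vs = Suc k \<and> set vs \<subseteq> V")
      case True
      then obtain v ws where vs: "vs = v # ws" "v \<in> V" by (cases vs) auto
      then have "v \<in> span (e ` I)" using e by auto
      then obtain c where "v = (\<Sum>u\<in>e ` I. c u *\<^sub>R u)"
        using I by (auto simp: span_finite)
      moreover have "\<alpha> ((\<Sum>u\<in>e ` I. c u *\<^sub>R u) # ws) = (\<Sum>u\<in>e ` I. c u * \<alpha> (u # ws))"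
        using e by (intro alt_forms_head_sum[OF Suc.prems(1) V]) auto
      ultimately show ?thesis using vs z by (auto intro!: sum.neutral)
    qed (use alt_forms_off[OF Suc.prems(1)] in auto)
  qed
qed

text \<open>Repeated indices give 0 and sorting changes at most the sign, so increasing index lists
  remain. In dimension 7 there is one of them in degree 7, and there are 35 in degree 4.\<close>

lemma alt_forms_eq_0I:
  fixes e :: "'i::linorder \<Rightarrow> 'v::real_vector"
  assumes V: "subspace V" and e: "e ` I \<subseteq> V" "V \<subseteq> span (e ` I)" and I: "finite I"
    and \<alpha>: "\<alpha> \<in> alt_forms V k"
    and inc: "\<And>ks. length ks = k \<Longrightarrow> set ks \<subseteq> I \<Longrightarrow> sorted_wrt (<) ks \<Longrightarrow> \<alpha> (map e ks) = 0"
  shows "\<alpha> = 0"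
proof (rule alt_forms_eq_0_basis[OF V e I \<alpha>])
  fix ks assume l: "length ks = k" "set ks \<subseteq> I"
  show "\<alpha> (map e ks) = 0"
  proof (cases "distinct ks")
    case True
    then have "sorted_wrt (<) (sort ks)" by (simp add: strict_sorted_iff)
    then have "\<alpha> (map e (sort ks)) = 0" using l by (intro inc) auto
    then show ?thesis using abs_alt_forms_sort[OF V \<alpha>, of e ks] by simp
  next
    case False
    then obtain i j where ij: "i < j" "j < length ks" "ks ! i = ks ! j"
      by (metis distinct_conv_nth linorder_neqE_nat)
    then show ?thesis
      using alt_forms_eq[OF \<alpha>, of "map e ks" i j] l e by auto
  qed
qed

text \<open>A contracted 1-form is a constant that multiplies \<open>\<gamma>\<close>. As
  \<open>\<gamma>\<close> is an arbitrary function, the rule can be iterated and evaluates products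
  of \<open>dx\<close> by rewriting.\<close>

lemma wedge_1form_Cons:
  assumes "\<alpha> \<in> alt_forms V 1"
  shows "wedge \<alpha> \<gamma> (v # vs) = \<alpha> [v] * \<gamma> vs - wedge \<alpha> (int_prod v \<gamma>) vs"
proof -
  have "int_prod v \<alpha> \<in> alt_forms V 0" using assms int_prod_alt_forms[of \<alpha> V 0] by simp
  note * = int_prod_0form[OF this] alt_forms_off[OF this]
  have "wedge (int_prod v \<alpha>) \<gamma> vs = \<alpha> [v] * \<gamma> vs"
  proof -
    have "wedge (int_prod v \<alpha>) \<gamma> us = int_prod v \<alpha> [] * \<gamma> us" for us
    proof (induction us arbitrary: \<gamma>)
      case (Cons u us)
      have "(\<lambda>us. (- 1) ^ length us * int_prod v \<alpha> us) = int_prod v \<alpha>"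
      proof (rule ext)
        show "(- 1) ^ length us * int_prod v \<alpha> us = int_prod v \<alpha> us" for us
          using *(2)[of us] by (cases us) auto
      qed
      then show ?case using Cons[of "int_prod u \<gamma>"]
        by (simp add: wedge_Cons *(1)) (simp add: int_prod_def)
    qed simp
    then show ?thesis by (simp add: int_prod_def)
  qed
  then show ?thesis by (simp add: wedge_Cons_alt_forms[OF assms])
qed

lemma alt_forms_1_Nil: "\<alpha> \<in> alt_forms V 1 \<Longrightarrow> \<alpha> [] = 0"
  by (simp add: alt_forms_off)

section \<open>The standard forms in coordinates\<close>

lemma exhaust_7:
  fixes x :: 7
  shows "x = 1 \<or> x = 2 \<or> x = 3 \<or> x = 4 \<or> x = 5 \<or> x = 6 \<or> x = 7"
proof (induct x)
  case (of_int z)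
  \<comment> \<open>The type \<open>7\<close> is represented by the integers 0 to 6, so that
    \<open>7 = 0\<close> in it.\<close>
  then have "z = 0 \<or> z = 1 \<or> z = 2 \<or> z = 3 \<or> z = 4 \<or> z = 5 \<or> z = 6" by (simp, arith)
  then show ?case by auto
qed

lemma forall_7: "(\<forall>i::7. P i) \<longleftrightarrow> P 1 \<and> P 2 \<and> P 3 \<and> P 4 \<and> P 5 \<and> P 6 \<and> P 7"
  by (metis exhaust_7)

lemma UNIV_7: "(UNIV::7 set) = {1, 2, 3, 4, 5, 6, 7}"
  using exhaust_7 by auto

lemma sum_7: "(\<Sum>i\<in>(UNIV::7 set). f i) = f 1 + f 2 + f 3 + f 4 + f 5 + f 6 + f 7"
  for f :: "7 \<Rightarrow> 'b::comm_monoid_add"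
  unfolding UNIV_7 by (simp add: add.assoc)

lemma inner_7: "(x::real^7) \<bullet> y = x $ 1 * y $ 1 + x $ 2 * y $ 2 + x $ 3 * y $ 3 + x $ 4 * y $ 4
    + x $ 5 * y $ 5 + x $ 6 * y $ 6 + x $ 7 * y $ 7"
  by (simp add: inner_vec_def sum_7)

abbreviation ax :: "7 \<Rightarrow> real^7" where "ax i \<equiv> axis i 1"

lemma axis_nth: "axis i (1::real) $ j = (if j = i then 1 else 0)"
  by (auto simp: axis_def)

lemma dx_alt_forms: "dx i \<in> alt_forms UNIV 1"
  by (rule alt_formsI) (auto simp: dx_def length_Suc_conv)

lemma dx_single [simp]: "dx i [v] = v $ i"
  by (simp add: dx_def)

lemma dx_other [simp]: "dx i [] = 0" "dx i (u # v # vs) = 0"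
  by (simp_all add: dx_def)

lemma wedge_dx_Nil: "wedge (dx i) \<gamma> [] = 0"
  and wedge_dx_Cons: "wedge (dx i) \<gamma> (v # vs) = v $ i * \<gamma> vs - wedge (dx i) (int_prod v \<gamma>) vs"
  by (simp_all add: wedge_1form_Cons[OF dx_alt_forms])

lemma int_prod_apply: "int_prod v \<alpha> vs = \<alpha> (v # vs)"
  by (simp add: int_prod_def)

lemmas wedge_dx_simps = wedge_dx_Nil wedge_dx_Cons int_prod_apply

lemma dx3_alt_forms: "dx3 i j k \<in> alt_forms UNIV 3"
proof -
  have "wedge (dx i) (wedge (dx j) (dx k)) \<in> alt_forms UNIV (1 + (1 + 1))"
    by (intro wedge_alt_forms subspace_UNIV dx_alt_forms)
  then show ?thesis by (simp add: dx3_def numeral_3_eq_3)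
qed

lemma dx3_apply: "dx3 i j k [a, b, c] = a $ i * (b $ j * c $ k - b $ k * c $ j)
    - b $ i * (a $ j * c $ k - a $ k * c $ j) + c $ i * (a $ j * b $ k - a $ k * b $ j)"
  by (simp add: dx3_def wedge_dx_simps algebra_simps)

definition dx4 :: "7 \<Rightarrow> 7 \<Rightarrow> 7 \<Rightarrow> 7 \<Rightarrow> (real^7) list \<Rightarrow> real" where
  "dx4 i j k l = wedge (dx i) (dx3 j k l)"

lemma dx4_alt_forms: "dx4 i j k l \<in> alt_forms UNIV 4"
proof -
  have "wedge (dx i) (dx3 j k l) \<in> alt_forms UNIV (1 + 3)"
    by (intro wedge_alt_forms subspace_UNIV dx_alt_forms dx3_alt_forms)
  then show ?thesis by (simp add: dx4_def)
qed

lemma dx4_apply: "dx4 i j k l [a, b, c, d] = a $ i * dx3 j k l [b, c, d]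
    - b $ i * dx3 j k l [a, c, d] + c $ i * dx3 j k l [a, b, d] - d $ i * dx3 j k l [a, b, c]"
  by (simp add: dx4_def wedge_dx_simps algebra_simps)

text \<open>The candidate for the Hodge dual of \<open>phi0\<close>: each index triple of
  \<open>phi0\<close> is replaced by its complement and keeps its sign. That it is the dual is the
  content of \<open>wedge_psi0\<close>.\<close>

definition psi0 :: "(real^7) list \<Rightarrow> real" where
  "psi0 = dx4 4 5 6 7 + dx4 2 3 6 7 + dx4 2 3 4 5 + dx4 1 3 5 7 - dx4 1 3 4 6 - dx4 1 2 5 6
    - dx4 1 2 4 7"

lemma phi0_alt_forms: "phi0 \<in> alt_forms UNIV 3"
  unfolding phi0_def
  by (intro subspace_add subspace_diff subspace_alt_forms dx3_alt_forms)

lemma psi0_alt_forms: "psi0 \<in> alt_forms UNIV 4"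
  unfolding psi0_def
  by (intro subspace_add subspace_diff subspace_alt_forms dx4_alt_forms)

lemma phi0_apply: "phi0 us = dx3 1 2 3 us + dx3 1 4 5 us + dx3 1 6 7 us + dx3 2 4 6 us
    - dx3 2 5 7 us - dx3 3 4 7 us - dx3 3 5 6 us"
  by (simp add: phi0_def)

lemma psi0_apply: "psi0 us = dx4 4 5 6 7 us + dx4 2 3 6 7 us + dx4 2 3 4 5 us + dx4 1 3 5 7 us
    - dx4 1 3 4 6 us - dx4 1 2 5 6 us - dx4 1 2 4 7 us"
  by (simp add: psi0_def)

lemma phi0_ax:
  "phi0 [a, b, ax 1] = a$2*b$3 - a$3*b$2 + a$4*b$5 - a$5*b$4 + a$6*b$7 - a$7*b$6"
  "phi0 [a, b, ax 2] = a$3*b$1 - a$1*b$3 + a$4*b$6 - a$6*b$4 + a$7*b$5 - a$5*b$7"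
  "phi0 [a, b, ax 3] = a$1*b$2 - a$2*b$1 + a$7*b$4 - a$4*b$7 + a$6*b$5 - a$5*b$6"
  "phi0 [a, b, ax 4] = a$5*b$1 - a$1*b$5 + a$6*b$2 - a$2*b$6 + a$3*b$7 - a$7*b$3"
  "phi0 [a, b, ax 5] = a$1*b$4 - a$4*b$1 + a$2*b$7 - a$7*b$2 + a$3*b$6 - a$6*b$3"
  "phi0 [a, b, ax 6] = a$7*b$1 - a$1*b$7 + a$2*b$4 - a$4*b$2 + a$5*b$3 - a$3*b$5"
  "phi0 [a, b, ax 7] = a$1*b$6 - a$6*b$1 + a$5*b$2 - a$2*b$5 + a$4*b$3 - a$3*b$4"
  by (simp_all add: phi0_apply dx3_apply axis_nth)

text \<open>The numbers \<open>phi0 [a, b, ax m]\<close> are the components of the cross product of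
  \<open>a\<close> and \<open>b\<close> in dimension 7. The identity is the analogue of the Lagrange
  identity for the cross product in dimension 3, with \<open>psi0\<close> as the correction term;
  written out, it is polynomial in 28 coordinates.\<close>

lemma phi0_contract:
  "(\<Sum>m\<in>UNIV. phi0 [a, b, ax m] * phi0 [c, d, ax m]) =
    (a \<bullet> c) * (b \<bullet> d) - (a \<bullet> d) * (b \<bullet> c) + psi0 [a, b, c, d]"
  unfolding sum_7 inner_7 phi0_ax psi0_apply dx4_apply dx3_apply
  by algebra

section \<open>Evaluating wedge products\<close>

text \<open>The lists \<open>as\<close> and \<open>bs\<close> collect the vectors already assigned to \<open>\<alpha>\<close> and \<open>\<beta>\<close>; the simplifier
  evaluates wedge products by this recursion.\<close>

primrec wedge_split ::
  "('v list \<Rightarrow> real) \<Rightarrow> ('v list \<Rightarrow> real) \<Rightarrow> 'v list \<Rightarrow> 'v list \<Rightarrow> 'v list \<Rightarrow> real" where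
  "wedge_split \<alpha> \<beta> as bs [] = \<alpha> as * \<beta> bs"
| "wedge_split \<alpha> \<beta> as bs (v # vs) =
    (-1) ^ length bs * wedge_split \<alpha> \<beta> (as @ [v]) bs vs + wedge_split \<alpha> \<beta> as (bs @ [v]) vs"

text \<open>Every later vector assigned to \<open>\<alpha>\<close> has to pass the
  \<open>length bs\<close> vectors already held by \<open>\<beta>\<close>, whence the exponent
  \<open>length bs * length us\<close>.\<close>

lemma wedge_split_eq: "wedge_split \<alpha> \<beta> as bs vs =
  wedge (\<lambda>us. (-1) ^ (length bs * length us) * \<alpha> (as @ us)) (\<lambda>us. \<beta> (bs @ us)) vs"
proof (induction vs arbitrary: "as" bs)
  case (Cons v vs)
  let ?n = "length bs"
  have 1: "int_prod v (\<lambda>us. (-1) ^ (?n * length us) * \<alpha> (as @ us)) =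
      (-1) ^ ?n *\<^sub>R (\<lambda>us. (-1) ^ (?n * length us) * \<alpha> ((as @ [v]) @ us))"
    by (auto simp: int_prod_def fun_eq_iff power_add)
  have 2: "int_prod v (\<lambda>us. \<beta> (bs @ us)) = (\<lambda>us. \<beta> ((bs @ [v]) @ us))"
    by (auto simp: int_prod_def fun_eq_iff)
  have 3: "(\<lambda>us. (-1) ^ length us * ((-1) ^ (?n * length us) * \<alpha> (as @ us))) =
      (\<lambda>us. (-1) ^ (length (bs @ [v]) * length us) * \<alpha> (as @ us))"
    by (auto simp: fun_eq_iff power_add)
  show ?case
    by (simp only: wedge_split.simps Cons wedge_Cons 1 2 3 wedge_scaleR_left fun_scaleR_apply
        real_scaleR_def)
qed simp

lemma wedge_eq_split: "wedge \<alpha> \<beta> vs = wedge_split \<alpha> \<beta> [] [] vs"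
  by (simp add: wedge_split_eq)

abbreviation std_basis :: "(real^7) list" where
  "std_basis \<equiv> [ax 1, ax 2, ax 3, ax 4, ax 5, ax 6, ax 7]"

lemma alt_forms_off_2:
  assumes "\<alpha> \<in> alt_forms V 2"
  shows "\<alpha> [] = 0" "\<alpha> [a] = 0" "\<alpha> (a # b # c # vs) = 0"
  using alt_forms_off[OF assms] by auto

lemma alt_forms_off_3:
  assumes "\<alpha> \<in> alt_forms V 3"
  shows "\<alpha> [] = 0" "\<alpha> [a] = 0" "\<alpha> [a, b] = 0" "\<alpha> (a # b # c # d # vs) = 0"
  using alt_forms_off[OF assms] by auto

lemma alt_forms_off_4:
  assumes "\<alpha> \<in> alt_forms V 4"
  shows "\<alpha> [] = 0" "\<alpha> [a] = 0" "\<alpha> [a, b] = 0" "\<alpha> [a, b, c] = 0" "\<alpha> (a # b # c # d # e # vs) = 0"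
  using alt_forms_off[OF assms] by auto

lemma wedge_2_2:
  assumes "\<alpha> \<in> alt_forms V 2" "\<beta> \<in> alt_forms V 2"
  shows "wedge \<alpha> \<beta> [a, b, c, d] = \<alpha> [a, b] * \<beta> [c, d] - \<alpha> [a, c] * \<beta> [b, d] + \<alpha> [a, d] * \<beta> [b, c]
    + \<alpha> [b, c] * \<beta> [a, d] - \<alpha> [b, d] * \<beta> [a, c] + \<alpha> [c, d] * \<beta> [a, b]"
  by (simp add: wedge_eq_split alt_forms_off_2[OF assms(1)] alt_forms_off_2[OF assms(2)])

lemma sorted_lists_7:
  assumes "length ks = 7" "set ks \<subseteq> {..<7}" "sorted_wrt (<) ks"
  shows "ks = [0..<7::nat]"
proof -
  have "distinct ks" "sorted ks" using assms(3) by (auto simp: strict_sorted_iff)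
  moreover have "set ks = {..<7}"
    using assms(1,2) distinct_card[OF \<open>distinct ks\<close>] by (intro card_subset_eq) auto
  ultimately show ?thesis
    by (intro sorted_distinct_set_unique) (auto simp: atLeast0LessThan)
qed

lemma span_std_basis:
  "(\<lambda>n. std_basis ! n) ` {..<7} \<subseteq> UNIV" "UNIV \<subseteq> span ((\<lambda>n. std_basis ! n) ` {..<7})"
proof -
  have "x \<in> span ((\<lambda>n. std_basis ! n) ` {..<7})" for x :: "real^7"
  proof -
    have "x = (\<Sum>i\<in>UNIV. x $ i *\<^sub>R ax i)"
      by (simp add: vec_eq_iff axis_nth sum_component if_distrib cong: if_cong)
    moreover have "ax i \<in> (\<lambda>n. std_basis ! n) ` {..<7}" for i
    proof -
      have "set std_basis = (\<lambda>n. std_basis ! n) ` {..<7}"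
        by (auto simp: lessThan_Suc numeral_eq_Suc)
      moreover have "ax i \<in> set std_basis" using exhaust_7[of i] by auto
      ultimately show ?thesis by simp
    qed
    then have "(\<Sum>i\<in>UNIV. x $ i *\<^sub>R ax i) \<in> span ((\<lambda>n. std_basis ! n) ` {..<7})"
      by (intro span_sum span_scale span_base) 
    ultimately show ?thesis by simp
  qed
  then show "UNIV \<subseteq> span ((\<lambda>n. std_basis ! n) ` {..<7})" by blast
qed simp

lemma map_std_basis: "map ((!) std_basis) [0..<7] = std_basis"
proof -
  have "length std_basis = 7" by simp
  then show ?thesis using map_nth[of std_basis] by metis
qed

text \<open>With seven basis vectors there is one increasing list of length 7, so one value fixes a
  7-form.\<close>

lemma seven_forms_eq:
  assumes "\<alpha> \<in> alt_forms UNIV 7" "\<beta> \<in> alt_forms UNIV 7" "\<alpha> std_basis = \<beta> std_basis"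
  shows "\<alpha> = \<beta>"
proof -
  have "\<alpha> - \<beta> = 0"
  proof (rule alt_forms_eq_0I[OF subspace_UNIV span_std_basis finite_lessThan])
    show "\<alpha> - \<beta> \<in> alt_forms UNIV 7" using assms by (intro subspace_diff subspace_alt_forms)
  next
    fix ks :: "nat list" assume "length ks = 7" "set ks \<subseteq> {..<7}" "sorted_wrt (<) ks"
    then have "ks = [0..<7]" by (rule sorted_lists_7)
    then show "(\<alpha> - \<beta>) (map ((!) std_basis) ks) = 0"
      using assms(3) by (simp only: map_std_basis fun_diff_def diff_self)
  qed
  then show ?thesis by simp
qed

text \<open>Of the 35 terms those survive whose last three vectors form one of the seven triples of
  \<open>phi0\<close>.\<close>

lemma wedge_4_3_std_basis:
  assumes "\<alpha> \<in> alt_forms UNIV 4"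
  shows "wedge \<alpha> phi0 std_basis =
     \<alpha> [ax 4, ax 5, ax 6, ax 7] + \<alpha> [ax 2, ax 3, ax 6, ax 7] + \<alpha> [ax 2, ax 3, ax 4, ax 5]
   + \<alpha> [ax 1, ax 3, ax 5, ax 7] - \<alpha> [ax 1, ax 3, ax 4, ax 6] - \<alpha> [ax 1, ax 2, ax 5, ax 6]
   - \<alpha> [ax 1, ax 2, ax 4, ax 7]"
  by (simp add: wedge_eq_split alt_forms_off_4[OF assms] alt_forms_off_3[OF phi0_alt_forms])
    (simp add: phi0_ax axis_nth)

section \<open>The 7-form-valued bilinear form that determines the metric\<close>

definition bform :: "((real^7) list \<Rightarrow> real) \<Rightarrow> real^7 \<Rightarrow> real^7 \<Rightarrow> (real^7) list \<Rightarrow> real" where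
  "bform \<phi> X Y = wedge (wedge (int_prod X \<phi>) (int_prod Y \<phi>)) \<phi>"

lemma bform_alt_forms:
  assumes "subspace V" "\<phi> \<in> alt_forms V 3"
  shows "wedge (wedge (int_prod X \<phi>) (int_prod Y \<phi>)) \<phi> \<in> alt_forms V 7"
proof -
  have "wedge (wedge (int_prod X \<phi>) (int_prod Y \<phi>)) \<phi> \<in> alt_forms V ((2 + 2) + 3)"
    using assms by (intro wedge_alt_forms int_prod_alt_forms) (auto simp: numeral_3_eq_3)
  then show ?thesis by simp
qed

lemma bform_phi0_std_basis: "bform phi0 X Y std_basis = 6 * (X \<bullet> Y)"
proof -
  have 2: "int_prod X phi0 \<in> alt_forms UNIV 2" for X
    using phi0_alt_forms by (intro int_prod_alt_forms) (simp add: numeral_3_eq_3)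
  have "wedge (int_prod X phi0) (int_prod Y phi0) \<in> alt_forms UNIV (2 + 2)"
    by (intro wedge_alt_forms 2) auto
  then have 4: "wedge (int_prod X phi0) (int_prod Y phi0) \<in> alt_forms UNIV 4" by simp
  show ?thesis
    unfolding bform_def wedge_4_3_std_basis[OF 4] wedge_2_2[OF 2 2] inner_7
    by (simp add: int_prod_apply phi0_ax axis_nth)
qed

text \<open>The standard volume form, taken from the equation that defines the metric:
  \<open>ax 1\<close> has length 1, so the bilinear form has the value 6 vol there.\<close>

definition vol0 :: "(real^7) list \<Rightarrow> real" where
  "vol0 = (1 / 6) *\<^sub>R bform phi0 (ax 1) (ax 1)"

lemma vol0_alt_forms: "vol0 \<in> alt_forms UNIV 7"
  unfolding vol0_def bform_def
  by (intro subspace_scale subspace_alt_forms bform_alt_forms phi0_alt_forms subspace_UNIV)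

lemma vol0_std_basis: "vol0 std_basis = 1"
  by (simp add: vol0_def bform_phi0_std_basis inner_axis_axis)

lemma bform_phi0: "bform phi0 X Y = (6 * (X \<bullet> Y)) *\<^sub>R vol0"
proof (rule seven_forms_eq)
  show "bform phi0 X Y \<in> alt_forms UNIV 7"
    unfolding bform_def by (intro bform_alt_forms phi0_alt_forms subspace_UNIV)
  show "(6 * (X \<bullet> Y)) *\<^sub>R vol0 \<in> alt_forms UNIV 7"
    by (intro subspace_scale subspace_alt_forms vol0_alt_forms)
qed (simp add: bform_phi0_std_basis vol0_std_basis)

section \<open>The Hodge dual of the standard form\<close>

text \<open>Both forms are left general because the expansion has two uses:
  \<open>\<eta> = psi0\<close> verifies the equation of the Hodge star, and
  \<open>\<beta> = dx3 i j k\<close> isolates a component of \<open>\<eta>\<close> for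
  uniqueness.\<close>

lemma wedge_3_4_std_basis:
  assumes "\<beta> \<in> alt_forms UNIV 3" "\<eta> \<in> alt_forms UNIV 4"
  shows "wedge \<beta> \<eta> std_basis = \<beta> [ax 1, ax 2, ax 3] * \<eta> [ax 4, ax 5, ax 6, ax 7]
    - \<beta> [ax 1, ax 2, ax 4] * \<eta> [ax 3, ax 5, ax 6, ax 7]
    + \<beta> [ax 1, ax 2, ax 5] * \<eta> [ax 3, ax 4, ax 6, ax 7]
    - \<beta> [ax 1, ax 2, ax 6] * \<eta> [ax 3, ax 4, ax 5, ax 7]
    + \<beta> [ax 1, ax 2, ax 7] * \<eta> [ax 3, ax 4, ax 5, ax 6]
    + \<beta> [ax 1, ax 3, ax 4] * \<eta> [ax 2, ax 5, ax 6, ax 7]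
    - \<beta> [ax 1, ax 3, ax 5] * \<eta> [ax 2, ax 4, ax 6, ax 7]
    + \<beta> [ax 1, ax 3, ax 6] * \<eta> [ax 2, ax 4, ax 5, ax 7]
    - \<beta> [ax 1, ax 3, ax 7] * \<eta> [ax 2, ax 4, ax 5, ax 6]
    + \<beta> [ax 1, ax 4, ax 5] * \<eta> [ax 2, ax 3, ax 6, ax 7]
    - \<beta> [ax 1, ax 4, ax 6] * \<eta> [ax 2, ax 3, ax 5, ax 7]
    + \<beta> [ax 1, ax 4, ax 7] * \<eta> [ax 2, ax 3, ax 5, ax 6]
    + \<beta> [ax 1, ax 5, ax 6] * \<eta> [ax 2, ax 3, ax 4, ax 7]
    - \<beta> [ax 1, ax 5, ax 7] * \<eta> [ax 2, ax 3, ax 4, ax 6]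
    + \<beta> [ax 1, ax 6, ax 7] * \<eta> [ax 2, ax 3, ax 4, ax 5]
    - \<beta> [ax 2, ax 3, ax 4] * \<eta> [ax 1, ax 5, ax 6, ax 7]
    + \<beta> [ax 2, ax 3, ax 5] * \<eta> [ax 1, ax 4, ax 6, ax 7]
    - \<beta> [ax 2, ax 3, ax 6] * \<eta> [ax 1, ax 4, ax 5, ax 7]
    + \<beta> [ax 2, ax 3, ax 7] * \<eta> [ax 1, ax 4, ax 5, ax 6]
    - \<beta> [ax 2, ax 4, ax 5] * \<eta> [ax 1, ax 3, ax 6, ax 7]
    + \<beta> [ax 2, ax 4, ax 6] * \<eta> [ax 1, ax 3, ax 5, ax 7]
    - \<beta> [ax 2, ax 4, ax 7] * \<eta> [ax 1, ax 3, ax 5, ax 6]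
    - \<beta> [ax 2, ax 5, ax 6] * \<eta> [ax 1, ax 3, ax 4, ax 7]
    + \<beta> [ax 2, ax 5, ax 7] * \<eta> [ax 1, ax 3, ax 4, ax 6]
    - \<beta> [ax 2, ax 6, ax 7] * \<eta> [ax 1, ax 3, ax 4, ax 5]
    + \<beta> [ax 3, ax 4, ax 5] * \<eta> [ax 1, ax 2, ax 6, ax 7]
    - \<beta> [ax 3, ax 4, ax 6] * \<eta> [ax 1, ax 2, ax 5, ax 7]
    + \<beta> [ax 3, ax 4, ax 7] * \<eta> [ax 1, ax 2, ax 5, ax 6]
    + \<beta> [ax 3, ax 5, ax 6] * \<eta> [ax 1, ax 2, ax 4, ax 7]
    - \<beta> [ax 3, ax 5, ax 7] * \<eta> [ax 1, ax 2, ax 4, ax 6]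
    + \<beta> [ax 3, ax 6, ax 7] * \<eta> [ax 1, ax 2, ax 4, ax 5]
    - \<beta> [ax 4, ax 5, ax 6] * \<eta> [ax 1, ax 2, ax 3, ax 7]
    + \<beta> [ax 4, ax 5, ax 7] * \<eta> [ax 1, ax 2, ax 3, ax 6]
    - \<beta> [ax 4, ax 6, ax 7] * \<eta> [ax 1, ax 2, ax 3, ax 5]
    + \<beta> [ax 5, ax 6, ax 7] * \<eta> [ax 1, ax 2, ax 3, ax 4]"
  by (simp add: wedge_eq_split alt_forms_off_3[OF assms(1)] alt_forms_off_4[OF assms(2)])

lemma form_inner_3_std_basis:
  assumes "\<beta> \<in> alt_forms UNIV 3"
  shows "form_inner std_basis \<beta> \<alpha> = \<beta> [ax 1, ax 2, ax 3] * \<alpha> [ax 1, ax 2, ax 3]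
    + \<beta> [ax 1, ax 2, ax 4] * \<alpha> [ax 1, ax 2, ax 4]
    + \<beta> [ax 1, ax 2, ax 5] * \<alpha> [ax 1, ax 2, ax 5]
    + \<beta> [ax 1, ax 2, ax 6] * \<alpha> [ax 1, ax 2, ax 6]
    + \<beta> [ax 1, ax 2, ax 7] * \<alpha> [ax 1, ax 2, ax 7]
    + \<beta> [ax 1, ax 3, ax 4] * \<alpha> [ax 1, ax 3, ax 4]
    + \<beta> [ax 1, ax 3, ax 5] * \<alpha> [ax 1, ax 3, ax 5]
    + \<beta> [ax 1, ax 3, ax 6] * \<alpha> [ax 1, ax 3, ax 6]
    + \<beta> [ax 1, ax 3, ax 7] * \<alpha> [ax 1, ax 3, ax 7]
    + \<beta> [ax 1, ax 4, ax 5] * \<alpha> [ax 1, ax 4, ax 5]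
    + \<beta> [ax 1, ax 4, ax 6] * \<alpha> [ax 1, ax 4, ax 6]
    + \<beta> [ax 1, ax 4, ax 7] * \<alpha> [ax 1, ax 4, ax 7]
    + \<beta> [ax 1, ax 5, ax 6] * \<alpha> [ax 1, ax 5, ax 6]
    + \<beta> [ax 1, ax 5, ax 7] * \<alpha> [ax 1, ax 5, ax 7]
    + \<beta> [ax 1, ax 6, ax 7] * \<alpha> [ax 1, ax 6, ax 7]
    + \<beta> [ax 2, ax 3, ax 4] * \<alpha> [ax 2, ax 3, ax 4]
    + \<beta> [ax 2, ax 3, ax 5] * \<alpha> [ax 2, ax 3, ax 5]
    + \<beta> [ax 2, ax 3, ax 6] * \<alpha> [ax 2, ax 3, ax 6]
    + \<beta> [ax 2, ax 3, ax 7] * \<alpha> [ax 2, ax 3, ax 7]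
    + \<beta> [ax 2, ax 4, ax 5] * \<alpha> [ax 2, ax 4, ax 5]
    + \<beta> [ax 2, ax 4, ax 6] * \<alpha> [ax 2, ax 4, ax 6]
    + \<beta> [ax 2, ax 4, ax 7] * \<alpha> [ax 2, ax 4, ax 7]
    + \<beta> [ax 2, ax 5, ax 6] * \<alpha> [ax 2, ax 5, ax 6]
    + \<beta> [ax 2, ax 5, ax 7] * \<alpha> [ax 2, ax 5, ax 7]
    + \<beta> [ax 2, ax 6, ax 7] * \<alpha> [ax 2, ax 6, ax 7]
    + \<beta> [ax 3, ax 4, ax 5] * \<alpha> [ax 3, ax 4, ax 5]
    + \<beta> [ax 3, ax 4, ax 6] * \<alpha> [ax 3, ax 4, ax 6]
    + \<beta> [ax 3, ax 4, ax 7] * \<alpha> [ax 3, ax 4, ax 7]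
    + \<beta> [ax 3, ax 5, ax 6] * \<alpha> [ax 3, ax 5, ax 6]
    + \<beta> [ax 3, ax 5, ax 7] * \<alpha> [ax 3, ax 5, ax 7]
    + \<beta> [ax 3, ax 6, ax 7] * \<alpha> [ax 3, ax 6, ax 7]
    + \<beta> [ax 4, ax 5, ax 6] * \<alpha> [ax 4, ax 5, ax 6]
    + \<beta> [ax 4, ax 5, ax 7] * \<alpha> [ax 4, ax 5, ax 7]
    + \<beta> [ax 4, ax 6, ax 7] * \<alpha> [ax 4, ax 6, ax 7]
    + \<beta> [ax 5, ax 6, ax 7] * \<alpha> [ax 5, ax 6, ax 7]"
  by (simp add: form_inner_Cons int_prod_apply alt_forms_off_3[OF assms])

lemma psi0_ax:
  "psi0 [ax 1, ax 2, c, d] = - c$4*d$7 - c$5*d$6 + c$6*d$5 + c$7*d$4"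
  "psi0 [ax 1, ax 3, c, d] = - c$4*d$6 + c$5*d$7 + c$6*d$4 - c$7*d$5"
  "psi0 [ax 1, ax 4, c, d] = c$2*d$7 + c$3*d$6 - c$6*d$3 - c$7*d$2"
  "psi0 [ax 1, ax 5, c, d] = c$2*d$6 - c$3*d$7 - c$6*d$2 + c$7*d$3"
  "psi0 [ax 1, ax 6, c, d] = - c$2*d$5 - c$3*d$4 + c$4*d$3 + c$5*d$2"
  "psi0 [ax 1, ax 7, c, d] = - c$2*d$4 + c$3*d$5 + c$4*d$2 - c$5*d$3"
  "psi0 [ax 2, ax 3, c, d] = c$4*d$5 - c$5*d$4 + c$6*d$7 - c$7*d$6"
  "psi0 [ax 2, ax 4, c, d] = - c$1*d$7 - c$3*d$5 + c$5*d$3 + c$7*d$1"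
  "psi0 [ax 2, ax 5, c, d] = - c$1*d$6 + c$3*d$4 - c$4*d$3 + c$6*d$1"
  "psi0 [ax 2, ax 6, c, d] = c$1*d$5 - c$3*d$7 - c$5*d$1 + c$7*d$3"
  "psi0 [ax 2, ax 7, c, d] = c$1*d$4 + c$3*d$6 - c$4*d$1 - c$6*d$3"
  "psi0 [ax 3, ax 4, c, d] = - c$1*d$6 + c$2*d$5 - c$5*d$2 + c$6*d$1"
  "psi0 [ax 3, ax 5, c, d] = c$1*d$7 - c$2*d$4 + c$4*d$2 - c$7*d$1"
  "psi0 [ax 3, ax 6, c, d] = c$1*d$4 + c$2*d$7 - c$4*d$1 - c$7*d$2"
  "psi0 [ax 3, ax 7, c, d] = - c$1*d$5 - c$2*d$6 + c$5*d$1 + c$6*d$2"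
  "psi0 [ax 4, ax 5, c, d] = c$2*d$3 - c$3*d$2 + c$6*d$7 - c$7*d$6"
  "psi0 [ax 4, ax 6, c, d] = - c$1*d$3 + c$3*d$1 - c$5*d$7 + c$7*d$5"
  "psi0 [ax 4, ax 7, c, d] = - c$1*d$2 + c$2*d$1 + c$5*d$6 - c$6*d$5"
  "psi0 [ax 5, ax 6, c, d] = - c$1*d$2 + c$2*d$1 + c$4*d$7 - c$7*d$4"
  "psi0 [ax 5, ax 7, c, d] = c$1*d$3 - c$3*d$1 - c$4*d$6 + c$6*d$4"
  "psi0 [ax 6, ax 7, c, d] = c$2*d$3 - c$3*d$2 + c$4*d$5 - c$5*d$4"
  by (simp_all add: psi0_apply dx4_apply dx3_apply axis_nth)

lemma wedge_psi0_std_basis: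
  assumes "\<beta> \<in> alt_forms UNIV 3"
  shows "wedge \<beta> psi0 std_basis = form_inner std_basis \<beta> phi0"
  unfolding wedge_3_4_std_basis[OF assms psi0_alt_forms] form_inner_3_std_basis[OF assms]
  by (simp add: psi0_ax phi0_ax axis_nth)

lemma wedge_psi0:
  assumes "\<beta> \<in> alt_forms UNIV 3"
  shows "wedge \<beta> psi0 = form_inner std_basis \<beta> phi0 *\<^sub>R vol0"
proof (rule seven_forms_eq)
  have "wedge \<beta> psi0 \<in> alt_forms UNIV (3 + 4)"
    by (intro wedge_alt_forms assms psi0_alt_forms subspace_UNIV)
  then show "wedge \<beta> psi0 \<in> alt_forms UNIV 7" by simp
  show "form_inner std_basis \<beta> phi0 *\<^sub>R vol0 \<in> alt_forms UNIV 7"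
    by (intro subspace_scale subspace_alt_forms vol0_alt_forms)
qed (simp add: wedge_psi0_std_basis[OF assms] vol0_std_basis)

lemma sorted_lists_4:
  assumes "length ks = 4" "set ks \<subseteq> {..<7::nat}" "sorted_wrt (<) ks"
  shows "ks \<in> {[0, 1, 2, 3],
    [0, 1, 2, 4],
    [0, 1, 2, 5],
    [0, 1, 2, 6],
    [0, 1, 3, 4],
    [0, 1, 3, 5],
    [0, 1, 3, 6],
    [0, 1, 4, 5],
    [0, 1, 4, 6],
    [0, 1, 5, 6],
    [0, 2, 3, 4],
    [0, 2, 3, 5],
    [0, 2, 3, 6],
    [0, 2, 4, 5],
    [0, 2, 4, 6],
    [0, 2, 5, 6],
    [0, 3, 4, 5],
    [0, 3, 4, 6],
    [0, 3, 5, 6],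
    [0, 4, 5, 6],
    [1, 2, 3, 4],
    [1, 2, 3, 5],
    [1, 2, 3, 6],
    [1, 2, 4, 5],
    [1, 2, 4, 6],
    [1, 2, 5, 6],
    [1, 3, 4, 5],
    [1, 3, 4, 6],
    [1, 3, 5, 6],
    [1, 4, 5, 6],
    [2, 3, 4, 5],
    [2, 3, 4, 6],
    [2, 3, 5, 6],
    [2, 4, 5, 6],
    [3, 4, 5, 6]}"
proof -
  obtain a b c d where xs: "ks = [a, b, c, d]"
    using assms(1) by (auto simp: length_Suc_conv numeral_eq_Suc)
  then have *: "a < b" "b < c" "c < d" "d < 7" using assms by auto
  then have "d = 3 \<or> d = 4 \<or> d = 5 \<or> d = 6" by arith
  moreover have "c = 2 \<or> c = 3 \<or> c = 4 \<or> c = 5" using * by arith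
  moreover have "b = 1 \<or> b = 2 \<or> b = 3 \<or> b = 4" using * by arith
  moreover have "a = 0 \<or> a = 1 \<or> a = 2 \<or> a = 3" using * by arith
  ultimately show ?thesis using * unfolding xs
    by (elim disjE) (simp_all)
qed

text \<open>Pairing with \<open>dx3 i j k\<close> picks out, up to sign, the component of
  \<open>\<eta>\<close> at the four complementary indices, so the 35 coordinate 3-forms detect all
  components. This is the uniqueness half of the Hodge star.\<close>

lemma four_form_eq_0:
  assumes \<eta>: "\<eta> \<in> alt_forms UNIV 4" and z: "\<And>\<beta>. \<beta> \<in> alt_forms UNIV 3 \<Longrightarrow> wedge \<beta> \<eta> std_basis = 0"
  shows "\<eta> = 0"
proof (rule alt_forms_eq_0I[OF subspace_UNIV span_std_basis finite_lessThan \<eta>])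
  have *: "wedge (dx3 i j k) \<eta> std_basis = 0" for i j k by (rule z[OF dx3_alt_forms])
  note eval = *[unfolded wedge_3_4_std_basis[OF dx3_alt_forms \<eta>]]
  have \<eta>4567: "\<eta> [ax 4, ax 5, ax 6, ax 7] = 0"
    using eval[of 1 2 3] by (simp add: dx3_apply axis_nth)
  have \<eta>3567: "\<eta> [ax 3, ax 5, ax 6, ax 7] = 0"
    using eval[of 1 2 4] by (simp add: dx3_apply axis_nth)
  have \<eta>3467: "\<eta> [ax 3, ax 4, ax 6, ax 7] = 0"
    using eval[of 1 2 5] by (simp add: dx3_apply axis_nth)
  have \<eta>3457: "\<eta> [ax 3, ax 4, ax 5, ax 7] = 0"
    using eval[of 1 2 6] by (simp add: dx3_apply axis_nth)
  have \<eta>3456: "\<eta> [ax 3, ax 4, ax 5, ax 6] = 0"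
    using eval[of 1 2 7] by (simp add: dx3_apply axis_nth)
  have \<eta>2567: "\<eta> [ax 2, ax 5, ax 6, ax 7] = 0"
    using eval[of 1 3 4] by (simp add: dx3_apply axis_nth)
  have \<eta>2467: "\<eta> [ax 2, ax 4, ax 6, ax 7] = 0"
    using eval[of 1 3 5] by (simp add: dx3_apply axis_nth)
  have \<eta>2457: "\<eta> [ax 2, ax 4, ax 5, ax 7] = 0"
    using eval[of 1 3 6] by (simp add: dx3_apply axis_nth)
  have \<eta>2456: "\<eta> [ax 2, ax 4, ax 5, ax 6] = 0"
    using eval[of 1 3 7] by (simp add: dx3_apply axis_nth)
  have \<eta>2367: "\<eta> [ax 2, ax 3, ax 6, ax 7] = 0"
    using eval[of 1 4 5] by (simp add: dx3_apply axis_nth)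
  have \<eta>2357: "\<eta> [ax 2, ax 3, ax 5, ax 7] = 0"
    using eval[of 1 4 6] by (simp add: dx3_apply axis_nth)
  have \<eta>2356: "\<eta> [ax 2, ax 3, ax 5, ax 6] = 0"
    using eval[of 1 4 7] by (simp add: dx3_apply axis_nth)
  have \<eta>2347: "\<eta> [ax 2, ax 3, ax 4, ax 7] = 0"
    using eval[of 1 5 6] by (simp add: dx3_apply axis_nth)
  have \<eta>2346: "\<eta> [ax 2, ax 3, ax 4, ax 6] = 0"
    using eval[of 1 5 7] by (simp add: dx3_apply axis_nth)
  have \<eta>2345: "\<eta> [ax 2, ax 3, ax 4, ax 5] = 0"
    using eval[of 1 6 7] by (simp add: dx3_apply axis_nth)
  have \<eta>1567: "\<eta> [ax 1, ax 5, ax 6, ax 7] = 0"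
    using eval[of 2 3 4] by (simp add: dx3_apply axis_nth)
  have \<eta>1467: "\<eta> [ax 1, ax 4, ax 6, ax 7] = 0"
    using eval[of 2 3 5] by (simp add: dx3_apply axis_nth)
  have \<eta>1457: "\<eta> [ax 1, ax 4, ax 5, ax 7] = 0"
    using eval[of 2 3 6] by (simp add: dx3_apply axis_nth)
  have \<eta>1456: "\<eta> [ax 1, ax 4, ax 5, ax 6] = 0"
    using eval[of 2 3 7] by (simp add: dx3_apply axis_nth)
  have \<eta>1367: "\<eta> [ax 1, ax 3, ax 6, ax 7] = 0"
    using eval[of 2 4 5] by (simp add: dx3_apply axis_nth)
  have \<eta>1357: "\<eta> [ax 1, ax 3, ax 5, ax 7] = 0"
    using eval[of 2 4 6] by (simp add: dx3_apply axis_nth)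
  have \<eta>1356: "\<eta> [ax 1, ax 3, ax 5, ax 6] = 0"
    using eval[of 2 4 7] by (simp add: dx3_apply axis_nth)
  have \<eta>1347: "\<eta> [ax 1, ax 3, ax 4, ax 7] = 0"
    using eval[of 2 5 6] by (simp add: dx3_apply axis_nth)
  have \<eta>1346: "\<eta> [ax 1, ax 3, ax 4, ax 6] = 0"
    using eval[of 2 5 7] by (simp add: dx3_apply axis_nth)
  have \<eta>1345: "\<eta> [ax 1, ax 3, ax 4, ax 5] = 0"
    using eval[of 2 6 7] by (simp add: dx3_apply axis_nth)
  have \<eta>1267: "\<eta> [ax 1, ax 2, ax 6, ax 7] = 0"
    using eval[of 3 4 5] by (simp add: dx3_apply axis_nth)
  have \<eta>1257: "\<eta> [ax 1, ax 2, ax 5, ax 7] = 0"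
    using eval[of 3 4 6] by (simp add: dx3_apply axis_nth)
  have \<eta>1256: "\<eta> [ax 1, ax 2, ax 5, ax 6] = 0"
    using eval[of 3 4 7] by (simp add: dx3_apply axis_nth)
  have \<eta>1247: "\<eta> [ax 1, ax 2, ax 4, ax 7] = 0"
    using eval[of 3 5 6] by (simp add: dx3_apply axis_nth)
  have \<eta>1246: "\<eta> [ax 1, ax 2, ax 4, ax 6] = 0"
    using eval[of 3 5 7] by (simp add: dx3_apply axis_nth)
  have \<eta>1245: "\<eta> [ax 1, ax 2, ax 4, ax 5] = 0"
    using eval[of 3 6 7] by (simp add: dx3_apply axis_nth)
  have \<eta>1237: "\<eta> [ax 1, ax 2, ax 3, ax 7] = 0"
    using eval[of 4 5 6] by (simp add: dx3_apply axis_nth)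
  have \<eta>1236: "\<eta> [ax 1, ax 2, ax 3, ax 6] = 0"
    using eval[of 4 5 7] by (simp add: dx3_apply axis_nth)
  have \<eta>1235: "\<eta> [ax 1, ax 2, ax 3, ax 5] = 0"
    using eval[of 4 6 7] by (simp add: dx3_apply axis_nth)
  have \<eta>1234: "\<eta> [ax 1, ax 2, ax 3, ax 4] = 0"
    using eval[of 5 6 7] by (simp add: dx3_apply axis_nth)
  fix ks :: "nat list" assume "length ks = 4" "set ks \<subseteq> {..<7}" "sorted_wrt (<) ks"
  from sorted_lists_4[OF this] show "\<eta> (map ((!) std_basis) ks) = 0"
    unfolding insert_iff empty_iff
    by (elim disjE) (simp_all add: \<eta>1234 \<eta>1235 \<eta>1236 \<eta>1237 \<eta>1245 \<eta>1246 \<eta>1247 \<eta>1256 \<eta>1257 \<eta>1267 \<eta>1345 \<eta>1346 \<eta>1347 \<eta>1356 \<eta>1357 \<eta>1367 \<eta>1456 \<eta>1457 \<eta>1467 \<eta>1567 \<eta>2345 \<eta>2346 \<eta>2347 \<eta>2356 \<eta>2357 \<eta>2367 \<eta>2456 \<eta>2457 \<eta>2467 \<eta>2567 \<eta>3456 \<eta>3457 \<eta>3467 \<eta>3567 \<eta>4567)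
qed

section \<open>Contraction of bivectors with the standard 4-form\<close>

text \<open>The division by 2 makes up for counting each pair of indices in both orders,
  \<open>q\<close> being the antisymmetric component matrix of a bivector. In an orthonormal frame
  bivectors and 2-forms have components of the same kind, so the operator can be iterated.\<close>

definition contract_psi0 :: "(7 \<Rightarrow> 7 \<Rightarrow> real) \<Rightarrow> real^7 \<Rightarrow> real^7 \<Rightarrow> real" where
  "contract_psi0 q c d = (\<Sum>i\<in>UNIV. \<Sum>j\<in>UNIV. q i j * psi0 [ax i, ax j, c, d]) / 2"

lemma contract_psi0_eq:
  assumes "\<And>i j. q j i = - q i j"
  shows "contract_psi0 q c d = q 1 2 * psi0 [ax 1, ax 2, c, d]
    + q 1 3 * psi0 [ax 1, ax 3, c, d]
    + q 1 4 * psi0 [ax 1, ax 4, c, d]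
    + q 1 5 * psi0 [ax 1, ax 5, c, d]
    + q 1 6 * psi0 [ax 1, ax 6, c, d]
    + q 1 7 * psi0 [ax 1, ax 7, c, d]
    + q 2 3 * psi0 [ax 2, ax 3, c, d]
    + q 2 4 * psi0 [ax 2, ax 4, c, d]
    + q 2 5 * psi0 [ax 2, ax 5, c, d]
    + q 2 6 * psi0 [ax 2, ax 6, c, d]
    + q 2 7 * psi0 [ax 2, ax 7, c, d]
    + q 3 4 * psi0 [ax 3, ax 4, c, d]
    + q 3 5 * psi0 [ax 3, ax 5, c, d]
    + q 3 6 * psi0 [ax 3, ax 6, c, d]
    + q 3 7 * psi0 [ax 3, ax 7, c, d]
    + q 4 5 * psi0 [ax 4, ax 5, c, d]
    + q 4 6 * psi0 [ax 4, ax 6, c, d]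
    + q 4 7 * psi0 [ax 4, ax 7, c, d]
    + q 5 6 * psi0 [ax 5, ax 6, c, d]
    + q 5 7 * psi0 [ax 5, ax 7, c, d]
    + q 6 7 * psi0 [ax 6, ax 7, c, d]"
proof -
  have q: "q i j * psi0 [ax i, ax j, c, d] = q j i * psi0 [ax j, ax i, c, d]" for i j
    using assms[of j i] alt_forms_swap[OF psi0_alt_forms subspace_UNIV, of "ax i" "ax j" "[c, d]"] by simp
  have z: "psi0 [ax i, ax i, c, d] = 0" for i by (rule alt_forms_twice[OF psi0_alt_forms])
  show ?thesis
    unfolding contract_psi0_def sum_7 z
    \<comment> \<open>Only instances with the larger index first are listed, so each such term is
      turned into its mirror image and rewriting stops.\<close>
    unfolding q[of 2 1] q[of 3 1] q[of 4 1] q[of 5 1] q[of 6 1] q[of 7 1] q[of 3 2] q[of 4 2] q[of 5 2] q[of 6 2] q[of 7 2] q[of 4 3] q[of 5 3] q[of 6 3] q[of 7 3] q[of 5 4] q[of 6 4] q[of 7 4] q[of 6 5] q[of 7 5] q[of 7 6]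
    by simp
qed

lemma contract_psi0_antisym: "contract_psi0 q d c = - contract_psi0 q c d"
proof -
  have "psi0 [a, b, d, c] = - psi0 [a, b, c, d]" for a b
  proof -
    have "int_prod b (int_prod a psi0) \<in> alt_forms UNIV 2"
      using psi0_alt_forms by (intro int_prod_alt_forms) simp
    from alt_forms_swap[OF this, of d c "[]"] show ?thesis by (simp add: int_prod_apply)
  qed
  then show ?thesis by (simp add: contract_psi0_def sum_negf)
qed

text \<open>The operator \<open>T = contract_psi0\<close> has the eigenvalues \<open>2\<close> and \<open>-1\<close>
  on \<open>\<Lambda>\<^sup>2 = \<Lambda>\<^sup>2\<^sub>7 \<oplus> \<Lambda>\<^sup>2\<^sub>1\<^sub>4\<close>, so that \<open>T\<^sup>2 = T + 2\<close>.\<close>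

lemma contract_psi0_twice:
  assumes q: "\<And>i j. q j i = - q i j"
  shows "contract_psi0 (\<lambda>i j. contract_psi0 q (ax i) (ax j)) (ax k) (ax l) =
    contract_psi0 q (ax k) (ax l) + 2 * q k l"
proof -
  let ?T = "\<lambda>i j. contract_psi0 q (ax i) (ax j)"
  have T:
    "?T 1 2 = - q 4 7 - q 5 6"
    "?T 1 3 = - q 4 6 + q 5 7"
    "?T 1 4 = q 2 7 + q 3 6"
    "?T 1 5 = q 2 6 - q 3 7"
    "?T 1 6 = - q 2 5 - q 3 4"
    "?T 1 7 = - q 2 4 + q 3 5"
    "?T 2 3 = q 4 5 + q 6 7"
    "?T 2 4 = - q 1 7 - q 3 5"
    "?T 2 5 = - q 1 6 + q 3 4"
    "?T 2 6 = q 1 5 - q 3 7"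
    "?T 2 7 = q 1 4 + q 3 6"
    "?T 3 4 = - q 1 6 + q 2 5"
    "?T 3 5 = q 1 7 - q 2 4"
    "?T 3 6 = q 1 4 + q 2 7"
    "?T 3 7 = - q 1 5 - q 2 6"
    "?T 4 5 = q 2 3 + q 6 7"
    "?T 4 6 = - q 1 3 - q 5 7"
    "?T 4 7 = - q 1 2 + q 5 6"
    "?T 5 6 = - q 1 2 + q 4 7"
    "?T 5 7 = q 1 3 - q 4 6"
    "?T 6 7 = q 2 3 + q 4 5"
    by (simp_all add: contract_psi0_eq[OF q] psi0_ax axis_nth)
  have TT: "\<And>k l. contract_psi0 ?T (ax k) (ax l) = ?T 1 2 * psi0 [ax 1, ax 2, ax k, ax l]
    + ?T 1 3 * psi0 [ax 1, ax 3, ax k, ax l]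
    + ?T 1 4 * psi0 [ax 1, ax 4, ax k, ax l]
    + ?T 1 5 * psi0 [ax 1, ax 5, ax k, ax l]
    + ?T 1 6 * psi0 [ax 1, ax 6, ax k, ax l]
    + ?T 1 7 * psi0 [ax 1, ax 7, ax k, ax l]
    + ?T 2 3 * psi0 [ax 2, ax 3, ax k, ax l]
    + ?T 2 4 * psi0 [ax 2, ax 4, ax k, ax l]
    + ?T 2 5 * psi0 [ax 2, ax 5, ax k, ax l]
    + ?T 2 6 * psi0 [ax 2, ax 6, ax k, ax l]
    + ?T 2 7 * psi0 [ax 2, ax 7, ax k, ax l]
    + ?T 3 4 * psi0 [ax 3, ax 4, ax k, ax l]
    + ?T 3 5 * psi0 [ax 3, ax 5, ax k, ax l]
    + ?T 3 6 * psi0 [ax 3, ax 6, ax k, ax l]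
    + ?T 3 7 * psi0 [ax 3, ax 7, ax k, ax l]
    + ?T 4 5 * psi0 [ax 4, ax 5, ax k, ax l]
    + ?T 4 6 * psi0 [ax 4, ax 6, ax k, ax l]
    + ?T 4 7 * psi0 [ax 4, ax 7, ax k, ax l]
    + ?T 5 6 * psi0 [ax 5, ax 6, ax k, ax l]
    + ?T 5 7 * psi0 [ax 5, ax 7, ax k, ax l]
    + ?T 6 7 * psi0 [ax 6, ax 7, ax k, ax l]"
    by (rule contract_psi0_eq) (rule contract_psi0_antisym)
  \<comment> \<open>The defect of the claimed identity is antisymmetric in \<open>k\<close> and
    \<open>l\<close>, which leaves 21 pairs to be computed from the table \<open>T\<close>.\<close>
  define D where "D k l = contract_psi0 ?T (ax k) (ax l) - ?T k l - 2 * q k l" for k l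
  have anti: "D l k = - D k l" for k l
    unfolding D_def by (simp add: contract_psi0_antisym[of _ "ax l" "ax k"] q[of k l])
  have "D k k = 0" for k using anti[of k k] by simp
  moreover have z: "D 1 2 = 0" "D 1 3 = 0" "D 1 4 = 0" "D 1 5 = 0" "D 1 6 = 0" "D 1 7 = 0" "D 2 3 = 0" "D 2 4 = 0" "D 2 5 = 0" "D 2 6 = 0" "D 2 7 = 0" "D 3 4 = 0" "D 3 5 = 0" "D 3 6 = 0" "D 3 7 = 0" "D 4 5 = 0" "D 4 6 = 0" "D 4 7 = 0" "D 5 6 = 0" "D 5 7 = 0" "D 6 7 = 0"
    by (simp_all add: D_def TT T psi0_ax axis_nth)
  moreover have "D k l = 0" if "D l k = 0" for k l using anti[of l k] that by simp
  ultimately have "\<forall>k l. D k l = 0" unfolding forall_7 by blast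
  then have "D k l = 0" by blast
  then show ?thesis by (simp add: D_def)
qed

text \<open>The degrees in \<open>volume_form\<close> and \<open>hodge_star\<close> are given by
  \<open>dim V\<close>. Independence holds because pairing a linear relation with a basis vector
  isolates its coefficient.\<close>

lemma dim_orthonormal_basis:
  assumes g: "inner_product_on V g" and V: "subspace V" and es: "orthonormal_basis V g es"
  shows "dim V = length es"
proof -
  have esV: "set es \<subseteq> V" and span: "span (set es) = V"
    using es by (auto simp: orthonormal_basis_def)
  have "independent (set es)"
  proof
    assume "dependent (set es)"
    then obtain u v where v: "v \<in> set es" "u v \<noteq> 0" and z: "(\<Sum>v\<in>set es. u v *\<^sub>R v) = 0"
      by (auto simp: dependent_finite)
    have "g (\<Sum>w\<in>set es. u w *\<^sub>R w) v = (\<Sum>w\<in>set es. u w * g w v)"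
      by (rule inner_product_on_sum[OF g V]) (use v esV in auto)
    also have "\<dots> = (\<Sum>w\<in>set es. if w = v then u v else 0)"
      using es v unfolding orthonormal_basis_def
      by (intro sum.cong refl) (auto simp: in_set_conv_nth split: if_splits)
    also have "\<dots> = u v" using v by simp
    finally have "g 0 v = u v" using z by simp
    moreover have "g 0 v = 0"
      using inner_product_on_sum[OF g V, of v "{}" "\<lambda>x. x" "\<lambda>x. 0"] v esV by auto
    ultimately show False using v by simp
  qed
  then have "dim V = card (set es)"
    using span by (intro dim_eq_card) (simp_all add: span_eq_iff[THEN iffD2, OF V])
  then show ?thesis using distinct_card[OF distinct_orthonormal_basis[OF es]] by simp
qed

section \<open>Linear frames\<close>

text \<open>With the inverse \<open>h\<close> as a parameter, adapted frames, the coordinate frames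
  of charts and the induced frame of the dual space all become instances of this locale.\<close>

locale linear_frame =
  fixes V :: "'v::real_vector set" and f :: "'v \<Rightarrow> real^'n::finite" and h :: "real^'n \<Rightarrow> 'v"
  assumes V: "subspace V"
    and f_add: "u \<in> V \<Longrightarrow> v \<in> V \<Longrightarrow> f (u + v) = f u + f v"
    and f_scale: "v \<in> V \<Longrightarrow> f (r *\<^sub>R v) = r *\<^sub>R f v"
    and h_in [simp]: "h x \<in> V"
    and fh [simp]: "f (h x) = x"
    and hf: "v \<in> V \<Longrightarrow> h (f v) = v"
begin

lemma h_add: "h (x + y) = h x + h y"
proof -
  have "h (x + y) = h (f (h x + h y))" by (simp add: f_add)
  also have "\<dots> = h x + h y" by (intro hf subspace_add[OF V]) auto
  finally show ?thesis .
qed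

lemma h_scale: "h (r *\<^sub>R x) = r *\<^sub>R h x"
proof -
  have "h (r *\<^sub>R x) = h (f (r *\<^sub>R h x))" by (simp add: f_scale)
  also have "\<dots> = r *\<^sub>R h x" by (intro hf subspace_scale[OF V]) auto
  finally show ?thesis .
qed

lemma linear_h: "linear h"
  by (rule linearI) (auto simp: h_add h_scale)

lemma f_combination: "u \<in> V \<Longrightarrow> v \<in> V \<Longrightarrow> f (a *\<^sub>R u + b *\<^sub>R v) = a *\<^sub>R f u + b *\<^sub>R f v"
  by (simp add: f_add f_scale subspace_scale[OF V])

lemma set_map_h: "set (map h us) \<subseteq> V"
  by auto

lemma map_hf: "set vs \<subseteq> V \<Longrightarrow> map h (map f vs) = vs"
  by (auto simp: hf intro!: map_idI)

lemma map_fh: "map f (map h us) = us"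
  by (auto intro!: map_idI)

definition pull :: "('v list \<Rightarrow> real) \<Rightarrow> (real^'n) list \<Rightarrow> real" where
  "pull \<alpha> us = \<alpha> (map h us)"

definition push :: "((real^'n) list \<Rightarrow> real) \<Rightarrow> 'v list \<Rightarrow> real" where
  "push \<alpha> vs = (if set vs \<subseteq> V then \<alpha> (map f vs) else 0)"

lemma pull_alt_forms:
  assumes "\<alpha> \<in> alt_forms V k"
  shows "pull \<alpha> \<in> alt_forms UNIV k"
proof (rule alt_formsI)
  show "pull \<alpha> vs = 0" if "\<not> (length vs = k \<and> set vs \<subseteq> UNIV)" for vs
    using that by (auto simp: pull_def intro!: alt_forms_off[OF assms])
next
  fix vs :: "(real^'n) list" and i u v and a b :: real assume "length vs = k" "i < k"
  then show "pull \<alpha> (vs[i := a *\<^sub>R u + b *\<^sub>R v]) = a * pull \<alpha> (vs[i := u]) + b * pull \<alpha> (vs[i := v])"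
    unfolding pull_def map_update h_add h_scale
    by (intro alt_forms_update[OF assms]) auto
next
  fix vs :: "(real^'n) list" and i j assume "length vs = k" "i < j" "j < k" "vs ! i = vs ! j"
  then show "pull \<alpha> vs = 0"
    unfolding pull_def by (intro alt_forms_eq[OF assms, of _ i j]) auto
qed

lemma push_alt_forms:
  assumes "\<alpha> \<in> alt_forms UNIV k"
  shows "push \<alpha> \<in> alt_forms V k"
proof (rule alt_formsI)
  show "push \<alpha> vs = 0" if "\<not> (length vs = k \<and> set vs \<subseteq> V)" for vs
    using that by (auto simp: push_def intro!: alt_forms_off[OF assms])
next
  fix vs i u v and a b :: real
  assume *: "length vs = k" "set vs \<subseteq> V" "i < k" "u \<in> V" "v \<in> V"
  have "set (vs[i := w]) \<subseteq> V" if "w \<in> V" for w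
    using * that set_update_subset_insert[of vs i w] by blast
  moreover have "a *\<^sub>R u + b *\<^sub>R v \<in> V"
    using * by (intro subspace_add[OF V] subspace_scale[OF V])
  ultimately show "push \<alpha> (vs[i := a *\<^sub>R u + b *\<^sub>R v]) = a * push \<alpha> (vs[i := u]) + b * push \<alpha> (vs[i := v])"
    using * by (simp add: push_def map_update f_combination alt_forms_update[OF assms])
next
  fix vs i j assume "length vs = k" "set vs \<subseteq> V" "i < j" "j < k" "vs ! i = vs ! j"
  then show "push \<alpha> vs = 0"
    using alt_forms_eq[OF assms, of "map f vs" i j] by (simp add: push_def)
qed

lemma pull_push [simp]: "pull (push \<alpha>) = \<alpha>"
proof (rule ext)
  show "pull (push \<alpha>) us = \<alpha> us" for us
    unfolding pull_def push_def map_fh using set_map_h by simp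
qed

lemma push_pull: "\<alpha> \<in> alt_forms V k \<Longrightarrow> push (pull \<alpha>) = \<alpha>"
  by (rule ext) (auto simp: pull_def push_def map_hf alt_forms_off simp del: map_map)

lemma pull_wedge: "pull (wedge \<alpha> \<beta>) = wedge (pull \<alpha>) (pull \<beta>)"
  by (rule ext) (simp add: wedge_def pull_def nths_map)

lemma pull_int_prod: "X \<in> V \<Longrightarrow> pull (int_prod X \<alpha>) = int_prod (f X) (pull \<alpha>)"
  by (rule ext) (simp add: int_prod_def pull_def hf)

lemma form_inner_pull: "form_inner (map h us) \<alpha> \<beta> = form_inner us (pull \<alpha>) (pull \<beta>)"
  by (simp add: form_inner_def pull_def nths_map)

lemma pull_scaleR: "pull (c *\<^sub>R \<alpha>) = c *\<^sub>R pull \<alpha>"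
  by (auto simp: pull_def)

lemma pull_eq_iff: "\<alpha> \<in> alt_forms V k \<Longrightarrow> \<beta> \<in> alt_forms V k \<Longrightarrow> pull \<alpha> = pull \<beta> \<longleftrightarrow> \<alpha> = \<beta>"
  by (metis push_pull)

lemma wedge_eqI:
  assumes "\<alpha> \<in> alt_forms V k" "\<beta> \<in> alt_forms V l" "\<gamma> \<in> alt_forms V (k + l)"
    and "wedge (pull \<alpha>) (pull \<beta>) = pull \<gamma>"
  shows "wedge \<alpha> \<beta> = \<gamma>"
  using assms pull_eq_iff[OF wedge_alt_forms[OF V assms(1,2)] assms(3)] by (simp add: pull_wedge)

text \<open>The value 0 off \<open>V\<close> is what \<open>inner_product_on\<close> demands; it
  makes the metric unique as a function, as the definite description in \<open>G2_metric_vol\<close>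
  requires.\<close>

definition metric :: "'v \<Rightarrow> 'v \<Rightarrow> real" where
  "metric u v = (if u \<in> V \<and> v \<in> V then f u \<bullet> f v else 0)"

lemma inner_product_on_metric: "inner_product_on V metric"
  unfolding inner_product_on_def
proof (intro conjI allI ballI impI)
  show "metric u v = metric v u" for u v by (simp add: metric_def inner_commute)
  show "metric (a *\<^sub>R u + b *\<^sub>R v) w = a * metric u w + b * metric v w"
    if "u \<in> V" "v \<in> V" "w \<in> V" for u v w a b
    using that by (simp add: metric_def f_combination inner_add_left subspace_add[OF V] subspace_scale[OF V])
  show "0 < metric u u" if "u \<in> V" "u \<noteq> 0" for u
  proof -
    have "h 0 = 0" using h_scale[of 0 0] by simp
    then have "f u \<noteq> 0" using that hf by force
    then show ?thesis using that by (simp add: metric_def)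
  qed
qed (auto simp: metric_def)

end

lemma linear_frameI:
  fixes f :: "'v::real_vector \<Rightarrow> real^'n::finite"
  assumes "linear_iso V UNIV f"
  shows "linear_frame V f (inv_into V f)"
proof
  have bij: "bij_betw f V UNIV" using assms by (simp add: linear_iso_def)
  show "inv_into V f x \<in> V" "f (inv_into V f x) = x" for x
    using bij by (auto simp: bij_betw_def intro!: inv_into_into f_inv_into_f)
  show "inv_into V f (f v) = v" if "v \<in> V" for v
    using bij that by (simp add: bij_betw_def)
qed (use assms in \<open>auto simp: linear_iso_def\<close>)

section \<open>The metric, volume form and dual 4-form of a \<open>G\<^sub>2\<close>-form\<close>

text \<open>The 3-form is not a separate parameter: in an adapted frame it is
  \<open>push phi0\<close>, so the frame alone determines all the data.\<close>

locale G2_frame = linear_frame V f h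
  for V :: "'v::real_vector set" and f :: "'v \<Rightarrow> real^7" and h
begin

abbreviation "phiV \<equiv> push phi0"
abbreviation "volV \<equiv> push vol0"
abbreviation "psiV \<equiv> push psi0"
abbreviation "frame_basis \<equiv> map h std_basis"

lemmas phi_alt_forms = push_alt_forms[OF phi0_alt_forms]
  and vol_alt_forms = push_alt_forms[OF vol0_alt_forms]
  and psi_alt_forms = push_alt_forms[OF psi0_alt_forms]

lemma vol_frame_basis: "volV frame_basis = 1"
  by (simp add: push_def vol0_std_basis)

lemma orthonormal_frame_basis: "orthonormal_basis V metric frame_basis"
  unfolding orthonormal_basis_def
proof (intro conjI)
  show "set frame_basis \<subseteq> V" by (rule set_map_h)
  then have "span (set frame_basis) \<subseteq> V" using V by (rule span_minimal)
  moreover have "v \<in> span (set frame_basis)" if "v \<in> V" for v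
  proof -
    have "f v \<in> span ((!) std_basis ` {..<7})" using span_std_basis by blast
    moreover have "(!) std_basis ` {..<7} = set std_basis"
      using arg_cong[OF map_std_basis, of set] by (simp add: atLeast0LessThan)
    ultimately have "f v \<in> span (set std_basis)" by simp
    then have "h (f v) \<in> span (h ` set std_basis)"
      unfolding linear_span_image[OF linear_h] by blast
    then show ?thesis using hf[OF that] by simp
  qed
  ultimately show "span (set frame_basis) = V" by blast
  have "metric (frame_basis ! i) (frame_basis ! j) = (if i = j then 1 else 0)" if "i < 7" "j < 7" for i j
  proof -
    have *: "i = 0 \<or> i = 1 \<or> i = 2 \<or> i = 3 \<or> i = 4 \<or> i = 5 \<or> i = 6"
      "j = 0 \<or> j = 1 \<or> j = 2 \<or> j = 3 \<or> j = 4 \<or> j = 5 \<or> j = 6" using that by arith+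
    show ?thesis using * by (elim disjE) (simp_all add: metric_def inner_axis_axis)
  qed
  then show "\<forall>i<length frame_basis. \<forall>j<length frame_basis.
      metric (frame_basis ! i) (frame_basis ! j) = (if i = j then 1 else 0)" by simp
qed

lemma dim_V: "dim V = 7"
  using dim_orthonormal_basis[OF inner_product_on_metric V orthonormal_frame_basis] by simp

lemma seven_forms_eq_V:
  assumes "\<alpha> \<in> alt_forms V 7" "\<beta> \<in> alt_forms V 7" "\<alpha> frame_basis = \<beta> frame_basis"
  shows "\<alpha> = \<beta>"
  using seven_forms_eq[OF pull_alt_forms[OF assms(1)] pull_alt_forms[OF assms(2)]] assms
    pull_eq_iff[OF assms(1,2)] by (simp add: pull_def)

text \<open>An orthonormal basis has seven vectors, so the squared norm of \<open>volV\<close> as a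
  7-form is the square of its value on that basis. The norm does not depend on the basis, and in the
  frame it is 1.\<close>

lemma volume_form_vol: "volume_form V metric volV"
  unfolding volume_form_def dim_V
proof (intro conjI vol_alt_forms allI impI)
  fix es assume es: "orthonormal_basis V metric es"
  have "length es = 7"
    using length_orthonormal_basis[OF inner_product_on_metric V es orthonormal_frame_basis] by simp
  then have "form_inner es volV volV = volV es * volV es"
    by (intro form_inner_top[of _ V]) (simp only: vol_alt_forms)
  moreover have "form_inner frame_basis volV volV = volV frame_basis * volV frame_basis"
    using vol_alt_forms by (intro form_inner_top[of _ V]) (simp add: numeral_eq_Suc)
  moreover have "form_inner es volV volV = form_inner frame_basis volV volV"
    by (rule form_inner_basis_independent[OF inner_product_on_metric V es orthonormal_frame_basis
          vol_alt_forms vol_alt_forms])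
  ultimately have "volV es * volV es = 1" using vol_frame_basis by simp
  then have "(volV es)\<^sup>2 = 1" by (simp add: power2_eq_square)
  then show "\<bar>volV es\<bar> = 1" by (auto simp: power2_eq_1_iff) 
qed

lemma bform_phi:
  assumes "X \<in> V" "Y \<in> V"
  shows "wedge (wedge (int_prod X phiV) (int_prod Y phiV)) phiV = (6 * metric X Y) *\<^sub>R volV"
proof -
  have "pull (wedge (wedge (int_prod X phiV) (int_prod Y phiV)) phiV) = bform phi0 (f X) (f Y)"
    by (simp add: bform_def pull_wedge pull_int_prod assms)
  also have "\<dots> = pull ((6 * metric X Y) *\<^sub>R volV)"
    by (simp add: bform_phi0 pull_scaleR metric_def assms)
  finally show ?thesis
    using pull_eq_iff[of _ 7] bform_alt_forms[OF V phi_alt_forms]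
      subspace_scale[OF subspace_alt_forms vol_alt_forms] by blast
qed

text \<open>For a second solution (g, v), comparing values on the frame gives
  \<open>metric = s g\<close> with \<open>s = v frame_basis\<close>. Positivity of both metrics
  forces \<open>s > 0\<close>, and the normalization of \<open>v\<close> on g-orthonormal bases
  forces \<open>s = 1\<close>.\<close>

lemma G2_metric_vol_eq: "G2_metric_vol V phiV = (metric, volV)"
  unfolding G2_metric_vol_def
proof (rule the_equality)
  show "case (metric, volV) of (g, v) \<Rightarrow> inner_product_on V g \<and> volume_form V g v \<and>
     (\<forall>X\<in>V. \<forall>Y\<in>V. wedge (wedge (int_prod X phiV) (int_prod Y phiV)) phiV = (6 * g X Y) *\<^sub>R v)"
    using inner_product_on_metric volume_form_vol bform_phi by auto
next
  fix gv :: "('v \<Rightarrow> 'v \<Rightarrow> real) \<times> ('v list \<Rightarrow> real)"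
  obtain g v where gv: "gv = (g, v)" by force
  assume "case gv of (g, v) \<Rightarrow> inner_product_on V g \<and> volume_form V g v \<and>
     (\<forall>X\<in>V. \<forall>Y\<in>V. wedge (wedge (int_prod X phiV) (int_prod Y phiV)) phiV = (6 * g X Y) *\<^sub>R v)"
  then have g: "inner_product_on V g" and v: "volume_form V g v"
    and B: "X \<in> V \<Longrightarrow> Y \<in> V \<Longrightarrow>
      wedge (wedge (int_prod X phiV) (int_prod Y phiV)) phiV = (6 * g X Y) *\<^sub>R v" for X Y
    by (auto simp: gv)
  let ?s = "v frame_basis"
  have gs: "g X Y * ?s = metric X Y" if "X \<in> V" "Y \<in> V" for X Y
    using fun_cong[OF B[OF that, unfolded bform_phi[OF that]], of frame_basis] vol_frame_basis
    by simp
  have h1: "h (ax 1) \<in> V" "metric (h (ax 1)) (h (ax 1)) = 1"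
    by (auto simp: metric_def inner_axis_axis)
  then have "h (ax 1) \<noteq> 0"
    using gs[of "0::'v"] h1 h_scale[of 0 0] by (metis axis_eq_0_iff fh scale_zero_left zero_neq_one)
  then have "0 < g (h (ax 1)) (h (ax 1))" using g h1 by (auto simp: inner_product_on_def)
  then have s: "?s > 0" using gs[OF h1(1) h1(1)] h1(2) by (metis zero_less_mult_pos zero_less_one)
  \<comment> \<open>As g is \<open>metric\<close> divided by s, scaling the frame by r makes it
    orthonormal for g. On the scaled frame \<open>v\<close> has the value
    \<open>r ^ 7 * ?s = r ^ 9\<close>, hence \<open>r = 1\<close>.\<close>
  define r where "r = sqrt ?s"
  have r: "r > 0" "r * r = ?s" using s by (auto simp: r_def)
  have g_scale: "g (a *\<^sub>R u) w = a * g u w" if "u \<in> V" "w \<in> V" for a u w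
    using inner_product_on_combination[OF g that(1,1,2), of a 0] by simp
  have g_sym: "g u w = g w u" if "u \<in> V" "w \<in> V" for u w
    using g that by (simp add: inner_product_on_def)
  have v_alt: "v \<in> alt_forms V 7" using v by (simp add: volume_form_def dim_V)
  have on: "orthonormal_basis V g (map ((*\<^sub>R) r) frame_basis)"
    unfolding orthonormal_basis_def
  proof (intro conjI allI impI)
    show "set (map ((*\<^sub>R) r) frame_basis) \<subseteq> V" using subspace_scale[OF V] by auto
    have "span ((*\<^sub>R) r ` set frame_basis) = span (set frame_basis)"
      using r by (intro span_image_scale[where c = "\<lambda>_. r"]) auto
    then show "span (set (map ((*\<^sub>R) r) frame_basis)) = V"
      using orthonormal_frame_basis by (simp add: orthonormal_basis_def)
  next
    fix i j assume "i < length (map ((*\<^sub>R) r) frame_basis)" "j < length (map ((*\<^sub>R) r) frame_basis)"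
    then have ij: "i < length frame_basis" "j < length frame_basis" by auto
    then have V_ij: "frame_basis ! i \<in> V" "frame_basis ! j \<in> V"
      using set_map_h nth_mem by blast+
    have "g (r *\<^sub>R frame_basis ! i) (r *\<^sub>R frame_basis ! j) = g (frame_basis ! i) (frame_basis ! j) * ?s"
      using V_ij subspace_scale[OF V] r g_sym[of "frame_basis ! i" "r *\<^sub>R frame_basis ! j"]
        g_sym[of "frame_basis ! i" "frame_basis ! j"]
      by (simp add: g_scale) 
    also have "\<dots> = (if i = j then 1 else 0)"
      using gs[OF V_ij] orthonormal_frame_basis ij by (simp add: orthonormal_basis_def)
    finally show "g (map ((*\<^sub>R) r) frame_basis ! i) (map ((*\<^sub>R) r) frame_basis ! j) = (if i = j then 1 else 0)"
      using ij by (simp only: nth_map length_map)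
  qed
  have "v (map ((*\<^sub>R) r) vs) = r ^ length vs * v vs" if "set vs \<subseteq> V" for vs
  proof -
    \<comment> \<open>Homogeneity is stated for all forms of all degrees, since the induction on the
      list passes to contractions.\<close>
    have "\<alpha> (map ((*\<^sub>R) r) vs) = r ^ length vs * \<alpha> vs" if "\<alpha> \<in> alt_forms V k" for \<alpha> k
      using \<open>set vs \<subseteq> V\<close> that
    proof (induction vs arbitrary: \<alpha> k)
      case (Cons u us)
      show ?case
      proof (cases k)
        case 0
        then show ?thesis using Cons.prems alt_forms_off[of \<alpha> V 0] by auto
      next
        case (Suc m)
        then have "int_prod (r *\<^sub>R u) \<alpha> \<in> alt_forms V m" using Cons.prems int_prod_alt_forms by auto
        from Cons.IH[OF _ this] Cons.prems show ?thesis
          using alt_forms_head[OF Cons.prems(2), of u u r 0] by (simp add: int_prod_def)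
      qed
    qed simp
    then show ?thesis using v_alt by blast
  qed
  from this[OF set_map_h, of std_basis] have "v (map ((*\<^sub>R) r) frame_basis) = r ^ 7 * ?s"
    by (simp add: eval_nat_numeral)
  moreover have "\<bar>v (map ((*\<^sub>R) r) frame_basis)\<bar> = 1"
    using v on by (auto simp only: volume_form_def)
  ultimately have "\<bar>r ^ 7 * ?s\<bar> = 1" by metis
  moreover have "r ^ 7 * ?s > 0" using r(1) s by (intro mult_pos_pos zero_less_power)
  ultimately have "r ^ 7 * ?s = 1" by linarith
  moreover have "r ^ 9 = r ^ 7 * (r * r)" by (simp add: eval_nat_numeral)
  ultimately have "r ^ 9 = 1" unfolding r(2) by simp
  then have "r = 1" using r by (metis less_eq_real_def power_eq_1_iff zero_less_numeral norm_of_real real_norm_def abs_of_pos zero_neq_numeral)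
  then have s1: "?s = 1" using r by simp
  have "g X Y = metric X Y" for X Y
    using gs[of X Y] s1 g by (cases "X \<in> V \<and> Y \<in> V") (auto simp: inner_product_on_def metric_def)
  moreover have "v = volV"
    by (rule seven_forms_eq_V[OF v_alt vol_alt_forms]) (simp only: s1 vol_frame_basis)
  ultimately show "gv = (metric, volV)" by (auto simp: gv fun_eq_iff)
qed

text \<open>The defining equation ranges over all orthonormal bases, but \<open>form_inner\<close>
  does not depend on the basis; in the frame basis the equation is the pullback of
  \<open>wedge_psi0\<close>.\<close>

lemma hodge_star_phi: "hodge_star V metric volV 3 phiV = psiV"
  unfolding hodge_star_def dim_V
proof (rule the_equality, intro conjI ballI allI impI)
  show "psiV \<in> alt_forms V (7 - 3)" using psi_alt_forms by simp
  fix \<beta> es assume \<beta>: "\<beta> \<in> alt_forms V 3" and es: "orthonormal_basis V metric es"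
  have "form_inner es \<beta> phiV = form_inner frame_basis \<beta> phiV"
    by (rule form_inner_basis_independent[OF inner_product_on_metric V es orthonormal_frame_basis
          \<beta> phi_alt_forms])
  then have "wedge (pull \<beta>) (pull psiV) = pull (form_inner es \<beta> phiV *\<^sub>R volV)"
    by (simp only: form_inner_pull pull_scaleR pull_push wedge_psi0[OF pull_alt_forms[OF \<beta>]])
  then show "wedge \<beta> psiV = form_inner es \<beta> phiV *\<^sub>R volV"
    using subspace_scale[OF subspace_alt_forms vol_alt_forms]
    by (intro wedge_eqI[OF \<beta> psi_alt_forms]) auto
next
  fix \<eta> assume *: "\<eta> \<in> alt_forms V (7 - 3) \<and> (\<forall>\<beta>\<in>alt_forms V 3. \<forall>es. orthonormal_basis V metric es \<longrightarrow>
    wedge \<beta> \<eta> = form_inner es \<beta> phiV *\<^sub>R volV)"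
  then have \<eta>: "\<eta> \<in> alt_forms V 4" by simp
  \<comment> \<open>Two solutions differ by a 4-form whose product with every 3-form is 0.\<close>
  have "pull \<eta> - psi0 = 0"
  proof (rule four_form_eq_0)
    show "pull \<eta> - psi0 \<in> alt_forms UNIV 4"
      by (intro subspace_diff subspace_alt_forms pull_alt_forms \<eta> psi0_alt_forms)
    fix \<beta> :: "(real^7) list \<Rightarrow> real" assume \<beta>: "\<beta> \<in> alt_forms UNIV 3"
    have "wedge (push \<beta>) \<eta> = form_inner frame_basis (push \<beta>) phiV *\<^sub>R volV"
      using * push_alt_forms[OF \<beta>] orthonormal_frame_basis by blast
    then have "pull (wedge (push \<beta>) \<eta>) = pull (form_inner frame_basis (push \<beta>) phiV *\<^sub>R volV)" by simp
    then have "wedge \<beta> (pull \<eta>) = wedge \<beta> psi0"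
      by (simp only: form_inner_pull pull_scaleR pull_push wedge_psi0[OF \<beta>] pull_wedge)
    moreover have "wedge \<beta> (pull \<eta>) = wedge \<beta> (pull \<eta> - psi0) + wedge \<beta> psi0"
      by (simp flip: wedge_add_right)
    ultimately show "wedge \<beta> (pull \<eta> - psi0) std_basis = 0" by simp
  qed
  then have "pull \<eta> = pull psiV" by simp
  then show "\<eta> = psiV" using pull_eq_iff[OF \<eta> psi_alt_forms] by simp
qed

end

lemma G2_formE:
  assumes "subspace V" "G2_form V \<phi>"
  obtains f h where "G2_frame V f h" "\<phi> = linear_frame.push V f phi0"
proof -
  obtain f where \<phi>: "\<phi> \<in> alt_forms V 3" and f: "linear_iso V UNIV f"
    and eq: "\<And>vs. length vs = 3 \<Longrightarrow> set vs \<subseteq> V \<Longrightarrow> \<phi> vs = phi0 (map f vs)"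
    using assms by (auto simp: G2_form_def)
  interpret linear_frame V f "inv_into V f" by (rule linear_frameI[OF f])
  interpret G2_frame V f "inv_into V f" ..
  have "\<phi> = phiV"
  proof (rule ext)
    show "\<phi> vs = phiV vs" for vs
      using alt_forms_off[OF \<phi>, of vs] alt_forms_off[OF phi_alt_forms, of vs] eq[of vs]
      by (cases "length vs = 3 \<and> set vs \<subseteq> V") (auto simp: push_def)
  qed
  then show ?thesis using that G2_frame_axioms by blast
qed

section \<open>Contraction with bivectors in a frame\<close>

lemma eval_at_alt_forms: "eval_at V X \<in> alt_forms (alt_forms V 1) 1"
proof (rule alt_formsI)
  fix vs :: "('a list \<Rightarrow> real) list" and i :: nat and u v and a b :: real
  assume *: "length vs = 1" "set vs \<subseteq> alt_forms V 1" "i < 1" "u \<in> alt_forms V 1" "v \<in> alt_forms V 1"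
  then obtain w where "vs = [w]" by (auto simp: length_Suc_conv)
  moreover have "a *\<^sub>R u + b *\<^sub>R v \<in> alt_forms V 1"
    using * by (intro subspace_add subspace_scale subspace_alt_forms)
  ultimately show "eval_at V X (vs[i := a *\<^sub>R u + b *\<^sub>R v]) =
      a * eval_at V X (vs[i := u]) + b * eval_at V X (vs[i := v])"
    using * by (simp add: eval_at_def)
qed (auto simp: eval_at_def)

lemma eval_at_single: "\<alpha> \<in> alt_forms V 1 \<Longrightarrow> eval_at V X [\<alpha>] = \<alpha> [X]"
  by (simp add: eval_at_def)

lemma wedge_eval_at_alt_forms: "wedge (eval_at V X) (eval_at V Y) \<in> multivectors V 2"
proof -
  have "wedge (eval_at V X) (eval_at V Y) \<in> alt_forms (alt_forms V 1) (1 + 1)"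
    by (intro wedge_alt_forms eval_at_alt_forms subspace_alt_forms)
  then show ?thesis by (simp add: multivectors_def numeral_2_eq_2)
qed

lemma wedge_eval_at:
  assumes "\<alpha> \<in> alt_forms V 1" "\<beta> \<in> alt_forms V 1"
  shows "wedge (eval_at V X) (eval_at V Y) [\<alpha>, \<beta>] = \<alpha> [X] * \<beta> [Y] - \<alpha> [Y] * \<beta> [X]"
  by (simp add: wedge_1form_Cons[OF eval_at_alt_forms] eval_at_single[OF assms(1)]
      eval_at_single[OF assms(2)] int_prod_apply
      alt_forms_1_Nil[OF eval_at_alt_forms])

lemma subspace_multivectors: "subspace (multivectors V k)"
  unfolding multivectors_def by (rule subspace_alt_forms)

lemma fun_sum_apply: "(\<Sum>i\<in>I. F i) x = (\<Sum>i\<in>I. F i x)"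
  for F :: "'i \<Rightarrow> 'a \<Rightarrow> 'b::comm_monoid_add"
  by (induction I rule: infinite_finite_induct) auto

context linear_frame
begin

lemma frame_expand: "v \<in> V \<Longrightarrow> v = (\<Sum>i\<in>UNIV. f v $ i *\<^sub>R h (axis i 1))"
proof -
  assume "v \<in> V"
  then have "v = h (\<Sum>i\<in>UNIV. f v $ i *\<^sub>R axis i 1)"
    using basis_expansion[of "f v"] by (simp add: hf scalar_mult_eq_scaleR)
  then show ?thesis by (simp add: linear_sum[OF linear_h] h_scale)
qed

lemma alt_forms_expand:
  assumes "\<alpha> \<in> alt_forms V k" "v \<in> V"
  shows "\<alpha> (v # vs) = (\<Sum>i\<in>UNIV. f v $ i * \<alpha> (h (axis i 1) # vs))"
  by (subst frame_expand[OF assms(2)]) (rule alt_forms_head_sum[OF assms(1) V], simp)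

lemma span_frame: "V \<subseteq> span ((\<lambda>i. h (axis i 1)) ` UNIV)"
proof
  fix v assume "v \<in> V"
  then show "v \<in> span ((\<lambda>i. h (axis i 1)) ` UNIV)"
    by (subst frame_expand[OF \<open>v \<in> V\<close>]) (intro span_sum span_scale span_base, simp)
qed

lemma two_forms_eqI:
  assumes "\<alpha> \<in> alt_forms V 2" "\<beta> \<in> alt_forms V 2"
    and eq: "\<And>i j. \<alpha> [h (axis i 1), h (axis j 1)] = \<beta> [h (axis i 1), h (axis j 1)]"
  shows "\<alpha> = \<beta>"
proof -
  have "\<alpha> - \<beta> = 0"
  proof (rule alt_forms_eq_0_basis[OF V _ span_frame])
    show "\<alpha> - \<beta> \<in> alt_forms V 2" using assms(1,2) by (intro subspace_diff subspace_alt_forms)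
    fix ks :: "'n list" assume "length ks = 2"
    then obtain i j where "ks = [i, j]" by (auto simp: length_Suc_conv numeral_eq_Suc)
    then show "(\<alpha> - \<beta>) (map (\<lambda>i. h (axis i 1)) ks) = 0" using eq by simp
  qed auto
  then show ?thesis by simp
qed

text \<open>The counterpart of \<open>coord_covector\<close> for a general frame; it takes the place
  of \<open>h\<close> in \<open>dual_frame\<close>.\<close>

definition cov :: "real^'n \<Rightarrow> 'v list \<Rightarrow> real" where
  "cov l vs = (if length vs = 1 \<and> set vs \<subseteq> V then l \<bullet> f (hd vs) else 0)"

lemma cov_alt_forms: "cov l \<in> alt_forms V 1"
proof (rule alt_formsI)
  fix vs :: "'v list" and i :: nat and u v and a b :: real
  assume *: "length vs = 1" "set vs \<subseteq> V" "i < 1" "u \<in> V" "v \<in> V"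
  then obtain w where "vs = [w]" by (auto simp: length_Suc_conv)
  moreover have "a *\<^sub>R u + b *\<^sub>R v \<in> V"
    using * by (intro subspace_add subspace_scale V)
  ultimately show "cov l (vs[i := a *\<^sub>R u + b *\<^sub>R v]) = a * cov l (vs[i := u]) + b * cov l (vs[i := v])"
    using * by (simp add: cov_def f_combination inner_add_right)
qed (auto simp: cov_def)

lemma cov_single: "v \<in> V \<Longrightarrow> cov l [v] = l \<bullet> f v"
  by (simp add: cov_def)

lemma cov_axis: "v \<in> V \<Longrightarrow> cov (axis i 1) [v] = f v $ i"
  by (simp add: cov_single inner_axis' )

lemma cov_expand:
  assumes "\<alpha> \<in> alt_forms V 1"
  shows "cov (\<chi> i. \<alpha> [h (axis i 1)]) = \<alpha>"
proof (rule ext)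
  fix vs
  show "cov (\<chi> i. \<alpha> [h (axis i 1)]) vs = \<alpha> vs"
  proof (cases "length vs = 1 \<and> set vs \<subseteq> V")
    case True
    then obtain v where "vs = [v]" "v \<in> V" by (auto simp: length_Suc_conv)
    then show ?thesis
      using alt_forms_expand[OF assms, of v "[]"] by (simp add: cov_single inner_vec_def mult.commute)
  qed (use alt_forms_off[OF assms] in \<open>auto simp: cov_def\<close>)
qed

text \<open>Bivectors are 2-forms on the dual space, so through this instance the lemmas on 2-forms
  in a frame, such as \<open>two_forms_eqI\<close>, apply to bivectors as well.\<close>

lemma dual_frame: "linear_frame (alt_forms V 1) (\<lambda>\<alpha>. \<chi> i. \<alpha> [h (axis i 1)]) cov"
proof
  show "cov (\<chi> i. \<alpha> [h (axis i 1)]) = \<alpha>" if "\<alpha> \<in> alt_forms V 1" for \<alpha>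
    by (rule cov_expand[OF that])
  show "subspace (alt_forms V 1)" by (rule subspace_alt_forms)
  show "cov l \<in> alt_forms V 1" for l by (rule cov_alt_forms)
  show "(\<chi> i. cov l [h (axis i 1)]) = l" for l
    by (simp add: vec_eq_iff cov_single inner_axis)
qed (simp_all add: vec_eq_iff)

lemmas bivector_eqI = linear_frame.two_forms_eqI[OF dual_frame, folded multivectors_def]

text \<open>With the factor 1/2 an antisymmetric \<open>q\<close> is exactly the matrix of
  components, as \<open>bivector_cov\<close> confirms.\<close>

definition bivector :: "('n \<Rightarrow> 'n \<Rightarrow> real) \<Rightarrow> ('v list \<Rightarrow> real) list \<Rightarrow> real" where
  "bivector q = (\<Sum>i\<in>UNIV. \<Sum>j\<in>UNIV.
     (q i j / 2) *\<^sub>R wedge (eval_at V (h (axis i 1))) (eval_at V (h (axis j 1))))"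

lemma bivector_multivectors: "bivector q \<in> multivectors V 2"
  unfolding bivector_def
  by (intro subspace_sum subspace_scale subspace_multivectors wedge_eval_at_alt_forms)

lemma bivector_apply:
  assumes q: "\<And>i j. q j i = - q i j" and "\<alpha> \<in> alt_forms V 1" "\<beta> \<in> alt_forms V 1"
  shows "bivector q [\<alpha>, \<beta>] = (\<Sum>i\<in>UNIV. \<Sum>j\<in>UNIV. q i j * \<alpha> [h (axis i 1)] * \<beta> [h (axis j 1)])"
proof -
  let ?a = "\<lambda>i. \<alpha> [h (axis i 1)]" and ?b = "\<lambda>i. \<beta> [h (axis i 1)]"
  have "bivector q [\<alpha>, \<beta>] = (\<Sum>i\<in>UNIV. \<Sum>j\<in>UNIV. q i j / 2 * (?a i * ?b j - ?a j * ?b i))"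
    by (simp add: bivector_def fun_sum_apply wedge_eval_at[OF assms(2,3)])
  also have "\<dots> = (\<Sum>i\<in>UNIV. \<Sum>j\<in>UNIV. q i j / 2 * ?a i * ?b j) - (\<Sum>i\<in>UNIV. \<Sum>j\<in>UNIV. q i j / 2 * ?a j * ?b i)"
    by (simp add: sum_subtractf algebra_simps)
  also have "(\<Sum>i\<in>UNIV. \<Sum>j\<in>UNIV. q i j / 2 * ?a j * ?b i) = (\<Sum>i\<in>UNIV. \<Sum>j\<in>UNIV. - (q i j / 2 * ?a i * ?b j))"
    by (subst sum.swap, intro sum.cong refl, subst q) simp
  finally show ?thesis by (simp add: sum_negf mult.assoc flip: sum.distrib)
qed

lemma bivector_cov:
  assumes q: "\<And>i j. q j i = - q i j"
  shows "bivector q [cov (axis i 1), cov (axis j 1)] = q i j"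
proof -
  have "(\<Sum>b\<in>UNIV. q a b * (if a = i then 1 else 0) * (if b = j then 1 else 0)) = (if a = i then q i j else 0)" for a
    by (cases "a = i") (simp_all add: if_distrib[where f = "(*) _"] cong: if_cong)
  then show ?thesis
    by (simp add: bivector_apply[OF q cov_alt_forms cov_alt_forms] cov_axis axis_nth
        eq_commute[of i] eq_commute[of j])
qed

lemma multivectors_antisym: "Q \<in> multivectors V 2 \<Longrightarrow> Q [\<alpha>, \<beta>] = - Q [\<beta>, \<alpha>]"
  unfolding multivectors_def by (rule alt_forms_swap[OF _ subspace_alt_forms])

lemma bivector_components:
  assumes "Q \<in> multivectors V 2"
  shows "bivector (\<lambda>i j. Q [cov (axis i 1), cov (axis j 1)]) = Q"
  by (intro bivector_eqI bivector_multivectors assms bivector_cov multivectors_antisym)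

text \<open>The right side involves \<open>Q\<close> but not its decomposition, so the linear
  extension in \<open>contract2\<close> is well defined. For a single term the components of
  \<open>Q\<close> produce the difference of \<omega> on X, Y and on Y, X, which is twice the value
  wanted.\<close>

lemma contract2_sum:
  assumes \<omega>: "\<omega> \<in> alt_forms V k" and XYs: "set XYs \<subseteq> V \<times> V"
    and Q: "Q = (\<Sum>(X, Y)\<leftarrow>XYs. wedge (eval_at V X) (eval_at V Y))"
  shows "(\<Sum>(X, Y)\<leftarrow>XYs. int_prod Y (int_prod X \<omega>)) = (\<lambda>vs. (\<Sum>i\<in>UNIV. \<Sum>j\<in>UNIV.
    Q [cov (axis i 1), cov (axis j 1)] * \<omega> (h (axis i 1) # h (axis j 1) # vs)) / 2)"
  using XYs unfolding Q
proof (induction XYs)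
  case Nil
  then show ?case by (simp add: fun_eq_iff)
next
  case (Cons XY XYs)
  obtain X Y where XY: "XY = (X, Y)" "X \<in> V" "Y \<in> V" using Cons.prems by auto
  let ?e = "\<lambda>i. h (axis i 1)"
  \<comment> \<open>Both arguments are expanded in the frame; the second one is first swapped to the
    head of the list.\<close>
  have ex: "(\<Sum>i\<in>UNIV. \<Sum>j\<in>UNIV. f A $ i * f B $ j * \<omega> (?e i # ?e j # vs)) = \<omega> (A # B # vs)"
    if "A \<in> V" "B \<in> V" for A B vs
  proof -
    have "\<omega> (?e i # B # vs) = (\<Sum>j\<in>UNIV. f B $ j * \<omega> (?e i # ?e j # vs))" for i
      using alt_forms_expand[OF \<omega> that(2), of "?e i # vs"]
      by (simp add: alt_forms_swap[OF \<omega> V, of "?e i"] sum_negf)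
    then show ?thesis
      unfolding alt_forms_expand[OF \<omega> that(1), of "B # vs"]
      by (simp add: sum_distrib_left mult.assoc)
  qed
  have "(\<Sum>i\<in>UNIV. \<Sum>j\<in>UNIV. wedge (eval_at V X) (eval_at V Y) [cov (axis i 1), cov (axis j 1)] *
      \<omega> (?e i # ?e j # vs)) = 2 * \<omega> (X # Y # vs)" for vs
  proof -
    have "(\<Sum>i\<in>UNIV. \<Sum>j\<in>UNIV. wedge (eval_at V X) (eval_at V Y) [cov (axis i 1), cov (axis j 1)] *
        \<omega> (?e i # ?e j # vs)) =
      (\<Sum>i\<in>UNIV. \<Sum>j\<in>UNIV. f X $ i * f Y $ j * \<omega> (?e i # ?e j # vs)) -
      (\<Sum>i\<in>UNIV. \<Sum>j\<in>UNIV. f Y $ i * f X $ j * \<omega> (?e i # ?e j # vs))"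
      by (simp add: wedge_eval_at[OF cov_alt_forms cov_alt_forms] cov_axis XY sum_subtractf left_diff_distrib)
    also have "\<dots> = \<omega> (X # Y # vs) - \<omega> (Y # X # vs)" by (simp add: ex XY)
    finally show ?thesis using alt_forms_swap[OF \<omega> V, of Y X vs] by simp
  qed
  then show ?case
    using Cons by (simp add: XY fun_eq_iff int_prod_apply sum.distrib distrib_right add_divide_distrib)
qed

lemma contract2_eq:
  assumes Q: "Q \<in> multivectors V 2" and \<omega>: "\<omega> \<in> alt_forms V k"
  shows "contract2 V Q \<omega> = (\<lambda>vs. (\<Sum>i\<in>UNIV. \<Sum>j\<in>UNIV.
    Q [cov (axis i 1), cov (axis j 1)] * \<omega> (h (axis i 1) # h (axis j 1) # vs)) / 2)"
  unfolding contract2_def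
proof (rule the_equality)
  let ?q = "\<lambda>i j. Q [cov (axis i 1), cov (axis j 1)]"
  obtain ijs :: "('n \<times> 'n) list" where ijs: "set ijs = UNIV" "distinct ijs"
    using finite_distinct_list[of "UNIV :: ('n \<times> 'n) set"] by auto
  \<comment> \<open>A decomposition of \<open>Q\<close>: all pairs of frame vectors, weighted by
    half the components because both orders of a pair occur.\<close>
  define XYs where "XYs = map (\<lambda>(i, j). ((?q i j / 2) *\<^sub>R h (axis i 1), h (axis j 1))) ijs"
  have XYs: "set XYs \<subseteq> V \<times> V"
    by (auto simp: XYs_def subspace_scale[OF V])
  have "wedge (eval_at V (c *\<^sub>R X)) (eval_at V Y) = c *\<^sub>R wedge (eval_at V X) (eval_at V Y)"
    if "X \<in> V" for c X Y
  proof -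
    have "eval_at V (c *\<^sub>R X) = c *\<^sub>R eval_at V X"
    proof (rule ext)
      fix \<alpha>s
      show "eval_at V (c *\<^sub>R X) \<alpha>s = (c *\<^sub>R eval_at V X) \<alpha>s"
      proof (cases "length \<alpha>s = 1 \<and> set \<alpha>s \<subseteq> alt_forms V 1")
        case True
        then obtain \<alpha> where \<alpha>: "\<alpha>s = [\<alpha>]" "\<alpha> \<in> alt_forms V 1" by (auto simp: length_Suc_conv)
        then show ?thesis
          using alt_forms_head[OF \<alpha>(2) that that, of c 0 "[]"] by (simp add: eval_at_single)
      qed (auto simp: eval_at_def)
    qed
    then show ?thesis by (simp add: wedge_scaleR_left)
  qed
  then have "(\<Sum>(X, Y)\<leftarrow>XYs. wedge (eval_at V X) (eval_at V Y)) =
      (\<Sum>(i, j)\<leftarrow>ijs. (?q i j / 2) *\<^sub>R wedge (eval_at V (h (axis i 1))) (eval_at V (h (axis j 1))))"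
    unfolding XYs_def map_map by (intro arg_cong[where f = sum_list] map_cong) auto
  also have "\<dots> = (\<Sum>(i, j)\<in>UNIV. (?q i j / 2) *\<^sub>R wedge (eval_at V (h (axis i 1))) (eval_at V (h (axis j 1))))"
    using ijs by (simp add: sum_list_distinct_conv_sum_set)
  also have "\<dots> = bivector ?q"
    unfolding bivector_def by (simp add: sum.cartesian_product)
  also have "\<dots> = Q" by (rule bivector_components[OF Q])
  finally have Q_eq: "Q = (\<Sum>(X, Y)\<leftarrow>XYs. wedge (eval_at V X) (eval_at V Y))" by simp
  show "\<exists>XYs. set XYs \<subseteq> V \<times> V \<and> Q = (\<Sum>(X, Y)\<leftarrow>XYs. wedge (eval_at V X) (eval_at V Y)) \<and>
      (\<lambda>vs. (\<Sum>i\<in>UNIV. \<Sum>j\<in>UNIV. ?q i j * \<omega> (h (axis i 1) # h (axis j 1) # vs)) / 2) =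
      (\<Sum>(X, Y)\<leftarrow>XYs. int_prod Y (int_prod X \<omega>))"
    by (intro exI[of _ XYs] conjI XYs Q_eq contract2_sum[OF \<omega> XYs Q_eq, symmetric])
next
  fix \<eta> assume "\<exists>XYs. set XYs \<subseteq> V \<times> V \<and> Q = (\<Sum>(X, Y)\<leftarrow>XYs. wedge (eval_at V X) (eval_at V Y)) \<and>
      \<eta> = (\<Sum>(X, Y)\<leftarrow>XYs. int_prod Y (int_prod X \<omega>))"
  then obtain XYs where XYs: "set XYs \<subseteq> V \<times> V"
      "Q = (\<Sum>(X, Y)\<leftarrow>XYs. wedge (eval_at V X) (eval_at V Y))"
    and \<eta>: "\<eta> = (\<Sum>(X, Y)\<leftarrow>XYs. int_prod Y (int_prod X \<omega>))"
    by blast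
  show "\<eta> = (\<lambda>vs. (\<Sum>i\<in>UNIV. \<Sum>j\<in>UNIV.
      Q [cov (axis i 1), cov (axis j 1)] * \<omega> (h (axis i 1) # h (axis j 1) # vs)) / 2)"
    unfolding \<eta> by (rule contract2_sum[OF \<omega> XYs])
qed

lemma contract2_alt_forms:
  assumes Q: "Q \<in> multivectors V 2" and \<omega>: "\<omega> \<in> alt_forms V 4"
  shows "contract2 V Q \<omega> \<in> alt_forms V 2"
proof -
  have "contract2 V Q \<omega> = (1 / 2) *\<^sub>R (\<Sum>i\<in>UNIV. \<Sum>j\<in>UNIV.
      Q [cov (axis i 1), cov (axis j 1)] *\<^sub>R int_prod (h (axis j 1)) (int_prod (h (axis i 1)) \<omega>))"
    unfolding contract2_eq[OF Q \<omega>] by (auto simp: fun_eq_iff fun_sum_apply int_prod_apply)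
  also have "\<dots> \<in> alt_forms V 2"
    using \<omega> by (intro subspace_scale subspace_sum subspace_alt_forms int_prod_alt_forms)
      (simp add: numeral_eq_Suc)
  finally show ?thesis .
qed

end

context G2_frame
begin

text \<open>The components of the 2-form are reused as those of a bivector: the frame is
  orthonormal, so raising indices changes nothing.\<close>

definition inverse_contraction :: "('v list \<Rightarrow> real) \<Rightarrow> ('v list \<Rightarrow> real) list \<Rightarrow> real" where
  "inverse_contraction \<eta> = bivector (\<lambda>i j.
     (contract_psi0 (\<lambda>i j. \<eta> [h (ax i), h (ax j)]) (ax i) (ax j) - \<eta> [h (ax i), h (ax j)]) / 2)"

lemma contract2_psi_frame:
  assumes Q: "Q \<in> multivectors V 2"
  shows "contract2 V Q psiV [h x, h y] = contract_psi0 (\<lambda>i j. Q [cov (ax i), cov (ax j)]) x y"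
  by (simp add: contract2_eq[OF Q psi_alt_forms] contract_psi0_def push_def)

lemma contract_inverse_contraction:
  assumes \<eta>: "\<eta> \<in> alt_forms V 2"
  shows "contract2 V (inverse_contraction \<eta>) psiV = \<eta>"
proof (rule two_forms_eqI)
  show "contract2 V (inverse_contraction \<eta>) psiV \<in> alt_forms V 2"
    unfolding inverse_contraction_def by (intro contract2_alt_forms bivector_multivectors psi_alt_forms)
  let ?N = "\<lambda>i j. \<eta> [h (ax i), h (ax j)]"
  let ?T = "\<lambda>i j. contract_psi0 ?N (ax i) (ax j)"
  have N: "?N j i = - ?N i j" for i j by (rule alt_forms_swap[OF \<eta> V])
  have T: "?T j i = - ?T i j" for i j by (rule contract_psi0_antisym)
  fix k l
  have q: "(?T j i - ?N j i) / 2 = - ((?T i j - ?N i j) / 2)" for i j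
    unfolding N[of j i] T[of j i] by (simp add: minus_divide_left)
  have "contract2 V (inverse_contraction \<eta>) psiV [h (ax k), h (ax l)] =
      contract_psi0 (\<lambda>i j. (?T i j - ?N i j) / 2) (ax k) (ax l)"
    unfolding inverse_contraction_def contract2_psi_frame[OF bivector_multivectors] bivector_cov[OF q]
    by (rule refl)
  also have "\<dots> = (contract_psi0 ?T (ax k) (ax l) - ?T k l) / 2"
    by (simp add: contract_psi0_def diff_divide_distrib left_diff_distrib sum_subtractf
        flip: sum_divide_distrib)
  also have "\<dots> = ?N k l"
    by (simp add: contract_psi0_twice[OF N])
  finally show "contract2 V (inverse_contraction \<eta>) psiV [h (ax k), h (ax l)] = ?N k l" .
qed (rule \<eta>)

lemma inverse_contraction_contract:
  assumes Q: "Q \<in> multivectors V 2"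
  shows "inverse_contraction (contract2 V Q psiV) = Q"
proof -
  let ?q = "\<lambda>i j. Q [cov (ax i), cov (ax j)]"
  have q: "?q j i = - ?q i j" for i j by (rule multivectors_antisym[OF Q])
  have "(contract_psi0 (\<lambda>i j. contract_psi0 ?q (ax i) (ax j)) (ax i) (ax j) -
      contract_psi0 ?q (ax i) (ax j)) / 2 = ?q i j" for i j
    by (simp add: contract_psi0_twice[OF q])
  then show ?thesis
    using bivector_components[OF Q]
    by (simp add: inverse_contraction_def contract2_psi_frame[OF Q])
qed

end

section \<open>Smooth functions\<close>

lemma Ck_on_Suc_has_derivative:
  "Ck_on (Suc k) f S \<Longrightarrow> x \<in> S \<Longrightarrow> (f has_derivative frechet_derivative f (at x)) (at x)"
  by (simp add: frechet_derivative_works[symmetric])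

lemma Ck_on_SucD: "Ck_on (Suc k) f S \<Longrightarrow> Ck_on k f S"
proof (induction k arbitrary: f)
  case 0
  then show ?case
    by (auto intro!: differentiable_imp_continuous_on differentiable_at_imp_differentiable_on)
qed auto

text \<open>Derivatives at a point depend only on values nearby, and \<open>S\<close> is open, so
  agreement on \<open>S\<close> passes to the derivatives.\<close>

lemma Ck_on_cong:
  assumes S: "open S"
  shows "Ck_on k f S \<Longrightarrow> (\<And>x. x \<in> S \<Longrightarrow> f x = g x) \<Longrightarrow> Ck_on k g S"
proof (induction k arbitrary: f g)
  case 0
  then show ?case by (simp cong: continuous_on_cong_simp)
next
  case (Suc k)
  have d: "(g has_derivative frechet_derivative f (at x)) (at x)" if "x \<in> S" for x
    by (rule has_derivative_transform_within_open[OF Ck_on_Suc_has_derivative[OF Suc.prems(1) that] S that])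
      (use Suc.prems in auto)
  have "Ck_on k (\<lambda>x. frechet_derivative g (at x) v) S" for v
    by (rule Suc.IH[of "\<lambda>x. frechet_derivative f (at x) v"])
      (use Suc.prems(1) frechet_derivative_at[OF d] in auto)
  then show ?case using d by (auto simp: differentiable_def)
qed

text \<open>Any explicit derivative may replace the one selected by
  \<open>frechet_derivative\<close>, which brings the usual differentiation rules into play.\<close>

lemma Ck_on_SucI:
  assumes S: "open S" and d: "\<And>x. x \<in> S \<Longrightarrow> (f has_derivative D x) (at x)"
    and D: "\<And>v. Ck_on k (\<lambda>x. D x v) S"
  shows "Ck_on (Suc k) f S"
proof -
  have "Ck_on k (\<lambda>x. frechet_derivative f (at x) v) S" for v
    by (rule Ck_on_cong[OF S D[of v]]) (use frechet_derivative_at[OF d] in auto)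
  then show ?thesis using d by (auto simp: differentiable_def)
qed

lemma Ck_on_const: "Ck_on k (\<lambda>x. c) S"
proof (induction k arbitrary: c)
  case (Suc k)
  then show ?case by simp
qed simp

lemma Ck_on_add:
  assumes S: "open S"
  shows "Ck_on k f S \<Longrightarrow> Ck_on k g S \<Longrightarrow> Ck_on k (\<lambda>x. f x + g x) S"
proof (induction k arbitrary: f g)
  case (Suc k)
  show ?case
    by (rule Ck_on_SucI[OF S has_derivative_add[OF Ck_on_Suc_has_derivative Ck_on_Suc_has_derivative]])
      (use Suc in auto)
qed (auto intro: continuous_intros)

lemma Ck_on_mult:
  fixes f g :: "'a::real_normed_vector \<Rightarrow> real"
  assumes S: "open S"
  shows "Ck_on k f S \<Longrightarrow> Ck_on k g S \<Longrightarrow> Ck_on k (\<lambda>x. f x * g x) S"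
proof (induction k arbitrary: f g)
  case (Suc k)
  show ?case
    by (rule Ck_on_SucI[OF S has_derivative_mult[OF Ck_on_Suc_has_derivative Ck_on_Suc_has_derivative]])
      (use Suc.prems Suc.IH Ck_on_SucD[OF Suc.prems(1)] Ck_on_SucD[OF Suc.prems(2)] in
        \<open>auto intro!: Ck_on_add[OF S]\<close>)
qed (auto intro: continuous_intros)

text \<open>Bootstrapping: the derivative is a product of a derivative of \<open>f\<close> and
  copies of the inverse itself, which is of class \<open>k\<close> by the induction
  hypothesis.\<close>

lemma Ck_on_inverse:
  fixes f :: "'a::real_normed_vector \<Rightarrow> real"
  assumes S: "open S" and nz: "\<And>x. x \<in> S \<Longrightarrow> f x \<noteq> 0"
  shows "Ck_on k f S \<Longrightarrow> Ck_on k (\<lambda>x. inverse (f x)) S"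
proof (induction k)
  case (Suc k)
  show ?case
  proof (rule Ck_on_SucI[OF S])
    \<comment> \<open>The sign is written as a factor \<open>- 1\<close>, which leaves only products
      of functions of class \<open>k\<close>.\<close>
    show "((\<lambda>x. inverse (f x)) has_derivative
        (\<lambda>v. - 1 * (inverse (f x) * frechet_derivative f (at x) v * inverse (f x)))) (at x)" if "x \<in> S" for x
      using Deriv.has_derivative_inverse[OF nz[OF that] Ck_on_Suc_has_derivative[OF Suc.prems that]] by simp
    show "Ck_on k (\<lambda>x. - 1 * (inverse (f x) * frechet_derivative f (at x) v * inverse (f x))) S" for v
      using Suc Ck_on_SucD[OF Suc.prems] by (intro Ck_on_mult[OF S] Ck_on_const) auto
  qed
qed (use nz in \<open>auto intro!: continuous_intros\<close>)

text \<open>The same bootstrapping. Away from 0 the real cube root is smooth for arguments of either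
  sign, so it can be applied to a density in a chart of either orientation.\<close>

lemma Ck_on_root3:
  fixes f :: "'a::real_normed_vector \<Rightarrow> real"
  assumes S: "open S" and nz: "\<And>x. x \<in> S \<Longrightarrow> f x \<noteq> 0"
  shows "Ck_on k f S \<Longrightarrow> Ck_on k (\<lambda>x. root 3 (f x)) S"
proof (induction k)
  case (Suc k)
  let ?d = "\<lambda>x. inverse (3 * (root 3 (f x) * root 3 (f x)))"
  show ?case
  proof (rule Ck_on_SucI[OF S])
    fix x assume x: "x \<in> S"
    have "(root 3 has_real_derivative inverse (real 3 * root 3 (f x) ^ (3 - Suc 0))) (at (f x))"
      by (rule DERIV_odd_real_root) (use nz x in auto)
    then have "(root 3 has_derivative (*) (?d x)) (at (f x))"
      by (simp add: has_field_derivative_def power2_eq_square)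
    from diff_chain_at[OF Ck_on_Suc_has_derivative[OF Suc.prems x] this]
    show "((\<lambda>x. root 3 (f x)) has_derivative (\<lambda>v. ?d x * frechet_derivative f (at x) v)) (at x)"
      by (simp add: o_def)
  next
    have "Ck_on k (\<lambda>x. root 3 (f x)) S" using Suc Ck_on_SucD by blast
    then show "Ck_on k (\<lambda>x. ?d x * frechet_derivative f (at x) v) S" for v
      using Suc.prems nz by (intro Ck_on_mult[OF S] Ck_on_inverse[OF S] Ck_on_const) auto
  qed
qed (auto intro!: continuous_intros)

context
  fixes S :: "'a::euclidean_space set"
  assumes S: "open S"
begin

lemma smooth_on_cong:
  "smooth_on f S \<Longrightarrow> (\<And>x. x \<in> S \<Longrightarrow> g x = f x) \<Longrightarrow> smooth_on g S"
  using Ck_on_cong[OF S, of _ f g] by (simp add: smooth_on_def)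

lemma smooth_on_const: "smooth_on (\<lambda>x. c) S"
  by (simp add: smooth_on_def Ck_on_const)

lemma smooth_on_add: "smooth_on f S \<Longrightarrow> smooth_on g S \<Longrightarrow> smooth_on (\<lambda>x. f x + g x) S"
  by (simp add: smooth_on_def Ck_on_add[OF S])

lemma smooth_on_mult:
  "smooth_on f S \<Longrightarrow> smooth_on g S \<Longrightarrow> smooth_on (\<lambda>x. f x * g x :: real) S"
  by (simp add: smooth_on_def Ck_on_mult[OF S])

lemma smooth_on_diff:
  "smooth_on f S \<Longrightarrow> smooth_on g S \<Longrightarrow> smooth_on (\<lambda>x. f x - g x :: real) S"
  using smooth_on_add[OF _ smooth_on_mult[OF smooth_on_const[of "- 1"]], of f g] by simp

lemma smooth_on_divide:
  "smooth_on f S \<Longrightarrow> smooth_on g S \<Longrightarrow> (\<And>x. x \<in> S \<Longrightarrow> g x \<noteq> 0) \<Longrightarrow> smooth_on (\<lambda>x. f x / g x :: real) S"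
  by (simp add: smooth_on_def divide_inverse Ck_on_mult[OF S] Ck_on_inverse[OF S])

lemma smooth_on_root3:
  "smooth_on f S \<Longrightarrow> (\<And>x. x \<in> S \<Longrightarrow> f x \<noteq> 0) \<Longrightarrow> smooth_on (\<lambda>x. root 3 (f x)) S"
  by (simp add: smooth_on_def Ck_on_root3[OF S])

lemma smooth_on_sum:
  "(\<And>i. i \<in> I \<Longrightarrow> smooth_on (f i) S) \<Longrightarrow> smooth_on (\<lambda>x. \<Sum>i\<in>I. f i x) S"
  by (induction I rule: infinite_finite_induct) (auto intro: smooth_on_const smooth_on_add)

lemma smooth_on_prod:
  "(\<And>i. i \<in> I \<Longrightarrow> smooth_on (f i) S) \<Longrightarrow> smooth_on (\<lambda>x. \<Prod>i\<in>I. f i x :: real) S"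
  by (induction I rule: infinite_finite_induct) (auto intro: smooth_on_const smooth_on_mult)

lemma smooth_on_det:
  "(\<And>i j. smooth_on (\<lambda>x. M x $ i $ j) S) \<Longrightarrow> smooth_on (\<lambda>x. det (M x :: real^'n^'n)) S"
  unfolding det_def by (intro smooth_on_sum smooth_on_mult smooth_on_const smooth_on_prod)

text \<open>The sum runs over all splittings of \<open>us\<close>, so the factors are evaluated on
  sublists of every length; hence the assumptions on lists of all lengths.\<close>

lemma smooth_on_wedge:
  assumes "\<And>us. smooth_on (\<lambda>y. \<alpha> y (map (h y) us)) S" "\<And>us. smooth_on (\<lambda>y. \<beta> y (map (h y) us)) S"
  shows "smooth_on (\<lambda>y. wedge (\<alpha> y) (\<beta> y) (map (h y) us)) S"
  unfolding wedge_def length_map nths_map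
  by (intro smooth_on_sum smooth_on_mult smooth_on_const assms)

end

lemma sum_swap_pairs:
  "(\<Sum>a\<in>A. \<Sum>b\<in>B. \<Sum>i\<in>I. \<Sum>j\<in>J. F a b i j) = (\<Sum>i\<in>I. \<Sum>j\<in>J. \<Sum>a\<in>A. \<Sum>b\<in>B. F a b i j)"
  unfolding sum.cartesian_product split_def
  by (rule sum.reindex_bij_witness[of _ "\<lambda>(i, j, a, b). (a, b, i, j)" "\<lambda>(a, b, i, j). (i, j, a, b)"]) auto

section \<open>A \<open>G\<^sub>2\<close>-frame and a coordinate frame\<close>

lemma alt_forms_rotate_3:
  assumes \<alpha>: "\<alpha> \<in> alt_forms V 3" and V: "subspace V"
  shows "\<alpha> [a, b, c] = \<alpha> [c, a, b]"
proof -
  have "int_prod a \<alpha> \<in> alt_forms V 2" using \<alpha> by (intro int_prod_alt_forms) (simp add: numeral_eq_Suc)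
  from alt_forms_swap[OF this V, of b c "[]"] show ?thesis
    using alt_forms_swap[OF \<alpha> V, of a c "[b]"] by (simp add: int_prod_apply)
qed

text \<open>In \<open>phi0_contract\<close> with \<open>c = a\<close> and \<open>d = b\<close> the
  \<open>psi0\<close> term has repeated arguments and drops out. What is left for each m is the
  squared length of \<open>a\<close> minus the square of \<open>a $ m\<close>; summed over seven
  indices this gives the constant 7 - 1 = 6.\<close>

lemma phi0_norm_int_prod: "(\<Sum>m\<in>UNIV. \<Sum>n\<in>UNIV. phi0 [ax m, ax n, a] * phi0 [ax m, ax n, a]) = 6 * (a \<bullet> a)"
proof -
  have z: "psi0 [a, b, a, b] = 0" for a b
    by (rule alt_forms_eq[OF psi0_alt_forms, of _ 0 2]) auto
  have rot: "phi0 [ax m, ax n, a] = phi0 [a, ax m, ax n]" for m n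
    by (rule alt_forms_rotate_3[OF phi0_alt_forms subspace_UNIV])
  have "(\<Sum>m\<in>UNIV. \<Sum>n\<in>UNIV. phi0 [ax m, ax n, a] * phi0 [ax m, ax n, a]) =
      (\<Sum>m\<in>UNIV. (a \<bullet> a) * (ax m \<bullet> ax m) - (a \<bullet> ax m) * (ax m \<bullet> a))"
    unfolding rot phi0_contract z by simp
  also have "\<dots> = 6 * (a \<bullet> a)"
  proof -
    have "(\<Sum>m\<in>UNIV. a $ m * a $ m) = a \<bullet> a" by (simp add: inner_vec_def)
    then show ?thesis by (simp add: sum_subtractf inner_axis_axis inner_axis inner_axis')
  qed
  finally show ?thesis .
qed

text \<open>At one point, \<open>f\<close> and \<open>h\<close> form an adapted frame, orthonormal
  but otherwise arbitrary, and \<open>f'\<close> and \<open>h'\<close> the coordinate frame of a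
  chart. The aim is to rewrite everything until only components along \<open>h'\<close>
  remain.\<close>

locale two_frames = G2_frame V f h + coord: linear_frame V f' h'
  for V :: "'v::real_vector set" and f h and f' :: "'v \<Rightarrow> real^7" and h'
begin

abbreviation "e m \<equiv> h (ax m)"
abbreviation "\<delta> i \<equiv> h' (ax i)"

text \<open>The coordinate components of the sum of the tensor squares of the \<open>e m\<close>,
  which is the inverse metric; see \<open>metric_cometric\<close>.\<close>

definition cometric :: "7 \<Rightarrow> 7 \<Rightarrow> real" where
  "cometric i j = (\<Sum>m\<in>UNIV. f' (e m) $ i * f' (e m) $ j)"

text \<open>Both occurrences of \<open>e m\<close> are expanded in coordinates and the sum over
  \<open>m\<close> is carried out first. This is how the adapted frame is eliminated from
  traces.\<close>

lemma trace_cometric: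
  assumes \<alpha>: "\<alpha> \<in> alt_forms V k" and \<beta>: "\<beta> \<in> alt_forms V l"
  shows "(\<Sum>m\<in>UNIV. \<alpha> (e m # vs) * \<beta> (e m # ws)) =
    (\<Sum>i\<in>UNIV. \<Sum>j\<in>UNIV. cometric i j * (\<alpha> (\<delta> i # vs) * \<beta> (\<delta> j # ws)))"
proof -
  have "(\<Sum>m\<in>UNIV. \<alpha> (e m # vs) * \<beta> (e m # ws)) =
    (\<Sum>m\<in>UNIV. \<Sum>i\<in>UNIV. \<Sum>j\<in>UNIV. f' (e m) $ i * f' (e m) $ j * (\<alpha> (\<delta> i # vs) * \<beta> (\<delta> j # ws)))"
    by (simp add: coord.alt_forms_expand[OF \<alpha>, of "e _"] coord.alt_forms_expand[OF \<beta>, of "e _"]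
        sum_product mult_ac)
  also have "\<dots> = (\<Sum>i\<in>UNIV. \<Sum>j\<in>UNIV. \<Sum>m\<in>UNIV. f' (e m) $ i * f' (e m) $ j * (\<alpha> (\<delta> i # vs) * \<beta> (\<delta> j # ws)))"
    by (rule trans[OF sum.swap], rule sum.cong[OF refl], rule sum.swap)
  finally show ?thesis by (simp add: cometric_def sum_distrib_right)
qed

lemma trace_cometric_2:
  assumes \<alpha>: "\<alpha> \<in> alt_forms V (Suc k)" and \<beta>: "\<beta> \<in> alt_forms V (Suc l)"
  shows "(\<Sum>m\<in>UNIV. \<Sum>n\<in>UNIV. \<alpha> (e m # e n # vs) * \<beta> (e m # e n # ws)) =
    (\<Sum>i\<in>UNIV. \<Sum>j\<in>UNIV. cometric i j *
      (\<Sum>i'\<in>UNIV. \<Sum>j'\<in>UNIV. cometric i' j' * (\<alpha> (\<delta> i # \<delta> i' # vs) * \<beta> (\<delta> j # \<delta> j' # ws))))"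
proof -
  have inner: "(\<Sum>n\<in>UNIV. \<alpha> (\<delta> i # e n # vs) * \<beta> (\<delta> j # e n # ws)) =
      (\<Sum>i'\<in>UNIV. \<Sum>j'\<in>UNIV. cometric i' j' * (\<alpha> (\<delta> i # \<delta> i' # vs) * \<beta> (\<delta> j # \<delta> j' # ws)))" for i j
    using trace_cometric[OF int_prod_alt_forms[OF \<alpha>, of "\<delta> i"] int_prod_alt_forms[OF \<beta>, of "\<delta> j"], of vs ws]
    by (simp add: int_prod_apply)
  have "(\<Sum>m\<in>UNIV. \<Sum>n\<in>UNIV. \<alpha> (e m # e n # vs) * \<beta> (e m # e n # ws)) =
      (\<Sum>n\<in>UNIV. \<Sum>i\<in>UNIV. \<Sum>j\<in>UNIV. cometric i j * (\<alpha> (\<delta> i # e n # vs) * \<beta> (\<delta> j # e n # ws)))"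
    by (subst sum.swap) (simp add: trace_cometric[OF \<alpha> \<beta>])
  also have "\<dots> = (\<Sum>i\<in>UNIV. \<Sum>j\<in>UNIV. \<Sum>n\<in>UNIV. cometric i j * (\<alpha> (\<delta> i # e n # vs) * \<beta> (\<delta> j # e n # ws)))"
    by (rule trans[OF sum.swap], rule sum.cong[OF refl], rule sum.swap)
  finally show ?thesis by (simp add: inner flip: sum_distrib_left)
qed

lemma metric_eq: "u \<in> V \<Longrightarrow> v \<in> V \<Longrightarrow> metric u v = f u \<bullet> f v"
  by (simp add: metric_def)

text \<open>The sum over \<open>j\<close> reassembles \<open>e m\<close> inside the inner product
  and leaves the component of \<open>\<delta> i\<close> along \<open>e m\<close>; the sum over
  \<open>m\<close> then reassembles \<open>\<delta> i\<close>.\<close>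

lemma metric_cometric: "(\<Sum>j\<in>UNIV. metric (\<delta> i) (\<delta> j) * cometric j k) = (if i = k then 1 else 0)"
proof -
  have fe: "f v $ m = (\<Sum>j\<in>UNIV. f' v $ j * f (\<delta> j) $ m)" if "v \<in> V" for v m
    using coord.alt_forms_expand[OF cov_alt_forms that, of "axis m 1" "[]"] that
    by (simp add: cov_axis)
  have "(\<Sum>j\<in>UNIV. metric (\<delta> i) (\<delta> j) * cometric j k) =
      (\<Sum>j\<in>UNIV. \<Sum>m\<in>UNIV. f' (e m) $ k * (f' (e m) $ j * (f (\<delta> i) \<bullet> f (\<delta> j))))"
    by (simp add: metric_eq cometric_def sum_distrib_left mult_ac)
  also have "\<dots> = (\<Sum>m\<in>UNIV. f' (e m) $ k * (\<Sum>j\<in>UNIV. f' (e m) $ j * (f (\<delta> i) \<bullet> f (\<delta> j))))"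
    by (subst sum.swap) (simp add: sum_distrib_left)
  also have "\<dots> = (\<Sum>m\<in>UNIV. f' (e m) $ k * f (\<delta> i) $ m)"
  proof (intro sum.cong refl arg_cong2[where f = "(*)"])
    fix m
    have "f (e m) = (\<Sum>j\<in>UNIV. f' (e m) $ j *\<^sub>R f (\<delta> j))"
      using fe[of "e m"] by (simp add: vec_eq_iff sum_component)
    then have "f (\<delta> i) \<bullet> ax m = (\<Sum>j\<in>UNIV. f' (e m) $ j * (f (\<delta> i) \<bullet> f (\<delta> j)))"
      by (metis (no_types, lifting) fh inner_scaleR_right inner_sum_right sum.cong)
    then show "(\<Sum>j\<in>UNIV. f' (e m) $ j * (f (\<delta> i) \<bullet> f (\<delta> j))) = f (\<delta> i) $ m"
      by (simp add: inner_axis)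
  qed
  also have "\<dots> = f' (\<delta> i) $ k"
    using alt_forms_expand[OF coord.cov_alt_forms, of "\<delta> i" "axis k 1" "[]"]
    by (simp add: coord.cov_axis mult.commute)
  finally show ?thesis by (simp add: axis_nth eq_commute)
qed

text \<open>Up to a sign that records the orientation of the chart, this is the square root of the
  determinant of the metric in coordinates.\<close>

definition density :: real where "density = volV (map h' std_basis)"

lemma density_nonzero: "density \<noteq> 0"
proof
  assume "density = 0"
  then have "coord.pull volV std_basis = 0" by (simp add: density_def coord.pull_def)
  then have "coord.pull volV = 0"
    using seven_forms_eq[OF coord.pull_alt_forms[OF vol_alt_forms] subspace_0[OF subspace_alt_forms]]
    by simp
  then have "coord.pull volV = coord.pull 0" by (simp add: coord.pull_def fun_eq_iff)
  then have "volV = 0"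
    using coord.pull_eq_iff[OF vol_alt_forms subspace_0[OF subspace_alt_forms]] by simp
  then show False using vol_frame_basis by simp
qed

lemma bform_density:
  "u \<in> V \<Longrightarrow> v \<in> V \<Longrightarrow> wedge (wedge (int_prod u phiV) (int_prod v phiV)) phiV (map h' std_basis) =
    6 * metric u v * density"
  by (simp add: bform_phi density_def)

lemma phi_trace: "u \<in> V \<Longrightarrow> (\<Sum>m\<in>UNIV. \<Sum>n\<in>UNIV. phiV [e m, e n, u] * phiV [e m, e n, u]) = 6 * metric u u"
  using phi0_norm_int_prod[of "f u"] by (simp add: push_def metric_eq)

text \<open>Solving \<open>phi0_contract\<close> for the 4-form and replacing the trace over the
  adapted frame by \<open>cometric\<close> leaves coordinate expressions in the 3-form and the
  metric.\<close>

lemma psi_eq: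
  assumes "a \<in> V" "b \<in> V" "c \<in> V" "d \<in> V"
  shows "psiV [a, b, c, d] =
    (\<Sum>i\<in>UNIV. \<Sum>j\<in>UNIV. cometric i j * (phiV [\<delta> i, a, b] * phiV [\<delta> j, c, d]))
    - metric a c * metric b d + metric a d * metric b c"
proof -
  have rot: "phi0 [ax m, x, y] = phi0 [x, y, ax m]" for m x y
    by (rule alt_forms_rotate_3[OF phi0_alt_forms subspace_UNIV, symmetric])
  have "(\<Sum>m\<in>UNIV. phiV [e m, a, b] * phiV [e m, c, d]) =
      (\<Sum>m\<in>UNIV. phi0 [f a, f b, ax m] * phi0 [f c, f d, ax m])"
    using assms by (simp add: push_def rot)
  then show ?thesis
    using assms unfolding trace_cometric[OF phi_alt_forms phi_alt_forms] phi0_contract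
    by (simp add: push_def metric_eq)
qed

text \<open>The musical isomorphism from covectors to vectors, in coordinates.\<close>

definition sharp :: "real^7 \<Rightarrow> 'v" where
  "sharp l = h' (\<chi> j. \<Sum>i\<in>UNIV. l $ i * cometric i j)"

lemma sharp_in [simp]: "sharp l \<in> V"
  by (simp add: sharp_def)

text \<open>In an orthonormal frame the components of a vector are the values of its metric dual,
  here \<open>l\<close>, on the frame. So evaluating a bivector on covectors can be traded for
  evaluating a 2-form on their \<open>sharp\<close> images.\<close>

lemma f_sharp: "f (sharp l) $ m = l \<bullet> f' (e m)"
proof -
  have "sharp l = (\<Sum>m\<in>UNIV. (l \<bullet> f' (e m)) *\<^sub>R e m)"
  proof -
    have 1: "f' (\<Sum>m\<in>UNIV. (l \<bullet> f' (e m)) *\<^sub>R e m) $ j = (\<Sum>i\<in>UNIV. l $ i * cometric i j)" for j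
    proof -
      have "f' (\<Sum>m\<in>UNIV. (l \<bullet> f' (e m)) *\<^sub>R e m) $ j = (\<Sum>m\<in>UNIV. (l \<bullet> f' (e m)) * f' (e m) $ j)"
        using alt_forms_head_sum[OF coord.cov_alt_forms V, of UNIV e "axis j 1" "\<lambda>m. l \<bullet> f' (e m)" "[]"]
        by (simp add: coord.cov_axis subspace_sum[OF V] subspace_scale[OF V])
      also have "\<dots> = (\<Sum>m\<in>UNIV. \<Sum>i\<in>UNIV. l $ i * (f' (e m) $ i * f' (e m) $ j))"
        by (simp add: inner_vec_def sum_distrib_left sum_distrib_right mult_ac)
      also have "\<dots> = (\<Sum>i\<in>UNIV. l $ i * cometric i j)"
        by (subst sum.swap) (simp add: cometric_def sum_distrib_left)
      finally show ?thesis .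
    qed
    have V_sum: "(\<Sum>m\<in>UNIV. (l \<bullet> f' (e m)) *\<^sub>R e m) \<in> V"
      by (intro subspace_sum[OF V] subspace_scale[OF V]) simp
    have "f' (\<Sum>m\<in>UNIV. (l \<bullet> f' (e m)) *\<^sub>R e m) = (\<chi> j. \<Sum>i\<in>UNIV. l $ i * cometric i j)"
      unfolding vec_eq_iff vec_lambda_beta using 1 by (rule allI)
    then show ?thesis
      unfolding sharp_def using coord.hf[OF V_sum] by simp
  qed
  then have "f (sharp l) $ m = (\<Sum>n\<in>UNIV. (l \<bullet> f' (e n)) * f (e n) $ m)"
    using alt_forms_head_sum[OF cov_alt_forms V, of UNIV e "axis m 1" "\<lambda>m. l \<bullet> f' (e m)" "[]"]
    by (simp add: cov_axis subspace_sum[OF V] subspace_scale[OF V])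
  also have "\<dots> = (\<Sum>n\<in>UNIV. if n = m then l \<bullet> f' (e n) else 0)"
    by (intro sum.cong refl) (simp add: axis_nth)
  finally show ?thesis by simp
qed

end

context linear_frame
begin

lemma two_form_expand:
  assumes \<alpha>: "\<alpha> \<in> alt_forms V 2" and "u \<in> V" "v \<in> V"
  shows "\<alpha> [u, v] = (\<Sum>i\<in>UNIV. \<Sum>j\<in>UNIV. f u $ i * f v $ j * \<alpha> [h (axis i 1), h (axis j 1)])"
proof -
  have "\<alpha> [h (axis i 1), v] = (\<Sum>j\<in>UNIV. f v $ j * \<alpha> [h (axis i 1), h (axis j 1)])" for i
  proof -
    have "int_prod (h (axis i 1)) \<alpha> \<in> alt_forms V 1"
      using \<alpha> by (intro int_prod_alt_forms) (simp add: numeral_2_eq_2)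
    from alt_forms_expand[OF this assms(3), of "[]"] show ?thesis by (simp add: int_prod_apply)
  qed
  then show ?thesis
    unfolding alt_forms_expand[OF \<alpha> assms(2), of "[v]"] by (simp add: sum_distrib_left mult.assoc)
qed

end

context two_frames
begin

text \<open>By \<open>f_sharp\<close>, evaluation on the covectors amounts to evaluating half the
  difference of T \<eta> and \<eta> on their \<open>sharp\<close> images. The sum over two adapted
  vectors in T \<eta> is a double trace, which \<open>trace_cometric_2\<close> rewrites.\<close>

lemma inverse_contraction_coords:
  assumes \<eta>: "\<eta> \<in> alt_forms V 2"
  shows "inverse_contraction \<eta> [coord.cov l, coord.cov l'] =
    ((\<Sum>i\<in>UNIV. \<Sum>j\<in>UNIV. cometric i j * (\<Sum>i'\<in>UNIV. \<Sum>j'\<in>UNIV. cometric i' j' *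
        (\<eta> [\<delta> i, \<delta> i'] * psiV [\<delta> j, \<delta> j', sharp l, sharp l']))) / 2 - \<eta> [sharp l, sharp l']) / 2"
proof -
  let ?N = "\<lambda>i j. \<eta> [e i, e j]"
  let ?T = "\<lambda>i j. contract_psi0 ?N (ax i) (ax j)"
  have N: "?N j i = - ?N i j" for i j by (rule alt_forms_swap[OF \<eta> V])
  have T: "?T j i = - ?T i j" for i j by (rule contract_psi0_antisym)
  have q: "(?T j i - ?N j i) / 2 = - ((?T i j - ?N i j) / 2)" for i j
    unfolding N[of j i] T[of j i] by (simp add: minus_divide_left)
  have psi2: "psiV [u, v, sharp l, sharp l'] = (\<Sum>a\<in>UNIV. \<Sum>b\<in>UNIV.
      f (sharp l) $ a * f (sharp l') $ b * psiV [u, v, e a, e b])" for u v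
  proof -
    have "int_prod v (int_prod u psiV) \<in> alt_forms V 2"
      using psi_alt_forms by (intro int_prod_alt_forms) (simp add: numeral_eq_Suc)
    from two_form_expand[OF this sharp_in sharp_in] show ?thesis by (simp add: int_prod_apply)
  qed
  have "(\<Sum>a\<in>UNIV. \<Sum>b\<in>UNIV. ?T a b * (f (sharp l) $ a * f (sharp l') $ b)) =
      (\<Sum>a\<in>UNIV. \<Sum>b\<in>UNIV. (\<Sum>i\<in>UNIV. \<Sum>j\<in>UNIV. ?N i j * (f (sharp l) $ a * f (sharp l') $ b * psiV [e i, e j, e a, e b])) / 2)"
    by (simp add: contract_psi0_def push_def sum_divide_distrib sum_distrib_left sum_distrib_right mult_ac)
  also have "\<dots> = (\<Sum>a\<in>UNIV. \<Sum>b\<in>UNIV. \<Sum>i\<in>UNIV. \<Sum>j\<in>UNIV. ?N i j * (f (sharp l) $ a * f (sharp l') $ b * psiV [e i, e j, e a, e b])) / 2"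
    by (simp add: sum_divide_distrib)
  also have "(\<Sum>a\<in>UNIV. \<Sum>b\<in>UNIV. \<Sum>i\<in>UNIV. \<Sum>j\<in>UNIV. ?N i j * (f (sharp l) $ a * f (sharp l') $ b * psiV [e i, e j, e a, e b])) =
      (\<Sum>i\<in>UNIV. \<Sum>j\<in>UNIV. \<Sum>a\<in>UNIV. \<Sum>b\<in>UNIV. ?N i j * (f (sharp l) $ a * f (sharp l') $ b * psiV [e i, e j, e a, e b]))"
    by (rule sum_swap_pairs)
  \<comment> \<open>The sums over \<open>a\<close> and \<open>b\<close> reassemble
    \<open>sharp l\<close> and \<open>sharp l'\<close> in the arguments of the 4-form.\<close>
  also have "\<dots> = (\<Sum>i\<in>UNIV. \<Sum>j\<in>UNIV. ?N i j * psiV [e i, e j, sharp l, sharp l'])"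
    by (simp add: psi2 sum_distrib_left)
  also have "\<dots> = (\<Sum>i\<in>UNIV. \<Sum>j\<in>UNIV. cometric i j * (\<Sum>i'\<in>UNIV. \<Sum>j'\<in>UNIV. cometric i' j' *
      (\<eta> [\<delta> i, \<delta> i'] * psiV [\<delta> j, \<delta> j', sharp l, sharp l'])))"
    using \<eta> psi_alt_forms by (intro trace_cometric_2[of _ 1 _ 3]) (simp_all add: numeral_eq_Suc)
  finally have T_sum: "(\<Sum>a\<in>UNIV. \<Sum>b\<in>UNIV. ?T a b * (f (sharp l) $ a * f (sharp l') $ b)) =
    (\<Sum>i\<in>UNIV. \<Sum>j\<in>UNIV. cometric i j * (\<Sum>i'\<in>UNIV. \<Sum>j'\<in>UNIV. cometric i' j' *
      (\<eta> [\<delta> i, \<delta> i'] * psiV [\<delta> j, \<delta> j', sharp l, sharp l']))) / 2" .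
  have N_sum: "(\<Sum>a\<in>UNIV. \<Sum>b\<in>UNIV. ?N a b * (f (sharp l) $ a * f (sharp l') $ b)) = \<eta> [sharp l, sharp l']"
    by (simp add: two_form_expand[OF \<eta> sharp_in sharp_in] mult.commute)
  have "inverse_contraction \<eta> [coord.cov l, coord.cov l'] =
      (\<Sum>a\<in>UNIV. \<Sum>b\<in>UNIV. (?T a b - ?N a b) / 2 * (f (sharp l) $ a * f (sharp l') $ b))"
    unfolding inverse_contraction_def bivector_apply[OF q coord.cov_alt_forms coord.cov_alt_forms]
    by (simp add: coord.cov_single f_sharp mult.assoc)
  also have "\<dots> = ((\<Sum>a\<in>UNIV. \<Sum>b\<in>UNIV. ?T a b * (f (sharp l) $ a * f (sharp l') $ b)) -
      (\<Sum>a\<in>UNIV. \<Sum>b\<in>UNIV. ?N a b * (f (sharp l) $ a * f (sharp l') $ b))) / 2"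
    by (simp add: sum_divide_distrib left_diff_distrib diff_divide_distrib sum_subtractf)
  finally show ?thesis unfolding T_sum N_sum .
qed

end

text \<open>Smoothness is assumed only of the components of the 3-form along the coordinate frame
  \<open>h'\<close>; \<open>f\<close> and \<open>h\<close> may vary with the point in any
  way.\<close>

locale smooth_frames =
  fixes S :: "(real^7) set" and V :: "real^7 \<Rightarrow> 'v::real_vector set"
    and f :: "real^7 \<Rightarrow> 'v \<Rightarrow> real^7" and h and f' :: "real^7 \<Rightarrow> 'v \<Rightarrow> real^7" and h'
  assumes S: "open S"
    and frames: "y \<in> S \<Longrightarrow> two_frames (V y) (f y) (h y) (f' y) (h' y)"
    and smooth_phi: "smooth_on (\<lambda>y. linear_frame.push (V y) (f y) phi0 (map (h' y) us)) S"
begin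

abbreviation "\<Phi> y \<equiv> linear_frame.push (V y) (f y) phi0"
abbreviation "\<Psi> y \<equiv> linear_frame.push (V y) (f y) psi0"
abbreviation "\<gamma> y \<equiv> linear_frame.metric (V y) (f y)"
abbreviation "\<rho> y \<equiv> two_frames.density (V y) (f y) (h' y)"
abbreviation "\<kappa> y \<equiv> two_frames.cometric (h y) (f' y)"

lemma smooth_bform:
  "smooth_on (\<lambda>y. wedge (wedge (int_prod (h' y u) (\<Phi> y)) (int_prod (h' y v) (\<Phi> y))) (\<Phi> y) (map (h' y) us)) S"
proof -
  have "smooth_on (\<lambda>y. int_prod (h' y u) (\<Phi> y) (map (h' y) us)) S" for u us
    using smooth_phi[of "u # us"] by (simp add: int_prod_apply)
  then show ?thesis by (intro smooth_on_wedge[OF S] smooth_phi)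
qed

text \<open>The matrix \<open>\<rho> g\<close> is polynomial in the components of the 3-form. Contracting two copies of the
  3-form with its inverse \<open>g\<inverse> / \<rho>\<close> twice gives \<open>6 g / \<rho>\<^sup>2\<close>, and comparison with \<open>\<rho> g\<close> yields \<open>\<rho>\<^sup>3\<close>;
  hence \<open>\<rho>\<close>, \<open>g\<close> and \<open>g\<inverse>\<close> are smooth.\<close>

definition scaled_metric :: "real^7 \<Rightarrow> real^7^7" where
  "scaled_metric y = (\<chi> i j. wedge (wedge (int_prod (h' y (ax i)) (\<Phi> y)) (int_prod (h' y (ax j)) (\<Phi> y))) (\<Phi> y)
     (map (h' y) std_basis) / 6)"

text \<open>Cramer's rule for the inverse of \<open>scaled_metric\<close>; a quotient of
  determinants is visibly smooth.\<close>

definition scaled_cometric :: "real^7 \<Rightarrow> 7 \<Rightarrow> 7 \<Rightarrow> real" where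
  "scaled_cometric y k j = det (\<chi> i l. if l = k then ax j $ i else scaled_metric y $ i $ l) / det (scaled_metric y)"

lemma scaled_metric_eq: "y \<in> S \<Longrightarrow> scaled_metric y $ i $ j = \<gamma> y (h' y (ax i)) (h' y (ax j)) * \<rho> y"
proof -
  assume "y \<in> S"
  then interpret two_frames "V y" "f y" "h y" "f' y" "h' y" by (rule frames)
  show ?thesis unfolding scaled_metric_def vec_lambda_beta by (subst bform_density) auto
qed

lemma smooth_scaled_metric: "smooth_on (\<lambda>y. scaled_metric y $ i $ j) S"
  unfolding scaled_metric_def vec_lambda_beta
  by (intro smooth_on_divide[OF S] smooth_bform smooth_on_const[OF S]) simp

lemma det_scaled_metric: "y \<in> S \<Longrightarrow> det (scaled_metric y) \<noteq> 0"
  and scaled_cometric_eq: "y \<in> S \<Longrightarrow> scaled_cometric y k j = \<kappa> y k j / \<rho> y"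
proof -
  assume "y \<in> S"
  then interpret two_frames "V y" "f y" "h y" "f' y" "h' y" by (rule frames)
  let ?C = "\<chi> i j. cometric i j / density"
  have *: "(\<Sum>k\<in>UNIV. scaled_metric y $ i $ k * cometric k j / density) = (if i = j then 1 else 0)" for i j
    using metric_cometric[of i j] density_nonzero by (simp add: scaled_metric_eq[OF \<open>y \<in> S\<close>])
  have "scaled_metric y ** ?C = mat 1"
    by (simp add: vec_eq_iff matrix_matrix_mult_def mat_def *)
  then show det: "det (scaled_metric y) \<noteq> 0"
    using invertible_det_nz invertible_right_inverse by blast
  \<comment> \<open>Column \<open>j\<close> of the inverse solves the linear system with right side
    \<open>ax j\<close>, the one that Cramer's rule solves.\<close>
  have "scaled_metric y *v (\<chi> k. cometric k j / density) = ax j"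
    by (simp add: vec_eq_iff matrix_vector_mult_def * axis_nth)
  then show "scaled_cometric y k j = cometric k j / density"
    unfolding cramer[OF det] scaled_cometric_def by (simp add: vec_eq_iff)
qed

lemma smooth_scaled_cometric: "smooth_on (\<lambda>y. scaled_cometric y k j) S"
proof -
  have "smooth_on (\<lambda>y. (\<chi> i l. if l = k then ax j $ i else scaled_metric y $ i $ l) $ i $ l) S" for i l
    using smooth_scaled_metric smooth_on_const[OF S] by (cases "l = k") simp_all
  then show ?thesis
    unfolding scaled_cometric_def by (intro smooth_on_divide[OF S] smooth_on_det[OF S] smooth_scaled_metric det_scaled_metric)
qed

text \<open>The vector \<open>ax 1\<close> is an arbitrary nonzero choice: its squared length
  cancels in the quotient with \<open>scaled_metric\<close>, and a power of the density
  remains.\<close>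

definition scaled_trace :: "real^7 \<Rightarrow> real" where
  "scaled_trace y = (\<Sum>i\<in>UNIV. \<Sum>j\<in>UNIV. scaled_cometric y i j * (\<Sum>i'\<in>UNIV. \<Sum>j'\<in>UNIV. scaled_cometric y i' j' *
     (\<Phi> y (map (h' y) [ax i, ax i', ax 1]) * \<Phi> y (map (h' y) [ax j, ax j', ax 1]))))"

lemma smooth_scaled_trace: "smooth_on scaled_trace S"
  unfolding scaled_trace_def by (intro smooth_on_sum[OF S] smooth_on_mult[OF S] smooth_scaled_cometric smooth_phi)

lemma metric_pos: "y \<in> S \<Longrightarrow> \<gamma> y (h' y (ax 1)) (h' y (ax 1)) > 0"
proof -
  assume "y \<in> S"
  then interpret two_frames "V y" "f y" "h y" "f' y" "h' y" by (rule frames)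
  have "h' y (ax 1) \<noteq> 0"
  proof
    assume "h' y (ax 1) = 0"
    then have "h' y (ax 1) = h' y 0" using coord.h_scale[of 0 0] by simp
    then have "ax 1 = 0" using coord.fh by metis
    then show False by simp
  qed
  then show ?thesis using inner_product_on_metric by (simp add: inner_product_on_def)
qed

lemma scaled_trace_eq: "y \<in> S \<Longrightarrow> scaled_trace y = 6 * \<gamma> y (h' y (ax 1)) (h' y (ax 1)) / (\<rho> y)\<^sup>2"
proof -
  assume y: "y \<in> S"
  then interpret two_frames "V y" "f y" "h y" "f' y" "h' y" by (rule frames)
  have "phiV \<in> alt_forms (V y) (Suc 2)" using phi_alt_forms by (simp add: numeral_eq_Suc)
  then have "6 * metric (\<delta> 1) (\<delta> 1) = (\<Sum>i\<in>UNIV. \<Sum>j\<in>UNIV. cometric i j *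
      (\<Sum>i'\<in>UNIV. \<Sum>j'\<in>UNIV. cometric i' j' * (phiV [\<delta> i, \<delta> i', \<delta> 1] * phiV [\<delta> j, \<delta> j', \<delta> 1])))"
    using trace_cometric_2[of phiV 2 phiV 2 "[\<delta> 1]" "[\<delta> 1]"] phi_trace[of "\<delta> 1"] by simp
  then show ?thesis
    unfolding scaled_trace_def scaled_cometric_eq[OF y]
    by (simp add: power2_eq_square flip: sum_divide_distrib)
qed

lemma smooth_density: "smooth_on \<rho> S"
proof (rule smooth_on_cong[OF S])
  have nz: "\<rho> y \<noteq> 0" if "y \<in> S" for y
  proof -
    interpret two_frames "V y" "f y" "h y" "f' y" "h' y" by (rule frames[OF that])
    show ?thesis by (rule density_nonzero)
  qed
  show "smooth_on (\<lambda>y. root 3 (6 * scaled_metric y $ 1 $ 1 / scaled_trace y)) S"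
    by (intro smooth_on_root3[OF S] smooth_on_divide[OF S] smooth_on_mult[OF S] smooth_on_const[OF S]
        smooth_scaled_metric smooth_scaled_trace)
      (use nz metric_pos in \<open>force simp: scaled_trace_eq scaled_metric_eq\<close>)+
  show "\<rho> y = root 3 (6 * scaled_metric y $ 1 $ 1 / scaled_trace y)" if y: "y \<in> S" for y
  proof -
    have "6 * scaled_metric y $ 1 $ 1 / scaled_trace y = \<rho> y ^ 3"
      using nz[OF y] metric_pos[OF y] by (simp add: scaled_trace_eq[OF y] scaled_metric_eq[OF y] field_simps eval_nat_numeral)
    \<comment> \<open>The root has odd order, so the sign of \<open>\<rho>\<close> comes out right
      for either orientation of the chart.\<close>
    then show ?thesis by (simp add: odd_real_root_power_cancel)
  qed
qed

lemma density_nonzero': "y \<in> S \<Longrightarrow> \<rho> y \<noteq> 0"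
  by (rule two_frames.density_nonzero[OF frames])

lemma smooth_cometric: "smooth_on (\<lambda>y. \<kappa> y i j) S"
  by (rule smooth_on_cong[OF S smooth_on_mult[OF S smooth_scaled_cometric smooth_density]])
    (simp add: scaled_cometric_eq density_nonzero')

lemma smooth_metric: "smooth_on (\<lambda>y. \<gamma> y (h' y u) (h' y v)) S"
proof (rule smooth_on_cong[OF S])
  show "smooth_on (\<lambda>y. wedge (wedge (int_prod (h' y u) (\<Phi> y)) (int_prod (h' y v) (\<Phi> y))) (\<Phi> y)
      (map (h' y) std_basis) / (6 * \<rho> y)) S"
    by (intro smooth_on_divide[OF S] smooth_on_mult[OF S] smooth_on_const[OF S] smooth_bform smooth_density)
      (simp add: density_nonzero')
  show "\<gamma> y (h' y u) (h' y v) = wedge (wedge (int_prod (h' y u) (\<Phi> y)) (int_prod (h' y v) (\<Phi> y))) (\<Phi> y)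
      (map (h' y) std_basis) / (6 * \<rho> y)" if y: "y \<in> S" for y
  proof -
    interpret two_frames "V y" "f y" "h y" "f' y" "h' y" by (rule frames[OF y])
    show ?thesis using density_nonzero by (subst bform_density) auto
  qed
qed

lemma smooth_psi: "smooth_on (\<lambda>y. \<Psi> y (map (h' y) us)) S"
proof (cases "length us = 4")
  case True
  then obtain a b c d where us: "us = [a, b, c, d]" by (auto simp: length_Suc_conv numeral_eq_Suc)
  show ?thesis
  proof (rule smooth_on_cong[OF S])
    show "smooth_on (\<lambda>y. (\<Sum>i\<in>UNIV. \<Sum>j\<in>UNIV. \<kappa> y i j *
        (\<Phi> y (map (h' y) [ax i, a, b]) * \<Phi> y (map (h' y) [ax j, c, d])))
      - \<gamma> y (h' y a) (h' y c) * \<gamma> y (h' y b) (h' y d) + \<gamma> y (h' y a) (h' y d) * \<gamma> y (h' y b) (h' y c)) S"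
      by (intro smooth_on_sum[OF S] smooth_on_add[OF S] smooth_on_diff[OF S] smooth_on_mult[OF S]
          smooth_cometric smooth_phi smooth_metric)
    fix y assume y: "y \<in> S"
    interpret two_frames "V y" "f y" "h y" "f' y" "h' y" by (rule frames[OF y])
    show "\<Psi> y (map (h' y) us) = (\<Sum>i\<in>UNIV. \<Sum>j\<in>UNIV. \<kappa> y i j *
        (\<Phi> y (map (h' y) [ax i, a, b]) * \<Phi> y (map (h' y) [ax j, c, d])))
      - \<gamma> y (h' y a) (h' y c) * \<gamma> y (h' y b) (h' y d) + \<gamma> y (h' y a) (h' y d) * \<gamma> y (h' y b) (h' y c)"
      unfolding us by (simp add: psi_eq)
  qed
next
  case False
  show ?thesis
  proof (rule smooth_on_cong[OF S smooth_on_const[OF S, of 0]])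
    fix y assume y: "y \<in> S"
    interpret two_frames "V y" "f y" "h y" "f' y" "h' y" by (rule frames[OF y])
    show "\<Psi> y (map (h' y) us) = 0" using False by (intro alt_forms_off[OF psi_alt_forms]) simp
  qed
qed

lemma smooth_inverse_contraction:
  assumes \<eta>: "\<And>y. y \<in> S \<Longrightarrow> \<eta> y \<in> alt_forms (V y) 2"
    and smooth: "\<And>us. length us = 2 \<Longrightarrow> smooth_on (\<lambda>y. \<eta> y (map (h' y) us)) S"
  shows "smooth_on (\<lambda>y. G2_frame.inverse_contraction (V y) (h y) (\<eta> y)
    [linear_frame.cov (V y) (f' y) l, linear_frame.cov (V y) (f' y) l']) S"
proof (rule smooth_on_cong[OF S])
  let ?x = "\<lambda>l y j. \<Sum>i\<in>UNIV. l $ i * \<kappa> y i j"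
  have x: "smooth_on (\<lambda>y. ?x l y j) S" for l j
    by (intro smooth_on_sum[OF S] smooth_on_mult[OF S] smooth_on_const[OF S] smooth_cometric)
  have e: "smooth_on (\<lambda>y. \<eta> y (map (h' y) [ax i, ax j])) S" for i j
    by (rule smooth) simp
  show "smooth_on (\<lambda>y. ((\<Sum>i\<in>UNIV. \<Sum>j\<in>UNIV. \<kappa> y i j * (\<Sum>i'\<in>UNIV. \<Sum>j'\<in>UNIV. \<kappa> y i' j' *
      (\<eta> y (map (h' y) [ax i, ax i']) * (\<Sum>a\<in>UNIV. \<Sum>b\<in>UNIV. ?x l y a * ?x l' y b *
          \<Psi> y (map (h' y) [ax j, ax j', ax a, ax b]))))) / 2
      - (\<Sum>a\<in>UNIV. \<Sum>b\<in>UNIV. ?x l y a * ?x l' y b * \<eta> y (map (h' y) [ax a, ax b]))) / 2) S"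
    by (intro smooth_on_divide[OF S] smooth_on_diff[OF S] smooth_on_sum[OF S, of UNIV]
        smooth_on_mult[OF S] smooth_on_const[OF S] smooth_cometric x e smooth_psi) auto
  fix y assume y: "y \<in> S"
  interpret two_frames "V y" "f y" "h y" "f' y" "h' y" by (rule frames[OF y])
  \<comment> \<open>The coordinates of \<open>sharp l\<close> are explicit in the smooth
    \<open>cometric\<close>, so \<open>sharp l\<close> is expanded along the coordinate frame and
    not along the adapted one.\<close>
  have s: "f' y (sharp l) $ a = ?x l y a" for l a by (simp add: sharp_def)
  have "psiV [u, v, sharp l, sharp l'] =
      (\<Sum>a\<in>UNIV. \<Sum>b\<in>UNIV. ?x l y a * ?x l' y b * psiV [u, v, \<delta> a, \<delta> b])" for u v
  proof -
    have "int_prod v (int_prod u psiV) \<in> alt_forms (V y) 2"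
      using psi_alt_forms by (intro int_prod_alt_forms) (simp add: numeral_eq_Suc)
    from coord.two_form_expand[OF this sharp_in sharp_in] show ?thesis
      by (simp only: int_prod_apply s)
  qed
  moreover have "\<eta> y [sharp l, sharp l'] =
      (\<Sum>a\<in>UNIV. \<Sum>b\<in>UNIV. ?x l y a * ?x l' y b * \<eta> y [\<delta> a, \<delta> b])"
    using coord.two_form_expand[OF \<eta>[OF y] sharp_in sharp_in] by (simp only: s)
  ultimately show "inverse_contraction (\<eta> y) [coord.cov l, coord.cov l'] =
    ((\<Sum>i\<in>UNIV. \<Sum>j\<in>UNIV. cometric i j * (\<Sum>i'\<in>UNIV. \<Sum>j'\<in>UNIV. cometric i' j' *
      (\<eta> y (map (h' y) [ax i, ax i']) * (\<Sum>a\<in>UNIV. \<Sum>b\<in>UNIV. ?x l y a * ?x l' y b *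
          psiV (map (h' y) [ax j, ax j', ax a, ax b]))))) / 2
      - (\<Sum>a\<in>UNIV. \<Sum>b\<in>UNIV. ?x l y a * ?x l' y b * \<eta> y (map (h' y) [ax a, ax b]))) / 2"
    unfolding inverse_contraction_coords[OF \<eta>[OF y]] by simp
qed

end

section \<open>Tangent spaces in charts\<close>

locale smooth_mfd =
  fixes M :: "'a topology" and A :: "('a, 'n::finite) chart set"
  assumes smooth_manifold: "smooth_manifold M A"
begin

abbreviation "T \<equiv> tangent_space A"
abbreviation "range_of c \<equiv> snd c ` fst c"

lemma
  assumes c: "c \<in> A"
  shows openin_chart: "openin M (fst c)"
    and open_range: "open (range_of c)"
    and homeomorphic_chart: "homeomorphic_map (subtopology M (fst c)) (top_of_set (range_of c)) (snd c)"
  using smooth_manifold c by (auto simp: smooth_manifold_def)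

lemma chart_subset: "c \<in> A \<Longrightarrow> fst c \<subseteq> topspace M"
  using openin_chart openin_subset by blast

lemma chart_inv_chart: "c \<in> A \<Longrightarrow> p \<in> fst c \<Longrightarrow> chart_inv c (snd c p) = p"
proof -
  assume c: "c \<in> A" and p: "p \<in> fst c"
  have "inj_on (snd c) (topspace (subtopology M (fst c)))"
    using homeomorphic_chart[OF c] homeomorphic_imp_injective_map by blast
  then have "inj_on (snd c) (fst c)"
    using chart_subset[OF c] by (simp add: topspace_subtopology Int_absorb1)
  then show ?thesis using p by (simp add: chart_inv_def)
qed

lemma chart_inv_in: "y \<in> range_of c \<Longrightarrow> chart_inv c y \<in> fst c"
  by (simp add: chart_inv_def inv_into_into)

lemma chart_inv_topspace: "c \<in> A \<Longrightarrow> y \<in> range_of c \<Longrightarrow> chart_inv c y \<in> topspace M"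
  by (rule subsetD[OF chart_subset chart_inv_in])

lemma open_overlap:
  assumes c: "c \<in> A" and d: "d \<in> A"
  shows "open (snd c ` (fst c \<inter> fst d))"
proof -
  have "openin (subtopology M (fst c)) (fst c \<inter> fst d)"
    using openin_chart[OF d] by (auto simp: openin_subtopology)
  moreover have "open_map (subtopology M (fst c)) (top_of_set (range_of c)) (snd c)"
    using homeomorphic_chart[OF c] homeomorphic_imp_open_map by blast
  ultimately have "openin (top_of_set (range_of c)) (snd c ` (fst c \<inter> fst d))"
    by (simp add: open_map_def)
  then show ?thesis using open_range[OF c] openin_open_trans by blast
qed

abbreviation "jac c d p \<equiv> frechet_derivative (transition c d) (at (snd c p))"

lemma transition_has_derivative:
  assumes "c \<in> charts_at A p" "d \<in> charts_at A p"
  shows "(transition c d has_derivative jac c d p) (at (snd c p))"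
proof -
  have "smooth_on (transition c d) (snd c ` (fst c \<inter> fst d))"
    using smooth_manifold assms by (auto simp: smooth_manifold_def charts_at_def)
  then have "Ck_on (Suc 0) (transition c d) (snd c ` (fst c \<inter> fst d))"
    unfolding smooth_on_def by blast
  moreover have "snd c p \<in> snd c ` (fst c \<inter> fst d)"
    using assms by (auto simp: charts_at_def)
  ultimately show ?thesis by (rule Ck_on_Suc_has_derivative)
qed

lemma linear_jac: "c \<in> charts_at A p \<Longrightarrow> d \<in> charts_at A p \<Longrightarrow> linear (jac c d p)"
  using transition_has_derivative has_derivative_linear by blast

lemma transition_apply: "c \<in> A \<Longrightarrow> p \<in> fst c \<Longrightarrow> transition c d (snd c p) = snd d p"
  by (simp add: transition_def chart_inv_chart)

lemma jac_self: "c \<in> charts_at A p \<Longrightarrow> jac c c p u = u"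
proof -
  assume c: "c \<in> charts_at A p"
  then have "c \<in> A" "p \<in> fst c" by (auto simp: charts_at_def)
  then have "(transition c c has_derivative (\<lambda>x. x)) (at (snd c p))"
    by (intro has_derivative_transform_within_open[OF has_derivative_ident open_range[of c]])
      (auto simp: transition_apply)
  from frechet_derivative_at[OF this] show ?thesis by metis
qed

text \<open>The composite of two transition maps agrees with the direct one on the image of the
  overlap of \<open>c\<close> and \<open>d\<close>. This is an open neighbourhood of the point, so
  the derivatives agree by the chain rule.\<close>

lemma jac_chain:
  assumes c: "c \<in> charts_at A p" and d: "d \<in> charts_at A p" and e: "e \<in> charts_at A p"
  shows "jac d e p (jac c d p u) = jac c e p u"
proof -
  have A: "c \<in> A" "d \<in> A" "p \<in> fst c" "p \<in> fst d" using c d by (auto simp: charts_at_def)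
  have "(transition d e has_derivative jac d e p) (at (transition c d (snd c p)))"
    using transition_has_derivative[OF d e] A by (simp add: transition_apply)
  from diff_chain_at[OF transition_has_derivative[OF c d] this]
  have "((transition d e \<circ> transition c d) has_derivative (jac d e p \<circ> jac c d p)) (at (snd c p))" .
  then have "(transition c e has_derivative (jac d e p \<circ> jac c d p)) (at (snd c p))"
    by (rule has_derivative_transform_within_open[OF _ open_overlap[of c d]])
      (use A in \<open>auto simp: transition_apply\<close>)
  from frechet_derivative_at[OF this] show ?thesis by (metis comp_apply)
qed

lemma tangent_spaceI:
  assumes "\<And>c. c \<notin> charts_at A p \<Longrightarrow> v c = 0"
    and "\<And>c d. c \<in> charts_at A p \<Longrightarrow> d \<in> charts_at A p \<Longrightarrow> v d = jac c d p (v c)"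
  shows "v \<in> T p"
  using assms unfolding tangent_space_def by blast

lemma tangent_space_off: "v \<in> T p \<Longrightarrow> c \<notin> charts_at A p \<Longrightarrow> v c = 0"
  unfolding tangent_space_def by blast

lemma tangent_space_jac:
  "v \<in> T p \<Longrightarrow> c \<in> charts_at A p \<Longrightarrow> d \<in> charts_at A p \<Longrightarrow> jac c d p (v c) = v d"
  by (rule sym) (unfold tangent_space_def, blast)

lemma subspace_tangent_space: "subspace (T p)"
proof (rule subspaceI)
  show "0 \<in> T p"
    by (rule tangent_spaceI) (simp_all add: linear_0[OF linear_jac])
next
  fix u v assume "u \<in> T p" "v \<in> T p"
  then show "u + v \<in> T p"
    by (intro tangent_spaceI) (simp_all add: linear_add[OF linear_jac] tangent_space_off tangent_space_jac)
next
  fix r u assume "u \<in> T p"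
  then show "r *\<^sub>R u \<in> T p"
    by (intro tangent_spaceI) (simp_all add: linear_scale[OF linear_jac] tangent_space_off tangent_space_jac)
qed

text \<open>A tangent vector is determined by its components in one chart; that arbitrary components
  extend consistently to the other charts is the chain rule for transition maps.\<close>

lemma coord_frame:
  assumes c: "c \<in> A" "p \<in> fst c"
  shows "linear_frame (T p) (\<lambda>v. v c) (coord_vector A p c)"
proof
  have cp: "c \<in> charts_at A p" using c by (simp add: charts_at_def)
  show "subspace (T p)" by (rule subspace_tangent_space)
  show "coord_vector A p c x \<in> T p" for x
    by (rule tangent_spaceI) (simp_all add: coord_vector_def jac_chain[OF cp])
  show "coord_vector A p c x c = x" for x
    using cp by (simp add: coord_vector_def jac_self)
  show "coord_vector A p c (v c) = v" if "v \<in> T p" for v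
  proof (rule ext)
    show "coord_vector A p c (v c) d = v d" for d
      using that cp by (simp add: coord_vector_def tangent_space_off tangent_space_jac)
  qed
qed simp_all

lemma coord_covector_eq:
  assumes c: "c \<in> A" "p \<in> fst c"
  shows "coord_covector A p c = linear_frame.cov (T p) (\<lambda>v. v c)"
  by (intro ext) (simp add: coord_covector_def linear_frame.cov_def[OF coord_frame[OF c]])

section \<open>Spaces of smooth fields\<close>

lemma smooth_formsI:
  assumes "\<And>p. p \<in> topspace M \<Longrightarrow> \<omega> p \<in> alt_forms (T p) k"
    and "\<And>p. p \<notin> topspace M \<Longrightarrow> \<omega> p = 0"
    and "\<And>c us. c \<in> A \<Longrightarrow> length us = k \<Longrightarrow>
      smooth_on (\<lambda>y. \<omega> (chart_inv c y) (map (coord_vector A (chart_inv c y) c) us)) (range_of c)"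
  shows "\<omega> \<in> smooth_forms M A k"
  using assms unfolding smooth_forms_def form_in_chart_def[abs_def] by blast

lemma
  assumes "\<omega> \<in> smooth_forms M A k"
  shows smooth_forms_alt: "p \<in> topspace M \<Longrightarrow> \<omega> p \<in> alt_forms (T p) k"
    and smooth_forms_off: "p \<notin> topspace M \<Longrightarrow> \<omega> p = 0"
    and smooth_forms_component: "c \<in> A \<Longrightarrow> length us = k \<Longrightarrow>
      smooth_on (\<lambda>y. \<omega> (chart_inv c y) (map (coord_vector A (chart_inv c y) c) us)) (range_of c)"
  using assms unfolding smooth_forms_def form_in_chart_def[abs_def] by blast+

lemma smooth_multivectorsI:
  assumes "\<And>p. p \<in> topspace M \<Longrightarrow> Q p \<in> multivectors (T p) k"
    and "\<And>p. p \<notin> topspace M \<Longrightarrow> Q p = 0"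
    and "\<And>c ls. c \<in> A \<Longrightarrow> length ls = k \<Longrightarrow>
      smooth_on (\<lambda>y. Q (chart_inv c y) (map (coord_covector A (chart_inv c y) c) ls)) (range_of c)"
  shows "Q \<in> smooth_multivectors M A k"
  using assms unfolding smooth_multivectors_def by blast

lemma
  assumes "Q \<in> smooth_multivectors M A k"
  shows smooth_multivectors_alt: "p \<in> topspace M \<Longrightarrow> Q p \<in> multivectors (T p) k"
    and smooth_multivectors_off: "p \<notin> topspace M \<Longrightarrow> Q p = 0"
    and smooth_multivectors_component: "c \<in> A \<Longrightarrow> length ls = k \<Longrightarrow>
      smooth_on (\<lambda>y. Q (chart_inv c y) (map (coord_covector A (chart_inv c y) c) ls)) (range_of c)"
  using assms unfolding smooth_multivectors_def by blast+

text \<open>Lists of the wrong length give the constant 0. The version for all lists supplies the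
  assumption of \<open>smooth_frames\<close>, where wedge products split lists into parts of every
  length.\<close>

lemma smooth_forms_component':
  assumes \<omega>: "\<omega> \<in> smooth_forms M A k" and c: "c \<in> A"
  shows "smooth_on (\<lambda>y. \<omega> (chart_inv c y) (map (coord_vector A (chart_inv c y) c) us)) (range_of c)"
proof (cases "length us = k")
  case False
  show ?thesis
  proof (rule smooth_on_cong[OF open_range[OF c] smooth_on_const[OF open_range[OF c], of 0]])
    fix y assume "y \<in> range_of c"
    then have "\<omega> (chart_inv c y) \<in> alt_forms (T (chart_inv c y)) k"
      by (intro smooth_forms_alt[OF \<omega>] chart_inv_topspace[OF c])
    from alt_forms_off[OF this] show "\<omega> (chart_inv c y) (map (coord_vector A (chart_inv c y) c) us) = 0"
      using False by simp
  qed
qed (rule smooth_forms_component[OF \<omega> c])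

lemma subspace_smooth_forms: "subspace (smooth_forms M A k)"
proof (rule subspaceI)
  show "0 \<in> smooth_forms M A k"
    by (rule smooth_formsI)
      (simp_all add: subspace_0[OF subspace_alt_forms] smooth_on_const[OF open_range])
next
  fix x y assume x: "x \<in> smooth_forms M A k" and y: "y \<in> smooth_forms M A k"
  show "x + y \<in> smooth_forms M A k"
    by (rule smooth_formsI)
      (simp_all add: subspace_add[OF subspace_alt_forms] smooth_on_add[OF open_range]
        smooth_forms_alt[OF x] smooth_forms_alt[OF y] smooth_forms_off[OF x] smooth_forms_off[OF y]
        smooth_forms_component[OF x] smooth_forms_component[OF y])
next
  fix r x assume x: "x \<in> smooth_forms M A k"
  show "r *\<^sub>R x \<in> smooth_forms M A k"
    by (rule smooth_formsI)
      (simp_all add: subspace_scale[OF subspace_alt_forms] smooth_on_mult[OF open_range]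
        smooth_on_const[OF open_range] smooth_forms_alt[OF x] smooth_forms_off[OF x]
        smooth_forms_component[OF x])
qed

lemma subspace_smooth_multivectors: "subspace (smooth_multivectors M A k)"
proof (rule subspaceI)
  show "0 \<in> smooth_multivectors M A k"
    by (rule smooth_multivectorsI)
      (simp_all add: subspace_0[OF subspace_multivectors] smooth_on_const[OF open_range])
next
  fix x y assume x: "x \<in> smooth_multivectors M A k" and y: "y \<in> smooth_multivectors M A k"
  show "x + y \<in> smooth_multivectors M A k"
    by (rule smooth_multivectorsI)
      (simp_all add: subspace_add[OF subspace_multivectors] smooth_on_add[OF open_range]
        smooth_multivectors_alt[OF x] smooth_multivectors_alt[OF y] smooth_multivectors_off[OF x]
        smooth_multivectors_off[OF y] smooth_multivectors_component[OF x] smooth_multivectors_component[OF y])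
next
  fix r x assume x: "x \<in> smooth_multivectors M A k"
  show "r *\<^sub>R x \<in> smooth_multivectors M A k"
    by (rule smooth_multivectorsI)
      (simp_all add: subspace_scale[OF subspace_multivectors] smooth_on_mult[OF open_range]
        smooth_on_const[OF open_range] smooth_multivectors_alt[OF x] smooth_multivectors_off[OF x]
        smooth_multivectors_component[OF x])
qed

end

text \<open>Off the manifold both fields are 0, but \<open>contract2\<close> is still a definite
  description to be resolved: every decomposition contracts the zero form to 0, and the empty list
  decomposes the zero bivector.\<close>

lemma contract2_zero: "contract2 V 0 0 = 0"
  unfolding contract2_def
proof (rule the_equality)
  have z: "(\<Sum>(X, Y)\<leftarrow>XYs. int_prod Y (int_prod X 0)) = 0" for XYs :: "('a \<times> 'a) list"
  proof (induction XYs)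
    case (Cons XY XYs)
    obtain X Y where "XY = (X, Y)" by force
    with Cons show ?case by (simp only: list.map sum_list.Cons prod.case int_prod_zero add_0)
  qed simp
  show "\<exists>XYs. set XYs \<subseteq> V \<times> V \<and> 0 = (\<Sum>(X, Y)\<leftarrow>XYs. wedge (eval_at V X) (eval_at V Y)) \<and>
      0 = (\<Sum>(X, Y)\<leftarrow>XYs. int_prod Y (int_prod X 0))"
    by (rule exI[of _ "[]"]) simp
  fix \<eta> assume "\<exists>XYs. set XYs \<subseteq> V \<times> V \<and> 0 = (\<Sum>(X, Y)\<leftarrow>XYs. wedge (eval_at V X) (eval_at V Y)) \<and>
      \<eta> = (\<Sum>(X, Y)\<leftarrow>XYs. int_prod Y (int_prod X 0))"
  then show "\<eta> = 0" using z by auto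
qed

section \<open>Contraction with the dual 4-form field\<close>

locale G2_mfd = smooth_mfd M A for M :: "'a topology" and A :: "('a, 7) chart set" +
  fixes \<phi> :: "('a, 7) form_field"
  assumes G2: "G2_structure M A \<phi>"
begin

text \<open>A pointwise choice; nothing is claimed about how the frame varies with
  \<open>p\<close>.\<close>

definition frame_choice where
  "frame_choice p = (SOME fh. G2_frame (T p) (fst fh) (snd fh) \<and> \<phi> p = linear_frame.push (T p) (fst fh) phi0)"

abbreviation "F p \<equiv> fst (frame_choice p)"
abbreviation "H p \<equiv> snd (frame_choice p)"
abbreviation "star \<equiv> star_phi M A \<phi>"

lemma
  assumes p: "p \<in> topspace M"
  shows frame: "G2_frame (T p) (F p) (H p)"
    and phi_eq: "\<phi> p = linear_frame.push (T p) (F p) phi0"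
proof -
  have "G2_form (T p) (\<phi> p)" using G2 p by (simp add: G2_structure_def)
  then obtain f h where "G2_frame (T p) f h" "\<phi> p = linear_frame.push (T p) f phi0"
    using G2_formE[OF subspace_tangent_space] by blast
  then have "G2_frame (T p) (fst (f, h)) (snd (f, h)) \<and> \<phi> p = linear_frame.push (T p) (fst (f, h)) phi0"
    by simp
  then have "G2_frame (T p) (F p) (H p) \<and> \<phi> p = linear_frame.push (T p) (F p) phi0"
    unfolding frame_choice_def by (rule someI)
  then show "G2_frame (T p) (F p) (H p)" "\<phi> p = linear_frame.push (T p) (F p) phi0" by auto
qed

lemma star_eq: "p \<in> topspace M \<Longrightarrow> star p = linear_frame.push (T p) (F p) psi0"
proof -
  assume p: "p \<in> topspace M"
  then interpret G2_frame "T p" "F p" "H p" by (rule frame)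
  show ?thesis
    by (simp add: star_phi_def p phi_eq G2_metric_vol_eq hodge_star_phi)
qed

lemma smooth_frames_chart:
  assumes c: "c \<in> A"
  shows "smooth_frames (range_of c) (\<lambda>y. T (chart_inv c y)) (\<lambda>y. F (chart_inv c y))
    (\<lambda>y. H (chart_inv c y)) (\<lambda>y v. v c) (\<lambda>y. coord_vector A (chart_inv c y) c)"
proof (rule smooth_frames.intro)
  show "open (range_of c)" by (rule open_range[OF c])
next
  fix y assume y: "y \<in> range_of c"
  then have p: "chart_inv c y \<in> fst c" "chart_inv c y \<in> topspace M"
    by (simp_all add: chart_inv_in chart_inv_topspace[OF c])
  show "two_frames (T (chart_inv c y)) (F (chart_inv c y)) (H (chart_inv c y)) (\<lambda>v. v c)
      (coord_vector A (chart_inv c y) c)"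
    by (intro two_frames.intro frame[OF p(2)] coord_frame[OF c p(1)])
next
  fix us
  have "\<phi> \<in> smooth_forms M A 3" using G2 by (simp add: G2_structure_def)
  from smooth_forms_component'[OF this c]
  show "smooth_on (\<lambda>y. linear_frame.push (T (chart_inv c y)) (F (chart_inv c y)) phi0
      (map (coord_vector A (chart_inv c y) c) us)) (range_of c)"
  proof (rule smooth_on_cong[OF open_range[OF c]])
    fix y assume "y \<in> range_of c"
    then have "chart_inv c y \<in> topspace M" by (rule chart_inv_topspace[OF c])
    then show "linear_frame.push (T (chart_inv c y)) (F (chart_inv c y)) phi0
        (map (coord_vector A (chart_inv c y) c) us) =
        \<phi> (chart_inv c y) (map (coord_vector A (chart_inv c y) c) us)"
      by (simp add: phi_eq)
  qed
qed

lemma contract_field_off: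
  assumes "p \<notin> topspace M" "Q p = 0"
  shows "contract_field A Q star p = 0"
  using assms by (simp add: contract_field_def star_phi_def contract2_zero)

lemma contract_field_smooth:
  assumes Q: "Q \<in> smooth_multivectors M A 2"
  shows "contract_field A Q star \<in> smooth_forms M A 2"
proof (rule smooth_formsI)
  show "contract_field A Q star p \<in> alt_forms (T p) 2" if p: "p \<in> topspace M" for p
  proof -
    interpret G2_frame "T p" "F p" "H p" by (rule frame[OF p])
    show ?thesis
      using Q p psi_alt_forms
      by (simp add: contract_field_def star_eq smooth_multivectors_def contract2_alt_forms)
  qed
  show "contract_field A Q star p = 0" if "p \<notin> topspace M" for p
    using Q that by (intro contract_field_off) (auto simp: smooth_multivectors_def)
  show "smooth_on (\<lambda>y. contract_field A Q star (chart_inv c y) (map (coord_vector A (chart_inv c y) c) us)) (range_of c)"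
    if c: "c \<in> A" for c us
  proof -
    interpret smooth_frames "range_of c" "\<lambda>y. T (chart_inv c y)" "\<lambda>y. F (chart_inv c y)"
      "\<lambda>y. H (chart_inv c y)" "\<lambda>y v. v c" "\<lambda>y. coord_vector A (chart_inv c y) c"
      by (rule smooth_frames_chart[OF c])
    let ?q = "\<lambda>i j y. Q (chart_inv c y) (map (coord_covector A (chart_inv c y) c) [ax i, ax j])"
    show ?thesis
    proof (rule smooth_on_cong[OF S])
      have "smooth_on (?q i j) (range_of c)" for i j
        by (rule smooth_multivectors_component[OF Q c]) simp
      then show "smooth_on (\<lambda>y. (\<Sum>i\<in>UNIV. \<Sum>j\<in>UNIV. ?q i j y *
          \<Psi> y (map (coord_vector A (chart_inv c y) c) (ax i # ax j # us))) / 2) (range_of c)"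
        by (intro smooth_on_divide[OF S] smooth_on_sum[OF S] smooth_on_mult[OF S] smooth_psi
            smooth_on_const[OF S]) simp_all
      fix y assume y: "y \<in> range_of c"
      then have p: "chart_inv c y \<in> fst c" "chart_inv c y \<in> topspace M"
        by (simp_all add: chart_inv_in chart_inv_topspace[OF c])
      interpret G2_frame "T (chart_inv c y)" "F (chart_inv c y)" "H (chart_inv c y)" by (rule frame[OF p(2)])
      have "Q (chart_inv c y) \<in> multivectors (T (chart_inv c y)) 2"
        using Q p by (simp add: smooth_multivectors_def)
      \<comment> \<open>The contraction formula holds in any frame; it is used in the coordinate
        frame, where each of its terms is smooth.\<close>
      from linear_frame.contract2_eq[OF coord_frame[OF c p(1)] this psi_alt_forms]
      show "contract_field A Q star (chart_inv c y) (map (coord_vector A (chart_inv c y) c) us) = (\<Sum>i\<in>UNIV. \<Sum>j\<in>UNIV. ?q i j y *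
          \<Psi> y (map (coord_vector A (chart_inv c y) c) (ax i # ax j # us))) / 2"
        by (simp add: contract_field_def star_eq[OF p(2)] coord_covector_eq[OF c p(1)])
    qed
  qed
qed

text \<open>A definite description is not visibly linear; pointwise, \<open>contract2_eq\<close>
  exhibits the contraction as linear in the components of the bivector.\<close>

lemma contract_field_combination:
  assumes Q: "Q \<in> smooth_multivectors M A 2" "R \<in> smooth_multivectors M A 2"
  shows "contract_field A (a *\<^sub>R Q + b *\<^sub>R R) star =
    a *\<^sub>R contract_field A Q star + b *\<^sub>R contract_field A R star"
proof (rule ext)
  fix p
  show "contract_field A (a *\<^sub>R Q + b *\<^sub>R R) star p =
    (a *\<^sub>R contract_field A Q star + b *\<^sub>R contract_field A R star) p"
  proof (cases "p \<in> topspace M")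
    case True
    interpret G2_frame "T p" "F p" "H p" by (rule frame[OF True])
    have QR: "Q p \<in> multivectors (T p) 2" "R p \<in> multivectors (T p) 2"
      using Q True by (auto simp: smooth_multivectors_def)
    then have "a *\<^sub>R Q p + b *\<^sub>R R p \<in> multivectors (T p) 2"
      by (intro subspace_add subspace_scale subspace_multivectors)
    then show ?thesis
      by (simp add: contract_field_def star_eq[OF True] contract2_eq[OF _ psi_alt_forms] QR fun_eq_iff
          distrib_right sum.distrib add_divide_distrib sum_distrib_left mult.assoc)
  next
    case False
    then have "Q p = 0" "R p = 0" using Q by (auto simp: smooth_multivectors_def)
    then show ?thesis by (simp add: contract_field_off False)
  qed
qed

definition inverse_field :: "('a, 7) form_field \<Rightarrow> ('a, 7) multivector_field" where
  "inverse_field \<omega> p = (if p \<in> topspace M then G2_frame.inverse_contraction (T p) (H p) (\<omega> p) else 0)"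

lemma inverse_field_smooth:
  assumes \<omega>: "\<omega> \<in> smooth_forms M A 2"
  shows "inverse_field \<omega> \<in> smooth_multivectors M A 2"
proof (rule smooth_multivectorsI)
  show "inverse_field \<omega> p \<in> multivectors (T p) 2" if p: "p \<in> topspace M" for p
  proof -
    interpret G2_frame "T p" "F p" "H p" by (rule frame[OF p])
    show ?thesis by (simp add: inverse_field_def p inverse_contraction_def bivector_multivectors)
  qed
  show "inverse_field \<omega> p = 0" if "p \<notin> topspace M" for p
    using that by (simp add: inverse_field_def)
  show "smooth_on (\<lambda>y. inverse_field \<omega> (chart_inv c y) (map (coord_covector A (chart_inv c y) c) ls)) (range_of c)"
    if c: "c \<in> A" and "length ls = 2" for c ls
  proof -
    interpret smooth_frames "range_of c" "\<lambda>y. T (chart_inv c y)" "\<lambda>y. F (chart_inv c y)"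
      "\<lambda>y. H (chart_inv c y)" "\<lambda>y v. v c" "\<lambda>y. coord_vector A (chart_inv c y) c"
      by (rule smooth_frames_chart[OF c])
    obtain l l' where ls: "ls = [l, l']" using \<open>length ls = 2\<close> by (auto simp: length_Suc_conv numeral_2_eq_2)
    have p: "chart_inv c y \<in> fst c" "chart_inv c y \<in> topspace M" if "y \<in> range_of c" for y
      by (rule chart_inv_in[OF that] chart_inv_topspace[OF c that])+
    have "smooth_on (\<lambda>y. G2_frame.inverse_contraction (T (chart_inv c y)) (H (chart_inv c y)) (\<omega> (chart_inv c y))
        [linear_frame.cov (T (chart_inv c y)) (\<lambda>v. v c) l, linear_frame.cov (T (chart_inv c y)) (\<lambda>v. v c) l'])
        (range_of c)"
    proof (rule smooth_inverse_contraction)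
      show "\<omega> (chart_inv c y) \<in> alt_forms (T (chart_inv c y)) 2" if "y \<in> range_of c" for y
        using \<omega> p[OF that] by (simp add: smooth_forms_def)
    qed (rule smooth_forms_component'[OF \<omega> c])
    then show ?thesis
      by (rule smooth_on_cong[OF S]) (simp add: ls inverse_field_def p coord_covector_eq[OF c])
  qed
qed

lemma contract_inverse_field:
  assumes \<omega>: "\<omega> \<in> smooth_forms M A 2"
  shows "contract_field A (inverse_field \<omega>) star = \<omega>"
proof (rule ext)
  fix p
  show "contract_field A (inverse_field \<omega>) star p = \<omega> p"
  proof (cases "p \<in> topspace M")
    case True
    interpret G2_frame "T p" "F p" "H p" by (rule frame[OF True])
    show ?thesis using \<omega> True
      by (simp add: contract_field_def star_eq inverse_field_def contract_inverse_contraction smooth_forms_def)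
  next
    case False
    then show ?thesis using \<omega> by (simp add: contract_field_off inverse_field_def smooth_forms_def)
  qed
qed

lemma inverse_contract_field:
  assumes Q: "Q \<in> smooth_multivectors M A 2"
  shows "inverse_field (contract_field A Q star) = Q"
proof (rule ext)
  fix p
  show "inverse_field (contract_field A Q star) p = Q p"
  proof (cases "p \<in> topspace M")
    case True
    interpret G2_frame "T p" "F p" "H p" by (rule frame[OF True])
    show ?thesis using Q True
      by (simp add: contract_field_def star_eq inverse_field_def inverse_contraction_contract smooth_multivectors_def)
  next
    case False
    then show ?thesis using Q by (simp add: inverse_field_def smooth_multivectors_def)
  qed
qed

lemma linear_iso_contract_field:
  "linear_iso (smooth_multivectors M A 2) (smooth_forms M A 2) (\<lambda>Q. contract_field A Q star)"
  unfolding linear_iso_def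
proof (intro conjI ballI allI)
  show "subspace (smooth_multivectors M A 2)" by (rule subspace_smooth_multivectors)
  show "subspace (smooth_forms M A 2)" by (rule subspace_smooth_forms)
  show "contract_field A (Q + R) star = contract_field A Q star + contract_field A R star"
    if "Q \<in> smooth_multivectors M A 2" "R \<in> smooth_multivectors M A 2" for Q R
    using contract_field_combination[OF that, of 1 1] by simp
  show "contract_field A (r *\<^sub>R Q) star = r *\<^sub>R contract_field A Q star"
    if "Q \<in> smooth_multivectors M A 2" for r Q
    using contract_field_combination[OF that that, of r 0] by simp
  show "bij_betw (\<lambda>Q. contract_field A Q star) (smooth_multivectors M A 2) (smooth_forms M A 2)"
    by (rule bij_betwI[where g = inverse_field])
      (auto simp: contract_field_smooth inverse_field_smooth contract_inverse_field inverse_contract_field)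
qed

end

theorem lemma3p3:
  fixes M :: "'a topology" and A :: "('a, 7) chart set" and \<phi> :: "('a, 7) form_field"
  assumes "smooth_manifold M A"
    and "G2_structure M A \<phi>"
    and "coclosed M A \<phi>"
  shows "linear_iso (smooth_multivectors M A 2) (smooth_forms M A 2)
           (\<lambda>Q. contract_field A Q (star_phi M A \<phi>))"
proof -
  interpret G2_mfd M A \<phi>
    using assms(1,2) by unfold_locales
  show ?thesis by (rule linear_iso_contract_field)
qed

end
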